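(* There exist absolute constants $c>0$ and $k_0$ such that for every integer $k\ge k_0$, $\tau(T_k)\ge c\,k$, where $T_k$ is the complete binary tree of height $k$ (with $2^{k+1}-1$ vertices). That is, $\tau(T_k)=\Omega(k)$.
   Context: Graphs are simple. For a finite graph $G$ and $\theta:E(G)\to\mathbb{R}$, let $\Delta_\theta(F)=|V(F)|-\sum_{e\in E(F)}\theta(e)$ for subgraphs $F\subseteq G$ (subgraphs have no isolated vertices). A threshold weighting for $G$ is $\theta:E(G)\to[0,2]$ with $\Delta_\theta(F)\ge 0$ for all $F\subseteq G$ and $\Delta_\theta(G)=0$. For a vertex set $S$, $F\ominus S$ is the union of the connected components of $F$ that are vertex-disjoint from $S$. Join-trees: a join-tree over $G$ is a finite rooted binary tree (each non-leaf node has two ordered children) whose leaves are labeled by elements of $E(G)\cup\{\bot\}$; its graph $\langle A\rangle$ is the subgraph of $G$ whose edges are the edge labels occurring in $A$; $V(A)=V(\langle A\rangle)$. $[B,C]$ denotes the join-tree whose root has children $B,C$; one-node join-trees are atomic. Pathsets (fix $\theta$ and a positive integer $n$): for finite $U$, a relation is a subset of $[n]^U$, with density $\mu(\mathcal A)=|\mathcal A|/n^{|U|}$ ($[n]^\emptyset$ has one element). For $x\in[n]^V$, $x_U$ is its restriction to $U\subseteq V$. Join: for $\mathcal B\subseteq[n]^V,\mathcal C\subseteq[n]^W$, $\mathcal B\bowtie\mathcal C=\{z\in[n]^{V\cup W}: z_V\in\mathcal B,\ z_W\in\mathcal C\}$. Restriction: for $\mathcal A\subseteq[n]^V$ and $z\in[n]^T$,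 $\rho_{V\setminus T}(\mathcal A,z)=\{x\in[n]^{V\setminus T}:\exists y\in\mathcal A,\ y_{V\setminus T}=x,\ y_{V\cap T}=z_{V\cap T}\}$. For $F\subseteq G$ and $S\subseteq V(G)$, a relation $\mathcal A\subseteq[n]^{V(F)\setminus S}$ is an $F|S$-pathset if $\mu(\rho_{V(F)\setminus T}(\mathcal A,z))\le n^{-\Delta_\theta(F\ominus T)}$ for all $T$ with $S\subseteq T\subseteq V(G)$ and all $z\in[n]^T$. Pathset complexity $\chi_{\theta,n,A|S}(\mathcal A)$ for $\mathcal A\subseteq[n]^{V(A)\setminus S}$: if $A$ is atomic, it is the minimum number $m$ of $\langle A\rangle|S$-pathsets whose union contains $\mathcal A$; if $A=[B,C]$, it is the minimum of $\sum_{i=1}^m\max\{\chi_{\theta,n,B|S}(\mathcal B_i),\chi_{\theta,n,C|S}(\mathcal C_i)\}$ over finite families $(\mathcal A_i,\mathcal B_i,\mathcal C_i)_{i\le m}$ where $\mathcal A_i,\mathcal B_i,\mathcal C_i$ are $\langle A\rangle|S$-, $\langle B\rangle|S$-, $\langle C\rangle|S$-pathsets respectively, $\mathcal A_i\subseteq\mathcal B_i\bowtie\mathcal C_i$, and $\mathcal A\subseteq\bigcup_i\mathcal A_i$. The invariant $\tau(G)$ of a finite graph $G$: the largest real $t\ge 0$ for which there is a threshold weighting $\theta$ for $G$ such that $\chi_{\theta,n,A|\emptyset}(\mathcal A)\ge n^{t}\mu(\mathcal A)$ for every join-tree $A$ over $G$ with $\langle A\rangle=G$, every positive integer $n$ and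 every $\mathcal A\subseteq[n]^{V(G)}$. *)

theory Defs
  imports Complex_Main "HOL-Library.FuncSet"
begin

section \<open>Graphs\<close>

record 'v ugraph =
  verts :: "'v set"
  edges :: "'v set set"

definition simple_graph :: "'v ugraph \<Rightarrow> bool" where
  "simple_graph G \<longleftrightarrow> (\<forall>e\<in>edges G. e \<subseteq> verts G \<and> card e = 2)"

definition finite_graph :: "'v ugraph \<Rightarrow> bool" where
  "finite_graph G \<longleftrightarrow> simple_graph G \<and> finite (verts G)"

text \<open>Subgraphs have no isolated vertices, so their vertex set is determined by their edges.\<close>

definition subgraph :: "'v ugraph \<Rightarrow> 'v ugraph \<Rightarrow> bool" where
  "subgraph F G \<longleftrightarrow> edges F \<subseteq> edges G \<and> verts F = \<Union> (edges F)"

definition reachable_set :: "'v ugraph \<Rightarrow> 'v \<Rightarrow> 'v set" where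
  "reachable_set F v = {w. (v, w) \<in> {(x, y). {x, y} \<in> edges F}\<^sup>*}"

definition component_of :: "'v ugraph \<Rightarrow> 'v \<Rightarrow> 'v ugraph" where
  "component_of F v =
     \<lparr>verts = reachable_set F v, edges = {e \<in> edges F. e \<subseteq> reachable_set F v}\<rparr>"

definition components :: "'v ugraph \<Rightarrow> 'v ugraph set" where
  "components F = component_of F ` verts F"

definition ominus :: "'v ugraph \<Rightarrow> 'v set \<Rightarrow> 'v ugraph"  (infixl "\<ominus>" 65) where
  "F \<ominus> S = (let \<C> = {C \<in> components F. verts C \<inter> S = {}}
            in \<lparr>verts = (\<Union>C\<in>\<C>. verts C), edges = (\<Union>C\<in>\<C>. edges C)\<rparr>)"

section \<open>Threshold weightings\<close>

definition Delta :: "('v set \<Rightarrow> real) \<Rightarrow> 'v ugraph \<Rightarrow> real" where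
  "Delta \<theta> F = real (card (verts F)) - (\<Sum>e\<in>edges F. \<theta> e)"

text \<open>Only the values of \<open>\<theta>\<close> on the edges of \<open>G\<close> matter.\<close>

definition threshold_weighting :: "'v ugraph \<Rightarrow> ('v set \<Rightarrow> real) \<Rightarrow> bool" where
  "threshold_weighting G \<theta> \<longleftrightarrow>
     (\<forall>e\<in>edges G. 0 \<le> \<theta> e \<and> \<theta> e \<le> 2) \<and>
     (\<forall>F. subgraph F G \<longrightarrow> Delta \<theta> F \<ge> 0) \<and>
     Delta \<theta> G = 0"

section \<open>Join-trees\<close>

text \<open>A leaf labelled \<open>\<bottom>\<close> is \<open>Atomic None\<close>.\<close>

datatype (labels: 'e) join_tree =
    Atomic "'e option"
  | Join "'e join_tree" "'e join_tree"

definition graph_of :: "'v set join_tree \<Rightarrow> 'v ugraph" where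
  "graph_of A = \<lparr>verts = \<Union> (labels A), edges = labels A\<rparr>"

definition join_tree_over :: "'v ugraph \<Rightarrow> 'v set join_tree \<Rightarrow> bool" where
  "join_tree_over G A \<longleftrightarrow> labels A \<subseteq> edges G"

section \<open>Relations\<close>

text \<open>
  The set \<open>[n]\<^sup>U\<close> is the extensional function space \<open>U \<rightarrow>\<^sub>E {1..n}\<close>, and \<open>x\<^sub>U\<close> is \<open>restrict x U\<close>.
\<close>

abbreviation cube :: "nat \<Rightarrow> 'v set \<Rightarrow> ('v \<Rightarrow> nat) set" where
  "cube n U \<equiv> U \<rightarrow>\<^sub>E {1..n}"

definition mu :: "nat \<Rightarrow> 'v set \<Rightarrow> ('v \<Rightarrow> nat) set \<Rightarrow> real" where
  "mu n U \<A> = real (card \<A>) / real n ^ card U"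

definition rel_join ::
  "nat \<Rightarrow> 'v set \<Rightarrow> 'v set \<Rightarrow> ('v \<Rightarrow> nat) set \<Rightarrow> ('v \<Rightarrow> nat) set \<Rightarrow> ('v \<Rightarrow> nat) set" where
  "rel_join n V W \<B> \<C> = {z \<in> cube n (V \<union> W). restrict z V \<in> \<B> \<and> restrict z W \<in> \<C>}"

text \<open>\<open>rho n V T \<A> z\<close> is the restriction \<open>\<rho>\<close>, on the coordinates \<open>V - T\<close>, of \<open>\<A> \<subseteq> [n]\<^sup>V\<close> at \<open>z \<in> [n]\<^sup>T\<close>.\<close>

definition rho ::
  "nat \<Rightarrow> 'v set \<Rightarrow> 'v set \<Rightarrow> ('v \<Rightarrow> nat) set \<Rightarrow> ('v \<Rightarrow> nat) \<Rightarrow> ('v \<Rightarrow> nat) set" where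
  "rho n V T \<A> z = {x \<in> cube n (V - T).
     \<exists>y\<in>\<A>. restrict y (V - T) = x \<and> restrict y (V \<inter> T) = restrict z (V \<inter> T)}"

section \<open>Pathsets and pathset complexity\<close>

text \<open>
  In \<open>pathset\<close>, the relation lives on \<open>V(F) - S\<close>; as \<open>S \<subseteq> T\<close>, its restriction at \<open>z \<in> [n]\<^sup>T\<close> lives on
  \<open>V(F) - S - T = V(F) - T\<close>.
\<close>

definition pathset ::
  "'v ugraph \<Rightarrow> ('v set \<Rightarrow> real) \<Rightarrow> nat \<Rightarrow> 'v set \<Rightarrow> 'v ugraph \<Rightarrow> ('v \<Rightarrow> nat) set \<Rightarrow> bool" where
  "pathset G \<theta> n S F \<A> \<longleftrightarrow>
     \<A> \<subseteq> cube n (verts F - S) \<and>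
     (\<forall>T. S \<subseteq> T \<and> T \<subseteq> verts G \<longrightarrow>
       (\<forall>z \<in> cube n T.
          mu n (verts F - T) (rho n (verts F - S) T \<A> z) \<le> real n powr (- Delta \<theta> (F \<ominus> T))))"

text \<open>
  The costs are natural numbers, so both minima are attained as soon as the sets are nonempty; see
  \<open>chi_Atomic_attained\<close> and \<open>chi_Join_attained\<close> below.
\<close>

primrec chi ::
  "'v ugraph \<Rightarrow> ('v set \<Rightarrow> real) \<Rightarrow> nat \<Rightarrow> 'v set \<Rightarrow> 'v set join_tree \<Rightarrow> ('v \<Rightarrow> nat) set \<Rightarrow> nat" where
  "chi G \<theta> n S (Atomic l) \<A> =
     (LEAST m. \<exists>\<P> :: nat \<Rightarrow> ('v \<Rightarrow> nat) set.
        (\<forall>i<m. pathset G \<theta> n S (graph_of (Atomic l)) (\<P> i)) \<and> \<A> \<subseteq> (\<Union>i<m. \<P> i))"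
| "chi G \<theta> n S (Join B C) \<A> =
     (LEAST s. \<exists>m (\<A>s :: nat \<Rightarrow> ('v \<Rightarrow> nat) set) \<B>s \<C>s.
        (\<forall>i<m. pathset G \<theta> n S (graph_of (Join B C)) (\<A>s i) \<and>
               pathset G \<theta> n S (graph_of B) (\<B>s i) \<and>
               pathset G \<theta> n S (graph_of C) (\<C>s i) \<and>
               \<A>s i \<subseteq> rel_join n (verts (graph_of B) - S) (verts (graph_of C) - S) (\<B>s i) (\<C>s i)) \<and>
        \<A> \<subseteq> (\<Union>i<m. \<A>s i) \<and>
        s = (\<Sum>i<m. max (chi G \<theta> n S B (\<B>s i)) (chi G \<theta> n S C (\<C>s i))))"

section \<open>The invariant \<open>\<tau>\<close>\<close>

definition tau_bound :: "'v ugraph \<Rightarrow> real \<Rightarrow> bool" where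
  "tau_bound G t \<longleftrightarrow> 0 \<le> t \<and>
     (\<exists>\<theta>. threshold_weighting G \<theta> \<and>
       (\<forall>A n \<A>. join_tree_over G A \<longrightarrow> graph_of A = G \<longrightarrow> n > 0 \<longrightarrow> \<A> \<subseteq> cube n (verts G) \<longrightarrow>
          real (chi G \<theta> n {} A \<A>) \<ge> real n powr t * mu n (verts G) \<A>))"

text \<open>
  \<open>tau G\<close> is the largest \<open>t\<close> satisfying \<open>tau_bound G\<close>, taken as a supremum so that the definition does not
  presuppose that the maximum is attained. The set is bounded above when \<open>G\<close> is a finite graph without
  isolated vertices (\<open>bdd_above_tau_bound\<close> below); if \<open>G\<close> has isolated vertices, then no join-tree
  has graph \<open>G\<close> and the value is meaningless.
\<close>

definition tau :: "'v ugraph \<Rightarrow> real" where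
  "tau G = Sup {t. tau_bound G t}"

section \<open>Complete binary trees\<close>

text \<open>
  A vertex is the sequence of left/right choices leading to it, most recent choice first; the root
  is \<open>[]\<close>.
\<close>

definition complete_binary_tree :: "nat \<Rightarrow> bool list ugraph" where
  "complete_binary_tree k =
     \<lparr>verts = {xs. length xs \<le> k}, edges = {{xs, b # xs} | xs b. length xs < k}\<rparr>"

section \<open>Sanity checks\<close>

lemma finite_graph_complete_binary_tree: "finite_graph (complete_binary_tree k)"
proof -
  have "finite {xs :: bool list. length xs \<le> k}"
    using finite_lists_length_le[of "UNIV :: bool set" k] by simp
  moreover have "card {xs, b # xs} = 2" for xs :: "bool list" and b
    by (simp add: card_insert_if)
  ultimately show ?thesis
    by (auto simp: finite_graph_def simple_graph_def complete_binary_tree_def)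
qed

lemma card_verts_complete_binary_tree:
  "card (verts (complete_binary_tree k)) = 2 ^ (k + 1) - 1"
proof -
  have "card {xs :: bool list. length xs \<le> k} = (\<Sum>i\<le>k. 2 ^ i)"
    using card_lists_length_le[of "UNIV :: bool set" k] by simp
  also have "\<dots> = 2 ^ (k + 1) - 1"
    using mask_eq_sum_exp_nat[of "k + 1"] by (simp add: lessThan_Suc_atMost atMost_def lessThan_def less_Suc_eq_le)
  finally show ?thesis by (simp add: complete_binary_tree_def)
qed

lemma ominus_subset:
  assumes "verts F = \<Union> (edges F)" and "\<And>e. e \<in> edges F \<Longrightarrow> card e = 2"
  shows "verts (F \<ominus> T) \<subseteq> verts F - T" "edges (F \<ominus> T) \<subseteq> edges F"
proof -
  have *: "reachable_set F v \<subseteq> verts F" if "v \<in> verts F" for v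
  proof
    fix w assume "w \<in> reachable_set F v"
    hence "(v, w) \<in> {(x, y). {x, y} \<in> edges F}\<^sup>*" by (simp add: reachable_set_def)
    thus "w \<in> verts F" using that assms(1) by (induction) auto
  qed
  show "verts (F \<ominus> T) \<subseteq> verts F - T" "edges (F \<ominus> T) \<subseteq> edges F"
    by (auto simp: ominus_def Let_def components_def component_of_def dest: subsetD[OF *])
qed

lemma pathset_subset_cube: "pathset G \<theta> n S F \<A> \<Longrightarrow> \<A> \<subseteq> cube n (verts F - S)"
  by (simp add: pathset_def)

lemma pathset_singleton:
  assumes "finite (verts G)" "simple_graph G" "subgraph F G" "\<forall>e\<in>edges G. 0 \<le> \<theta> e"
    and n: "n > 0" and x: "x \<in> cube n (verts F - S)"
  shows "pathset G \<theta> n S F {x}"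
proof -
  have e2: "card e = 2" "e \<subseteq> verts G" "0 \<le> \<theta> e" if "e \<in> edges F" for e
    using that assms by (auto simp: subgraph_def simple_graph_def)
  have vF: "verts F = \<Union> (edges F)" using assms by (simp add: subgraph_def)
  have "verts F \<subseteq> verts G" unfolding vF using e2(2) by (rule Union_least)
  hence fin: "finite (verts F)" using assms(1) finite_subset by blast
  have "mu n (verts F - T) (rho n (verts F - S) T {x} z) \<le> real n powr (- Delta \<theta> (F \<ominus> T))"
    for T z
  proof -
    note sub = ominus_subset[OF vF e2(1), of T]
    have "rho n (verts F - S) T {x} z \<subseteq> {restrict x (verts F - S - T)}"
      by (auto simp: rho_def)
    hence "card (rho n (verts F - S) T {x} z) \<le> 1"
      using card_mono[of "{restrict x (verts F - S - T)}"] by fastforce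
    hence "mu n (verts F - T) (rho n (verts F - S) T {x} z) \<le> 1 / real n ^ card (verts F - T)"
      unfolding mu_def by (intro divide_right_mono) auto
    also have "\<dots> = real n powr (- real (card (verts F - T)))"
      using n by (simp add: powr_minus powr_realpow inverse_eq_divide)
    also have "\<dots> \<le> real n powr (- Delta \<theta> (F \<ominus> T))"
    proof (rule powr_mono)
      have "(\<Sum>e\<in>edges (F \<ominus> T). \<theta> e) \<ge> 0" using sub e2(3) by (intro sum_nonneg) auto
      moreover have "card (verts (F \<ominus> T)) \<le> card (verts F - T)"
        using sub fin by (intro card_mono) auto
      ultimately show "- real (card (verts F - T)) \<le> - Delta \<theta> (F \<ominus> T)"
        by (simp add: Delta_def)
    qed (use n in auto)
    finally show ?thesis .
  qed
  with x show ?thesis by (auto simp: pathset_def)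
qed

lemma subgraph_graph_of: "join_tree_over G A \<Longrightarrow> subgraph (graph_of A) G"
  by (simp add: join_tree_over_def subgraph_def graph_of_def)

lemma finite_cube: "finite U \<Longrightarrow> finite (cube n U)"
  by (intro finite_PiE) auto

lemma finite_verts_graph_of:
  assumes "finite (verts G)" "simple_graph G" "join_tree_over G A"
  shows "finite (verts (graph_of A))"
proof -
  have "verts (graph_of A) \<subseteq> verts G"
    using assms by (fastforce simp: graph_of_def join_tree_over_def simple_graph_def)
  thus ?thesis using assms(1) finite_subset by blast
qed

lemma Atomic_singletons:
  assumes G: "finite (verts G)" "simple_graph G" "\<forall>e\<in>edges G. 0 \<le> \<theta> e"
    and A: "join_tree_over G (Atomic l)" and n: "n > 0"
    and sub: "\<A> \<subseteq> cube n (verts (graph_of (Atomic l)) - S)"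
  shows "\<exists>\<P>. (\<forall>i<card \<A>. pathset G \<theta> n S (graph_of (Atomic l)) (\<P> i)) \<and> \<A> \<subseteq> (\<Union>i<card \<A>. \<P> i)"
proof -
  have "finite \<A>"
    by (rule finite_subset[OF sub finite_cube[OF finite_Diff[OF finite_verts_graph_of[OF G(1,2) A]]]])
  then obtain f where f: "bij_betw f {..<card \<A>} \<A>"
    using ex_bij_betw_nat_finite by (metis atLeast0LessThan)
  have fA: "f i \<in> \<A>" if "i < card \<A>" for i using bij_betwE[OF f] that by auto
  have "\<forall>i<card \<A>. pathset G \<theta> n S (graph_of (Atomic l)) {f i}"
  proof (intro allI impI)
    fix i assume i: "i < card \<A>"
    have "f i \<in> cube n (verts (graph_of (Atomic l)) - S)" using sub fA[OF i] by (rule subsetD)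
    with G n show "pathset G \<theta> n S (graph_of (Atomic l)) {f i}"
      by (intro pathset_singleton subgraph_graph_of[OF A])
  qed
  moreover have "\<A> \<subseteq> (\<Union>i<card \<A>. {f i})" using f by (auto simp: bij_betw_def)
  ultimately show ?thesis by (intro exI[of _ "\<lambda>i. {f i}"] conjI)
qed

lemma Join_singletons:
  assumes G: "finite (verts G)" "simple_graph G" "\<forall>e\<in>edges G. 0 \<le> \<theta> e"
    and A: "join_tree_over G (Join B C)" and n: "n > 0"
    and sub: "\<A> \<subseteq> cube n (verts (graph_of (Join B C)) - S)"
  shows "\<exists>\<A>s \<B>s \<C>s.
        (\<forall>i<card \<A>. pathset G \<theta> n S (graph_of (Join B C)) (\<A>s i) \<and>
               pathset G \<theta> n S (graph_of B) (\<B>s i) \<and>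
               pathset G \<theta> n S (graph_of C) (\<C>s i) \<and>
               \<A>s i \<subseteq> rel_join n (verts (graph_of B) - S) (verts (graph_of C) - S) (\<B>s i) (\<C>s i)) \<and>
        \<A> \<subseteq> (\<Union>i<card \<A>. \<A>s i)"
proof -
  have BC: "join_tree_over G B" "join_tree_over G C"
    using A by (auto simp: join_tree_over_def)
  have "finite \<A>"
    by (rule finite_subset[OF sub finite_cube[OF finite_Diff[OF finite_verts_graph_of[OF G(1,2) A]]]])
  then obtain f where f: "bij_betw f {..<card \<A>} \<A>"
    using ex_bij_betw_nat_finite by (metis atLeast0LessThan)
  have fA: "f i \<in> \<A>" if "i < card \<A>" for i using bij_betwE[OF f] that by auto
  let ?B = "verts (graph_of B) - S" and ?C = "verts (graph_of C) - S"
  let ?fB = "\<lambda>i. {restrict (f i) ?B}" and ?fC = "\<lambda>i. {restrict (f i) ?C}"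
  have V: "verts (graph_of (Join B C)) - S = ?B \<union> ?C" by (auto simp: graph_of_def)
  have "pathset G \<theta> n S (graph_of (Join B C)) {f i} \<and> pathset G \<theta> n S (graph_of B) (?fB i) \<and>
        pathset G \<theta> n S (graph_of C) (?fC i) \<and> {f i} \<subseteq> rel_join n ?B ?C (?fB i) (?fC i)"
    if i: "i < card \<A>" for i
  proof (intro conjI)
    have fi: "f i \<in> cube n (verts (graph_of (Join B C)) - S)" using sub fA[OF i] by (rule subsetD)
    with G n show "pathset G \<theta> n S (graph_of (Join B C)) {f i}"
      by (intro pathset_singleton subgraph_graph_of[OF A])
    have fi': "f i \<in> cube n (?B \<union> ?C)" using fi unfolding V .
    have "restrict (f i) ?B \<in> cube n ?B" using fi' by (intro restrict_PiE_iff[THEN iffD2]) blast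
    with G n show "pathset G \<theta> n S (graph_of B) (?fB i)"
      by (intro pathset_singleton subgraph_graph_of[OF BC(1)])
    have "restrict (f i) ?C \<in> cube n ?C" using fi' by (intro restrict_PiE_iff[THEN iffD2]) blast
    with G n show "pathset G \<theta> n S (graph_of C) (?fC i)"
      by (intro pathset_singleton subgraph_graph_of[OF BC(2)])
    show "{f i} \<subseteq> rel_join n ?B ?C (?fB i) (?fC i)"
      using fi' by (simp add: rel_join_def)
  qed
  moreover have "\<A> \<subseteq> (\<Union>i<card \<A>. {f i})" using f by (auto simp: bij_betw_def)
  ultimately show ?thesis
    by (intro exI[of _ "\<lambda>i. {f i}"] exI[of _ ?fB] exI[of _ ?fC] conjI allI impI) auto
qed

lemma Least_attained: "\<lbrakk>x = (LEAST m. P m); \<exists>m. P m\<rbrakk> \<Longrightarrow> P x" for x :: nat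
  by (auto intro: LeastI)

lemma chi_Atomic_attained:
  assumes G: "finite (verts G)" "simple_graph G" "\<forall>e\<in>edges G. 0 \<le> \<theta> e"
    and A: "join_tree_over G (Atomic l)" and n: "n > 0"
    and sub: "\<A> \<subseteq> cube n (verts (graph_of (Atomic l)) - S)"
  shows "\<exists>\<P>. (\<forall>i<chi G \<theta> n S (Atomic l) \<A>. pathset G \<theta> n S (graph_of (Atomic l)) (\<P> i)) \<and>
             \<A> \<subseteq> (\<Union>i<chi G \<theta> n S (Atomic l) \<A>. \<P> i)"
  unfolding chi.simps by (rule LeastI, rule Atomic_singletons[OF assms])

lemma chi_Join_attained:
  assumes G: "finite (verts G)" "simple_graph G" "\<forall>e\<in>edges G. 0 \<le> \<theta> e"
    and A: "join_tree_over G (Join B C)" and n: "n > 0"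
    and sub: "\<A> \<subseteq> cube n (verts (graph_of (Join B C)) - S)"
  shows "\<exists>(m::nat) \<A>s \<B>s \<C>s.
        (\<forall>i<m. pathset G \<theta> n S (graph_of (Join B C)) (\<A>s i) \<and>
               pathset G \<theta> n S (graph_of B) (\<B>s i) \<and>
               pathset G \<theta> n S (graph_of C) (\<C>s i) \<and>
               \<A>s i \<subseteq> rel_join n (verts (graph_of B) - S) (verts (graph_of C) - S) (\<B>s i) (\<C>s i)) \<and>
        \<A> \<subseteq> (\<Union>i<m. \<A>s i) \<and>
        chi G \<theta> n S (Join B C) \<A> = (\<Sum>i<m. max (chi G \<theta> n S B (\<B>s i)) (chi G \<theta> n S C (\<C>s i)))"
proof -
  obtain \<A>s \<B>s \<C>s where *: "\<forall>i<card \<A>. pathset G \<theta> n S (graph_of (Join B C)) (\<A>s i) \<and>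
               pathset G \<theta> n S (graph_of B) (\<B>s i) \<and>
               pathset G \<theta> n S (graph_of C) (\<C>s i) \<and>
               \<A>s i \<subseteq> rel_join n (verts (graph_of B) - S) (verts (graph_of C) - S) (\<B>s i) (\<C>s i)"
      "\<A> \<subseteq> (\<Union>i<card \<A>. \<A>s i)"
    using Join_singletons[OF assms] by (elim exE conjE) (rule that)
  show ?thesis
    by (rule Least_attained[OF chi.simps(2)], intro exI conjI, rule *(1), rule *(2), rule refl)
qed

lemma chi_bounded:
  assumes G: "finite (verts G)" "simple_graph G" and n: "n > 0"
  shows "join_tree_over G A \<Longrightarrow> \<exists>K. \<forall>\<theta> \<A>. (\<forall>e\<in>edges G. 0 \<le> \<theta> e) \<longrightarrow>
           \<A> \<subseteq> cube n (verts (graph_of A) - S) \<longrightarrow> chi G \<theta> n S A \<A> \<le> K"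
proof (induction A)
  case (Atomic l)
  let ?N = "card (cube n (verts (graph_of (Atomic l)) - S))"
  have fin: "finite (cube n (verts (graph_of (Atomic l)) - S))"
    using finite_cube finite_verts_graph_of[OF G Atomic] by blast
  have "chi G \<theta> n S (Atomic l) \<A> \<le> ?N"
    if "\<forall>e\<in>edges G. 0 \<le> \<theta> e" and sub: "\<A> \<subseteq> cube n (verts (graph_of (Atomic l)) - S)" for \<theta> \<A>
  proof -
    have "chi G \<theta> n S (Atomic l) \<A> \<le> card \<A>"
      unfolding chi.simps using that
      by (intro Least_le Atomic_singletons[OF G _ Atomic n]) auto
    also have "\<dots> \<le> ?N" using fin sub by (rule card_mono)
    finally show ?thesis .
  qed
  thus ?case by blast
next
  case (Join B C)
  let ?N = "card (cube n (verts (graph_of (Join B C)) - S))"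
  have "join_tree_over G B" "join_tree_over G C"
    using Join.prems by (auto simp: join_tree_over_def)
  with Join.IH obtain KB KC
    where KB: "\<And>\<theta> \<A>. \<lbrakk>\<forall>e\<in>edges G. 0 \<le> \<theta> e; \<A> \<subseteq> cube n (verts (graph_of B) - S)\<rbrakk> \<Longrightarrow> chi G \<theta> n S B \<A> \<le> KB"
      and KC: "\<And>\<theta> \<A>. \<lbrakk>\<forall>e\<in>edges G. 0 \<le> \<theta> e; \<A> \<subseteq> cube n (verts (graph_of C) - S)\<rbrakk> \<Longrightarrow> chi G \<theta> n S C \<A> \<le> KC"
    by metis
  have fin: "finite (cube n (verts (graph_of (Join B C)) - S))"
    using finite_cube finite_verts_graph_of[OF G Join.prems] by blast
  have "chi G \<theta> n S (Join B C) \<A> \<le> ?N * max KB KC"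
    if \<theta>: "\<forall>e\<in>edges G. 0 \<le> \<theta> e" and sub: "\<A> \<subseteq> cube n (verts (graph_of (Join B C)) - S)" for \<theta> \<A>
  proof -
    obtain \<A>s \<B>s \<C>s where *: "\<forall>i<card \<A>. pathset G \<theta> n S (graph_of (Join B C)) (\<A>s i) \<and>
                 pathset G \<theta> n S (graph_of B) (\<B>s i) \<and>
                 pathset G \<theta> n S (graph_of C) (\<C>s i) \<and>
                 \<A>s i \<subseteq> rel_join n (verts (graph_of B) - S) (verts (graph_of C) - S) (\<B>s i) (\<C>s i)"
        "\<A> \<subseteq> (\<Union>i<card \<A>. \<A>s i)"
      using Join_singletons[OF G \<theta> Join.prems n sub] by (elim exE conjE) (rule that)
    have "chi G \<theta> n S (Join B C) \<A> \<le> (\<Sum>i<card \<A>. max (chi G \<theta> n S B (\<B>s i)) (chi G \<theta> n S C (\<C>s i)))"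
      unfolding chi.simps
      by (rule Least_le, intro exI conjI, rule *(1), rule *(2), rule refl)
    also have "\<dots> \<le> (\<Sum>i<card \<A>. max KB KC)"
    proof (intro sum_mono max.mono)
      fix i assume "i \<in> {..<card \<A>}"
      thus "chi G \<theta> n S B (\<B>s i) \<le> KB" "chi G \<theta> n S C (\<C>s i) \<le> KC"
        using * by (auto intro!: KB[OF \<theta>] KC[OF \<theta>] pathset_subset_cube)
    qed
    also have "\<dots> \<le> ?N * max KB KC" using card_mono[OF fin sub] by simp
    finally show ?thesis .
  qed
  thus ?case by blast
qed

lemma ex_join_tree:
  assumes "finite E"
  shows "\<exists>A. labels A = E"
  using assms
proof (induction E)
  case empty
  show ?case by (rule exI[of _ "Atomic None"]) simp
next
  case (insert e E)
  then obtain A where "labels A = E" by blast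
  thus ?case by (intro exI[of _ "Join (Atomic (Some e)) A"]) simp
qed

text \<open>The hypothesis on the vertices says that \<open>G\<close> has no isolated vertices.\<close>

lemma bdd_above_tau_bound:
  assumes G: "finite_graph G" "verts G = \<Union> (edges G)"
  shows "bdd_above {t. tau_bound G t}"
proof -
  have fin: "finite (verts G)" and sg: "simple_graph G" using G(1) by (auto simp: finite_graph_def)
  have "edges G \<subseteq> Pow (verts G)" using G(2) by auto
  hence "finite (edges G)" using fin finite_subset by blast
  then obtain A :: "'a set join_tree" where A: "labels A = edges G" using ex_join_tree by blast
  hence gA: "graph_of A = G" "join_tree_over G A"
    using G(2) by (simp_all add: graph_of_def join_tree_over_def)
  have "\<exists>K. \<forall>\<theta> \<A>. (\<forall>e\<in>edges G. 0 \<le> \<theta> e) \<longrightarrow> \<A> \<subseteq> cube 2 (verts G) \<longrightarrow> chi G \<theta> 2 {} A \<A> \<le> K"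
    using chi_bounded[OF fin sg zero_less_numeral gA(2), where S = "{}"] unfolding gA(1) Diff_empty .
  then obtain K where K: "\<forall>\<theta> \<A>. (\<forall>e\<in>edges G. 0 \<le> \<theta> e) \<longrightarrow> \<A> \<subseteq> cube 2 (verts G) \<longrightarrow>
      chi G \<theta> 2 {} A \<A> \<le> K" ..
  have mu: "mu 2 (verts G) (cube 2 (verts G)) = 1"
    using fin by (simp add: mu_def card_PiE)
  have "t \<le> K" if t: "tau_bound G t" for t
  proof -
    obtain \<theta> where \<theta>: "threshold_weighting G \<theta>"
      and le: "\<And>n \<A>. \<lbrakk>n > 0; \<A> \<subseteq> cube n (verts G)\<rbrakk> \<Longrightarrow>
                 real n powr t * mu n (verts G) \<A> \<le> chi G \<theta> n {} A \<A>"
      using t gA unfolding tau_bound_def by metis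
    have "2 powr t \<le> chi G \<theta> 2 {} A (cube 2 (verts G))"
      using le[of 2 "cube 2 (verts G)"] mu by simp
    also have "\<dots> \<le> K" using \<theta> by (intro of_nat_mono K[rule_format]) (auto simp: threshold_weighting_def)
    also have "\<dots> \<le> 2 powr K"
      using less_exp[of K] by (simp add: powr_realpow flip: of_nat_le_iff)
    finally show ?thesis by simp
  qed
  thus ?thesis by (intro bdd_aboveI) auto
qed

end

theory Submission
  imports Defs "HOL-Library.Sublist"
begin

text \<open>
  The weighting comes from the random walk on the tree: \<open>\<theta> {x, y} = 1 / deg x + 1 / deg y\<close>, so that
  \<open>\<Delta>\<^sub>\<theta>(F)\<close> is at least a third of the number of edges leaving \<open>F\<close>. Pathset complexity is bounded below
  by an exponent computed along the join-tree. At a join with children \<open>B\<close> and \<open>C\<close>, three inequalities are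
  available: for a subtree \<open>D\<close> of \<open>B\<close>, reveal \<open>D\<close> and then gain \<open>\<Delta>(C \<ominus> V(D))\<close>; or reveal \<open>C\<close>, gaining
  \<open>\<Delta>(C)\<close>, and then \<open>D\<close> given \<open>C\<close>; or average the exponents of \<open>D\<close> and of a subtree \<open>E\<close> of \<open>C\<close> given \<open>D\<close>,
  which gains half of \<open>\<Delta>(B \<union> C)\<close>.

  The exponent of a join-tree whose graph contains a full subtree of height \<open>h\<close> is shown to be at least
  \<open>\<alpha> h\<close>, plus a term for that part of \<open>\<Delta>\<close> which cannot be lost by passing to subtrees still containing
  an almost equally high full subtree. In a minimal counterexample, follow the join-tree from the top
  down to a subtree \<open>X\<close> with small \<open>\<Delta>\<close>, and look at the siblings of the nodes passed. A sibling containing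
  a high full subtree is excluded by averaging, one of large \<open>\<Delta>\<close> by revealing it first. If all
  siblings are small, then each component of a sibling must touch what lies below it up to a small
  total gain, and these components cannot reach deep into a subtree that \<open>X\<close> does not meet, although
  together they must cover it.
\<close>

section \<open>Densities of relations and their sections\<close>

primrec subt :: "'e join_tree \<Rightarrow> 'e join_tree set" where
  "subt (Atomic l) = {Atomic l}"
| "subt (Join B C) = insert (Join B C) (subt B \<union> subt C)"

definition sib :: "'e join_tree \<Rightarrow> 'e join_tree \<Rightarrow> 'e join_tree \<Rightarrow> bool" where
  "sib P B C \<longleftrightarrow> P = Join B C \<or> P = Join C B"

abbreviation vts :: "'v set join_tree \<Rightarrow> 'v set" where
  "vts A \<equiv> \<Union> (labels A)"

lemma verts_graph_of [simp]: "verts (graph_of A) = vts A"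
  and edges_graph_of [simp]: "edges (graph_of A) = labels A"
  by (simp_all add: graph_of_def)

text \<open>\<open>rho\<close> followed by a projection to \<open>U - S\<close>; with
  \<open>U = V\<close> it is \<open>rho\<close> itself. The extra argument lets the coordinates of a
  subtree be revealed while the conditioned relation is that of the larger join-tree.\<close>

definition sec :: "'v set \<Rightarrow> 'v set \<Rightarrow> 'v set \<Rightarrow> ('v \<Rightarrow> nat) set \<Rightarrow> ('v \<Rightarrow> nat) \<Rightarrow> ('v \<Rightarrow> nat) set" where
  "sec V U S \<A> z = (\<lambda>y. restrict y (U - S)) ` {y \<in> \<A>. \<forall>i\<in>V \<inter> S. y i = z i}"

lemma restrict_eq_iff: "restrict f A = restrict g A \<longleftrightarrow> (\<forall>i\<in>A. f i = g i)"
  by (auto simp: restrict_def fun_eq_iff)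

lemma rho_eq_sec:
  assumes "\<A> \<subseteq> cube n V"
  shows "rho n V S \<A> z = sec V V S \<A> z"
proof -
  have "restrict y (V - S) \<in> cube n (V - S)" if "y \<in> \<A>" for y
    using that assms by (intro restrict_PiE_iff[THEN iffD2]) blast
  hence "{x \<in> cube n (V - S). \<exists>y\<in>\<A>. restrict y (V - S) = x \<and> (\<forall>i\<in>V \<inter> S. y i = z i)} =
      (\<lambda>y. restrict y (V - S)) ` {y \<in> \<A>. \<forall>i\<in>V \<inter> S. y i = z i}" by (fast elim: subst)
  thus ?thesis unfolding rho_def sec_def restrict_eq_iff .
qed

lemma sec_subset_cube:
  assumes "\<A> \<subseteq> cube n V" "U \<subseteq> V"
  shows "sec V U S \<A> z \<subseteq> cube n (U - S)"
proof
  fix x assume "x \<in> sec V U S \<A> z"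
  then obtain y where y: "y \<in> \<A>" "x = restrict y (U - S)" by (auto simp: sec_def)
  have "y \<in> cube n V" using y(1) assms(1) by blast
  thus "x \<in> cube n (U - S)"
    unfolding y(2) using assms(2) by (intro restrict_PiE_iff[THEN iffD2]) blast
qed

lemma finite_rel: "finite W \<Longrightarrow> R \<subseteq> cube n W \<Longrightarrow> finite R"
  by (rule finite_subset[OF _ finite_cube])

lemma mu_nonneg: "mu n V R \<ge> 0"
  by (simp add: mu_def)

lemma mu_mono: "finite W \<Longrightarrow> R \<subseteq> R' \<Longrightarrow> R' \<subseteq> cube n W \<Longrightarrow> mu n V R \<le> mu n V R'"
  unfolding mu_def by (intro divide_right_mono of_nat_mono card_mono finite_rel[of W R']) auto

lemma mu_Union_le:
  assumes "finite W" "\<And>i. i < (m::nat) \<Longrightarrow> R i \<subseteq> cube n W"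
  shows "mu n V (\<Union>i<m. R i) \<le> (\<Sum>i<m. mu n V (R i))"
proof -
  have "real (card (\<Union>i<m. R i)) \<le> (\<Sum>i<m. real (card (R i)))"
    using card_UN_le[of "{..<m}" R] by (simp flip: of_nat_sum)
  thus ?thesis
    by (simp add: mu_def divide_right_mono flip: sum_divide_distrib)
qed

lemma card_le_fibres:
  assumes "finite R" "\<And>x. x \<in> f ` R \<Longrightarrow> real (card {r\<in>R. f r = x}) \<le> b"
  shows "real (card R) \<le> real (card (f ` R)) * b"
proof -
  have "R = (\<Union>x\<in>f ` R. {r\<in>R. f r = x})" by auto
  hence "card R \<le> (\<Sum>x\<in>f ` R. card {r\<in>R. f r = x})"
    using card_UN_le[of "f ` R" "\<lambda>x. {r\<in>R. f r = x}"] assms(1) by simp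
  hence "real (card R) \<le> (\<Sum>x\<in>f ` R. real (card {r\<in>R. f r = x}))"
    by (simp flip: of_nat_sum)
  also have "\<dots> \<le> (\<Sum>x\<in>f ` R. b)" using assms(2) by (rule sum_mono)
  finally show ?thesis by simp
qed

text \<open>A Fubini estimate: coordinates in \<open>U1\<close> first, then those in
  \<open>U2\<close> given the former. The remaining coordinates are bounded trivially, by density
  1.\<close>

lemma mu_le_fibres:
  assumes W: "finite W" and n: "n > 0" and R: "R \<subseteq> cube n W"
    and U: "U1 \<subseteq> W" "U2 \<subseteq> W" "U1 \<inter> U2 = {}"
    and fib: "\<And>x. x \<in> (\<lambda>r. restrict r U1) ` R \<Longrightarrow>
          mu n U2 ((\<lambda>r. restrict r U2) ` {r\<in>R. restrict r U1 = x}) \<le> b"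
  shows "mu n W R \<le> mu n U1 ((\<lambda>r. restrict r U1) ` R) * b"
proof -
  let ?U3 = "W - U1 - U2"
  let ?f = "\<lambda>r. restrict r U1" and ?g = "\<lambda>r. restrict r U2" and ?h = "\<lambda>r. restrict r ?U3"
  have fR: "finite R" using finite_rel[OF W R] .
  have fU: "finite U1" "finite U2" "finite ?U3" using W U finite_subset by auto
  have npos: "real n > 0" using n by simp
  have cW: "card W = card U1 + (card U2 + card ?U3)"
  proof -
    have "W = U1 \<union> (U2 \<union> ?U3)" using U by auto
    hence "card W = card U1 + card (U2 \<union> ?U3)"
      using card_Un_disjoint[of U1 "U2 \<union> ?U3"] fU U by auto
    also have "card (U2 \<union> ?U3) = card U2 + card ?U3"
      using card_Un_disjoint[of U2 ?U3] fU by auto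
    finally show ?thesis .
  qed
  let ?N = "real n ^ card U2 * real n ^ card ?U3"
  have "real (card R) \<le> real (card (?f ` R)) * (b * ?N)"
  proof (rule card_le_fibres[OF fR])
    fix x assume x: "x \<in> ?f ` R"
    let ?F = "{r\<in>R. ?f r = x}"
    have "real (card ?F) \<le> real (card (?g ` ?F)) * real n ^ card ?U3"
    proof (rule card_le_fibres)
      show "finite ?F" using fR by simp
      fix y assume "y \<in> ?g ` ?F"
      let ?H = "{r\<in>?F. ?g r = y}"
      \<comment> \<open>Inside a joint fibre of the projections to \<open>U1\<close> and
        \<open>U2\<close>, a point is determined by its coordinates in \<open>?U3\<close>.\<close>
      have inj: "inj_on ?h ?H"
      proof (rule inj_onI)
        fix r s assume rs: "r \<in> ?H" "s \<in> ?H" "?h r = ?h s"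
        have "?f r = ?f s" "?g r = ?g s" using rs(1,2) by auto
        hence "\<forall>i\<in>W. r i = s i" using rs(3) unfolding restrict_eq_iff by auto
        thus "r = s" using rs(1,2) R by (intro PiE_ext[of r W _ s]) auto
      qed
      have "?h r \<in> cube n ?U3" if "r \<in> R" for r
        using that R by (intro restrict_PiE_iff[THEN iffD2]) blast
      hence "?h ` ?H \<subseteq> cube n ?U3" by blast
      hence "card ?H \<le> card (cube n ?U3)"
        using card_inj_on_le[OF inj] finite_cube[OF fU(3)] by blast
      thus "real (card ?H) \<le> real n ^ card ?U3"
        using fU(3) by (simp add: card_PiE flip: of_nat_power)
    qed
    moreover have "real (card (?g ` ?F)) \<le> b * real n ^ card U2"
      using fib[OF x] npos by (simp add: mu_def divide_le_eq)
    ultimately show "real (card ?F) \<le> b * ?N"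
      by (smt (verit, best) mult.assoc mult_right_mono npos zero_le_power)
  qed
  thus ?thesis
    using npos unfolding mu_def cW power_add by (simp add: divide_simps mult_ac)
qed

section \<open>Lower bounds on pathset complexity\<close>

text \<open>
  \<open>LB G \<theta> A S t\<close> says that the exponent \<open>t\<close> is a lower bound for \<open>A\<close> conditioned on the coordinates in
  \<open>S\<close>. Conditioning acts on the relation only: the complexity stays the unconditional one, which is
  what makes the rules below compose without a restriction lemma for \<open>chi\<close>.
\<close>

definition LB :: "'v ugraph \<Rightarrow> ('v set \<Rightarrow> real) \<Rightarrow> 'v set join_tree \<Rightarrow> 'v set \<Rightarrow> real \<Rightarrow> bool" where
  "LB G \<theta> A S t \<longleftrightarrow> (\<forall>n>0. \<forall>\<A> \<subseteq> cube n (vts A). \<forall>z \<in> cube n S.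
     real n powr t * mu n (vts A - S) (sec (vts A) (vts A) S \<A> z) \<le> real (chi G \<theta> n {} A \<A>))"

locale weighted_graph =
  fixes G :: "'v ugraph" and \<theta> :: "'v set \<Rightarrow> real"
  assumes fin: "finite (verts G)" and sg: "simple_graph G" and nonneg: "\<forall>e\<in>edges G. 0 \<le> \<theta> e"
begin

abbreviation lb where "lb \<equiv> LB G \<theta>"
abbreviation dl where "dl A S \<equiv> Delta \<theta> (graph_of A \<ominus> S)"

lemma vts_subset: "labels A \<subseteq> edges G \<Longrightarrow> vts A \<subseteq> verts G"
  using sg by (auto simp: simple_graph_def)

lemma fin_vts: "labels A \<subseteq> edges G \<Longrightarrow> finite (vts A)"
  by (rule finite_subset[OF vts_subset fin])

lemma labels_subt: "X \<in> subt A \<Longrightarrow> labels X \<subseteq> labels A"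
  by (induction A) auto

lemma pathset_sec:
  assumes "pathset G \<theta> n {} (graph_of A) \<A>" "T \<subseteq> verts G" "z \<in> cube n T"
  shows "mu n (vts A - T) (sec (vts A) (vts A) T \<A> z) \<le> real n powr - dl A T"
proof -
  have "\<A> \<subseteq> cube n (vts A)" using assms(1) by (auto simp: pathset_def)
  hence "sec (vts A) (vts A) T \<A> z = rho n (vts A) T \<A> z" by (rule rho_eq_sec[symmetric])
  moreover have "mu n (verts (graph_of A) - T) (rho n (verts (graph_of A) - {}) T \<A> z) \<le> real n powr - dl A T"
    using assms unfolding pathset_def by blast
  ultimately show ?thesis by simp
qed

lemma LB_mono: "lb A S t \<Longrightarrow> t' \<le> t \<Longrightarrow> lb A S t'"
  unfolding LB_def
proof (intro allI impI ballI)
  fix n \<A> z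
  assume lb: "\<forall>n>0. \<forall>\<A>\<subseteq>cube n (vts A). \<forall>z\<in>cube n S.
      real n powr t * mu n (vts A - S) (sec (vts A) (vts A) S \<A> z) \<le> real (chi G \<theta> n {} A \<A>)"
    and "t' \<le> t" and n: "0 < (n::nat)" and "\<A> \<subseteq> cube n (vts A)" "z \<in> cube n S"
  have "real n powr t' \<le> real n powr t" using n \<open>t' \<le> t\<close> by (intro powr_mono) auto
  hence "real n powr t' * mu n (vts A - S) (sec (vts A) (vts A) S \<A> z)
      \<le> real n powr t * mu n (vts A - S) (sec (vts A) (vts A) S \<A> z)"
    by (intro mult_right_mono mu_nonneg)
  also have "\<dots> \<le> real (chi G \<theta> n {} A \<A>)" using lb[rule_format, OF n] \<open>\<A> \<subseteq> _\<close> \<open>z \<in> _\<close> .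
  finally show "real n powr t' * mu n (vts A - S) (sec (vts A) (vts A) S \<A> z) \<le> real (chi G \<theta> n {} A \<A>)" .
qed

lemma sec_Union: "\<A> \<subseteq> (\<Union>i<m. \<A>s i) \<Longrightarrow> sec V U S \<A> z \<subseteq> (\<Union>i<(m::nat). sec V U S (\<A>s i) z)"
proof
  fix x assume "\<A> \<subseteq> (\<Union>i<m. \<A>s i)" "x \<in> sec V U S \<A> z"
  then obtain y i where "y \<in> \<A>s i" "i < m" "\<forall>i\<in>V \<inter> S. y i = z i" "x = restrict y (U - S)"
    unfolding sec_def by blast
  thus "x \<in> (\<Union>i<m. sec V U S (\<A>s i) z)" unfolding sec_def by blast
qed

lemma sib_vts: "sib P B C \<Longrightarrow> vts P = vts B \<union> vts C"
  and sib_labels: "sib P B C \<Longrightarrow> labels P = labels B \<union> labels C"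
  by (auto simp: sib_def)

text \<open>Reduction to a single triple: the minimum in \<open>chi\<close> is attained by some
  family, and density is subadditive over its members, so an inequality valid for each triple sums
  to one for \<open>chi\<close>. Stating it through \<open>sib\<close> makes \<open>B\<close> either
  of the two children.\<close>

lemma chi_sib_ge:
  assumes sib: "sib P B C" and lP: "labels P \<subseteq> edges G" and n: "n > 0"
    and sub: "\<A> \<subseteq> cube n (vts P)" and U: "U \<subseteq> vts P" and c: "c \<ge> 0"
    and main: "\<And>\<A>' \<B> \<C>. \<lbrakk>pathset G \<theta> n {} (graph_of P) \<A>'; pathset G \<theta> n {} (graph_of B) \<B>;
         pathset G \<theta> n {} (graph_of C) \<C>; \<And>y. y \<in> \<A>' \<Longrightarrow> restrict y (vts B) \<in> \<B>;
         \<And>y. y \<in> \<A>' \<Longrightarrow> restrict y (vts C) \<in> \<C>\<rbrakk> \<Longrightarrow>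
        c * mu n V (sec (vts P) U S \<A>' z) \<le> max (real (chi G \<theta> n {} B \<B>)) (real (chi G \<theta> n {} C \<C>))"
  shows "c * mu n V (sec (vts P) U S \<A> z) \<le> real (chi G \<theta> n {} P \<A>)"
proof -
  obtain B' C' where P: "P = Join B' C'" and BC: "B' = B \<and> C' = C \<or> B' = C \<and> C' = B"
    using sib by (auto simp: sib_def)
  have jt: "join_tree_over G (Join B' C')" using lP P by (simp add: join_tree_over_def)
  have sub': "\<A> \<subseteq> cube n (verts (graph_of (Join B' C')) - {})"
    using sub unfolding P verts_graph_of Diff_empty .
  obtain m \<A>s \<B>s \<C>s where *: "\<forall>i<(m::nat). pathset G \<theta> n {} (graph_of (Join B' C')) (\<A>s i) \<and>
               pathset G \<theta> n {} (graph_of B') (\<B>s i) \<and>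
               pathset G \<theta> n {} (graph_of C') (\<C>s i) \<and>
               \<A>s i \<subseteq> rel_join n (verts (graph_of B') - {}) (verts (graph_of C') - {}) (\<B>s i) (\<C>s i)"
        "\<A> \<subseteq> (\<Union>i<m. \<A>s i)"
        "chi G \<theta> n {} (Join B' C') \<A> = (\<Sum>i<m. max (chi G \<theta> n {} B' (\<B>s i)) (chi G \<theta> n {} C' (\<C>s i)))"
    using chi_Join_attained[OF fin sg nonneg jt n sub'] by (elim exE conjE) (rule that)
  have fU: "finite (U - S)" by (rule finite_Diff[OF finite_subset[OF U fin_vts[OF lP]]])
  have As: "\<A>s i \<subseteq> cube n (vts P)" if "i < m" for i
    using pathset_subset_cube *(1) that P by fastforce
  have secs: "sec (vts P) U S (\<A>s i) z \<subseteq> cube n (U - S)" if "i < m" for i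
    using sec_subset_cube[OF As[OF that] U] .
  have "mu n V (sec (vts P) U S \<A> z) \<le> mu n V (\<Union>i<m. sec (vts P) U S (\<A>s i) z)"
    using secs by (intro mu_mono[OF fU sec_Union[OF *(2)]]) auto
  also have "\<dots> \<le> (\<Sum>i<m. mu n V (sec (vts P) U S (\<A>s i) z))"
    using secs by (intro mu_Union_le[OF fU]) auto
  finally have "c * mu n V (sec (vts P) U S \<A> z) \<le> (\<Sum>i<m. c * mu n V (sec (vts P) U S (\<A>s i) z))"
    unfolding sum_distrib_left[symmetric] using c by (rule mult_left_mono)
  also have "\<dots> \<le> (\<Sum>i<m. max (real (chi G \<theta> n {} B' (\<B>s i))) (real (chi G \<theta> n {} C' (\<C>s i))))"
  proof (rule sum_mono)
    fix i assume "i \<in> {..<m}"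
    hence i: "i < m" by simp
    have ps: "pathset G \<theta> n {} (graph_of P) (\<A>s i)" "pathset G \<theta> n {} (graph_of B') (\<B>s i)"
      "pathset G \<theta> n {} (graph_of C') (\<C>s i)"
      and j: "\<A>s i \<subseteq> rel_join n (vts B') (vts C') (\<B>s i) (\<C>s i)"
      using *(1)[rule_format, OF i] P by simp_all
    have r: "restrict y (vts B') \<in> \<B>s i" "restrict y (vts C') \<in> \<C>s i" if "y \<in> \<A>s i" for y
      using subsetD[OF j that] by (simp_all add: rel_join_def)
    from BC show "c * mu n V (sec (vts P) U S (\<A>s i) z)
        \<le> max (real (chi G \<theta> n {} B' (\<B>s i))) (real (chi G \<theta> n {} C' (\<C>s i)))"
    proof
      assume "B' = B \<and> C' = C"
      hence e: "B' = B" "C' = C" by simp_all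
      show ?thesis unfolding e
        by (rule main[OF ps(1) ps(2)[unfolded e] ps(3)[unfolded e] r[unfolded e]])
    next
      assume "B' = C \<and> C' = B"
      hence e: "B' = C" "C' = B" by simp_all
      show ?thesis unfolding e max.commute[of "real (chi G \<theta> n {} C _)"]
        by (rule main[OF ps(1) ps(3)[unfolded e] ps(2)[unfolded e] r(2,1)[unfolded e]])
    qed
  qed
  also have "\<dots> = real (chi G \<theta> n {} P \<A>)"
    unfolding P *(3) by (simp add: of_nat_max)
  finally show ?thesis .
qed

text \<open>Induction from \<open>D\<close> up to \<open>B\<close>: in every triple, the projection
  to \<open>D\<close> of the section of the relation at the parent is contained in that of the
  relation at the child above \<open>D\<close>, so the bound passes upwards through
  \<open>chi_sib_ge\<close>.\<close>

lemma LB_sec: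
  assumes lb: "lb D S t"
  shows "\<lbrakk>D \<in> subt B; labels B \<subseteq> edges G; n > 0; \<B> \<subseteq> cube n (vts B); z \<in> cube n S\<rbrakk> \<Longrightarrow>
    real n powr t * mu n (vts D - S) (sec (vts B) (vts D) S \<B> z) \<le> real (chi G \<theta> n {} B \<B>)"
proof (induction B arbitrary: \<B>)
  case (Atomic l)
  hence D: "D = Atomic l" by simp
  show ?case unfolding D
    by (rule lb[unfolded D LB_def, rule_format, OF Atomic.prems(3-5)])
next
  case (Join B1 B2)
  show ?case
  proof (cases "D = Join B1 B2")
    case True
    show ?thesis unfolding True
      by (rule lb[unfolded True LB_def, rule_format, OF Join.prems(3-5)])
  next
    case False
    then obtain X Y where XY: "sib (Join B1 B2) X Y" "D \<in> subt X" and
      IH: "\<And>\<B>. \<B> \<subseteq> cube n (vts X) \<Longrightarrow>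
         real n powr t * mu n (vts D - S) (sec (vts X) (vts D) S \<B> z) \<le> real (chi G \<theta> n {} X \<B>)"
    proof -
      have lB: "labels B1 \<subseteq> edges G" "labels B2 \<subseteq> edges G" using Join.prems(2) by auto
      have "D \<in> subt B1 \<or> D \<in> subt B2" using Join.prems(1) False by auto
      thus thesis
      proof
        assume D: "D \<in> subt B1"
        have "sib (Join B1 B2) B1 B2" by (simp add: sib_def)
        thus thesis
          by (rule that[OF _ D Join.IH(1)[OF D lB(1) Join.prems(3) _ Join.prems(5)]])
      next
        assume D: "D \<in> subt B2"
        have "sib (Join B1 B2) B2 B1" by (simp add: sib_def)
        thus thesis
          by (rule that[OF _ D Join.IH(2)[OF D lB(2) Join.prems(3) _ Join.prems(5)]])
      qed
    qed
    have lX: "labels X \<subseteq> edges G" using sib_labels[OF XY(1)] Join.prems(2) by auto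
    have DX: "vts D \<subseteq> vts X" using labels_subt[OF XY(2)] by auto
    have X: "vts X \<subseteq> vts (Join B1 B2)" using sib_vts[OF XY(1)] by auto
    have DB: "vts D \<subseteq> vts (Join B1 B2)" using DX X by blast
    show ?thesis
    proof (rule chi_sib_ge[OF XY(1) Join.prems(2,3,4) DB])
      fix \<A>' \<X> \<Y>
      assume ps: "pathset G \<theta> n {} (graph_of X) \<X>"
        and r: "\<And>y. y \<in> \<A>' \<Longrightarrow> restrict y (vts X) \<in> \<X>"
      have Xc: "\<X> \<subseteq> cube n (vts X)" using ps by (auto simp: pathset_def)
      have "sec (vts (Join B1 B2)) (vts D) S \<A>' z \<subseteq> sec (vts X) (vts D) S \<X> z"
      proof
        fix x assume "x \<in> sec (vts (Join B1 B2)) (vts D) S \<A>' z"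
        then obtain y where y: "y \<in> \<A>'" "\<forall>i\<in>vts (Join B1 B2) \<inter> S. y i = z i" "x = restrict y (vts D - S)"
          unfolding sec_def by blast
        have "x = restrict (restrict y (vts X)) (vts D - S)"
          unfolding y(3) restrict_eq_iff using DX by auto
        moreover have "restrict y (vts X) i = z i" if i: "i \<in> vts X \<inter> S" for i
        proof -
          have "i \<in> vts (Join B1 B2) \<inter> S" using i X by blast
          hence "y i = z i" using y(2) by blast
          thus ?thesis using i by simp
        qed
        ultimately show "x \<in> sec (vts X) (vts D) S \<X> z" using r[OF y(1)] unfolding sec_def by blast
      qed
      hence "mu n (vts D - S) (sec (vts (Join B1 B2)) (vts D) S \<A>' z)
          \<le> mu n (vts D - S) (sec (vts X) (vts D) S \<X> z)"
        by (rule mu_mono[rotated])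
          (rule sec_subset_cube[OF Xc DX], rule finite_Diff[OF finite_subset[OF DX fin_vts[OF lX]]])
      hence "real n powr t * mu n (vts D - S) (sec (vts (Join B1 B2)) (vts D) S \<A>' z)
          \<le> real n powr t * mu n (vts D - S) (sec (vts X) (vts D) S \<X> z)"
        by (rule mult_left_mono) simp
      also have "\<dots> \<le> real (chi G \<theta> n {} X \<X>)" using IH[OF Xc] .
      finally show "real n powr t * mu n (vts D - S) (sec (vts (Join B1 B2)) (vts D) S \<A>' z)
         \<le> max (real (chi G \<theta> n {} X \<X>)) (real (chi G \<theta> n {} Y \<Y>))" by simp
    qed simp
  qed
qed

text \<open>Forgetting all coordinates outside \<open>X\<close> can only increase the density, and
  \<open>LB_sec\<close> bounds the projected section.\<close>

lemma LB_subt: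
  assumes X: "X \<in> subt A" and lA: "labels A \<subseteq> edges G" and lb: "lb X S t"
  shows "lb A S t"
  unfolding LB_def
proof (intro allI impI ballI)
  fix n \<A> z assume n: "(n::nat) > 0" and sub: "\<A> \<subseteq> cube n (vts A)" and z: "z \<in> cube n S"
  have XA: "vts X \<subseteq> vts A" using labels_subt[OF X] by auto
  let ?R = "sec (vts A) (vts A) S \<A> z"
  have R: "?R \<subseteq> cube n (vts A - S)" using sec_subset_cube[OF sub] by blast
  have im: "(\<lambda>r. restrict r (vts X - S)) ` ?R = sec (vts A) (vts X) S \<A> z"
  proof -
    have "restrict (restrict y (vts A - S)) (vts X - S) = restrict y (vts X - S)" for y :: "'v \<Rightarrow> nat"
      unfolding restrict_eq_iff using XA by auto
    thus ?thesis unfolding sec_def image_image by simp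
  qed
  have "mu n (vts A - S) ?R \<le> mu n (vts X - S) ((\<lambda>r. restrict r (vts X - S)) ` ?R) * 1"
  \<comment> \<open>With an empty second stage the fibre bound is 1.\<close>
  proof (rule mu_le_fibres[where ?U2.0 = "{}"])
    fix x
    have "card ((\<lambda>r. restrict r {}) ` {r \<in> ?R. restrict r (vts X - S) = x})
        \<le> card {(\<lambda>i. undefined) :: 'v \<Rightarrow> nat}"
      by (intro card_mono image_subsetI) (simp_all add: restrict_def)
    thus "mu n {} ((\<lambda>r. restrict r {}) ` {r \<in> ?R. restrict r (vts X - S) = x}) \<le> 1"
      by (simp add: mu_def)
  qed (use fin_vts[OF lA] R XA n in auto)
  hence "real n powr t * mu n (vts A - S) ?R \<le> real n powr t * mu n (vts X - S) (sec (vts A) (vts X) S \<A> z)"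
    unfolding im by (intro mult_left_mono) simp_all
  also have "\<dots> \<le> real (chi G \<theta> n {} A \<A>)" using LB_sec[OF lb X lA n sub z] .
  finally show "real n powr t * mu n (vts A - S) ?R \<le> real (chi G \<theta> n {} A \<A>)" .
qed


lemma chi_ge_1:
  "\<lbrakk>labels A \<subseteq> edges G; n > 0; \<A> \<subseteq> cube n (vts A); \<A> \<noteq> {}\<rbrakk> \<Longrightarrow> 1 \<le> real (chi G \<theta> n {} A \<A>)"
proof (induction A arbitrary: \<A>)
  case (Atomic l)
  have jt: "join_tree_over G (Atomic l)" using Atomic.prems(1) by (simp add: join_tree_over_def)
  have sub': "\<A> \<subseteq> cube n (verts (graph_of (Atomic l)) - {})"
    using Atomic.prems(3) unfolding verts_graph_of Diff_empty .
  obtain \<P> where "\<A> \<subseteq> (\<Union>i<chi G \<theta> n {} (Atomic l) \<A>. \<P> i)"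
    using chi_Atomic_attained[OF fin sg nonneg jt Atomic.prems(2) sub'] by (elim exE conjE) (rule that)
  hence "chi G \<theta> n {} (Atomic l) \<A> \<noteq> 0" using Atomic.prems(4) by (intro notI) simp
  thus ?case by linarith
next
  case (Join B C)
  have lB: "labels B \<subseteq> edges G" using Join.prems(1) by simp
  \<comment> \<open>With no coordinates kept, the density only records whether the relation is
    empty, so \<open>chi_sib_ge\<close> transports nonemptiness.\<close>
  have mu1: "mu n {} (sec V {} {} \<A>' z) = (if \<A>' = {} then 0 else 1)" for V z and \<A>' :: "('v \<Rightarrow> nat) set"
  proof -
    have "sec V {} {} \<A>' z = (\<lambda>y. restrict y {}) ` \<A>'" by (simp add: sec_def)
    moreover have "(\<lambda>y. restrict y {}) ` \<A>' = (if \<A>' = {} then {} else {\<lambda>i. undefined})"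
      by (auto simp: restrict_def)
    ultimately show ?thesis by (simp add: mu_def)
  qed
  have "1 * mu n {} (sec (vts (Join B C)) {} {} \<A> undefined) \<le> real (chi G \<theta> n {} (Join B C) \<A>)"
  proof (rule chi_sib_ge[of _ B C])
    fix \<A>' \<B> \<C>
    assume B: "pathset G \<theta> n {} (graph_of B) \<B>" and r: "\<And>y. y \<in> \<A>' \<Longrightarrow> restrict y (vts B) \<in> \<B>"
    have Bs: "\<B> \<subseteq> cube n (vts B)" using pathset_subset_cube[OF B] by simp
    show "1 * mu n {} (sec (vts (Join B C)) {} {} \<A>' undefined)
        \<le> max (real (chi G \<theta> n {} B \<B>)) (real (chi G \<theta> n {} C \<C>))"
    proof (cases "\<A>' = {}")
      case False
      hence "\<B> \<noteq> {}" using r by blast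
      hence "1 \<le> real (chi G \<theta> n {} B \<B>)" using Join.IH(1)[OF lB Join.prems(2) Bs] by blast
      thus ?thesis unfolding mu1 by (simp add: max.coboundedI1)
    qed (simp add: mu1)
  qed (use Join.prems in \<open>simp_all add: sib_def\<close>)
  thus ?case unfolding mu1 using Join.prems(4) by simp
qed

lemma powr_minus_cancel: "n > 0 \<Longrightarrow> real n powr t * real n powr - t = 1"
  by (simp add: powr_minus)

lemma mult_powr_le: 
  assumes "n > 0" "x \<le> real n powr - t * y"
  shows "real n powr t * x \<le> y"
proof -
  have "real n powr t * x \<le> real n powr t * (real n powr - t * y)"
    using assms(2) by (rule mult_left_mono) simp
  thus ?thesis using powr_minus_cancel[OF assms(1), of t] by (simp flip: mult.assoc)
qed

text \<open>Each pathset of a cover has section density at most \<open>n powr - dl A S\<close> and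
  costs at least 1; at a join the cost comes from \<open>chi_ge_1\<close>.\<close>

lemma LB_Delta:
  assumes lA: "labels A \<subseteq> edges G" and S: "S \<subseteq> verts G"
  shows "lb A S (dl A S)"
  unfolding LB_def
proof (intro allI impI ballI)
  fix n \<A> z assume n: "(n::nat) > 0" and sub: "\<A> \<subseteq> cube n (vts A)" and z: "z \<in> cube n S"
  have ps: "real n powr dl A S * mu n (vts A - S) (sec (vts A) (vts A) S \<A>' z) \<le> 1"
    if "pathset G \<theta> n {} (graph_of A) \<A>'" for \<A>'
    using pathset_sec[OF that S z] by (intro mult_powr_le[OF n]) simp
  show "real n powr dl A S * mu n (vts A - S) (sec (vts A) (vts A) S \<A> z) \<le> real (chi G \<theta> n {} A \<A>)"
  proof (cases A)
    case (Atomic l)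
    have jt: "join_tree_over G (Atomic l)" using lA Atomic by (simp add: join_tree_over_def)
    have sub': "\<A> \<subseteq> cube n (verts (graph_of (Atomic l)) - {})"
      using sub Atomic unfolding verts_graph_of Diff_empty by simp
    let ?m = "chi G \<theta> n {} (Atomic l) \<A>"
    obtain \<P> where P: "\<forall>i<?m. pathset G \<theta> n {} (graph_of (Atomic l)) (\<P> i)" "\<A> \<subseteq> (\<Union>i<?m. \<P> i)"
      using chi_Atomic_attained[OF fin sg nonneg jt n sub'] by (elim exE conjE) (rule that)
    have fU: "finite (vts A - S)" using fin_vts[OF lA] by simp
    have Ps: "\<P> i \<subseteq> cube n (vts A)" if "i < ?m" for i
      using pathset_subset_cube[OF P(1)[rule_format, OF that]] Atomic by simp
    have secs: "sec (vts A) (vts A) S (\<P> i) z \<subseteq> cube n (vts A - S)" if "i < ?m" for i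
      using sec_subset_cube[OF Ps[OF that]] by blast
    have "mu n (vts A - S) (sec (vts A) (vts A) S \<A> z) \<le> mu n (vts A - S) (\<Union>i<?m. sec (vts A) (vts A) S (\<P> i) z)"
      using secs by (intro mu_mono[OF fU sec_Union[OF P(2)]]) (rule UN_least, simp)
    also have "\<dots> \<le> (\<Sum>i<?m. mu n (vts A - S) (sec (vts A) (vts A) S (\<P> i) z))"
      by (intro mu_Union_le[OF fU] secs)
    finally have "real n powr dl A S * mu n (vts A - S) (sec (vts A) (vts A) S \<A> z)
        \<le> (\<Sum>i<?m. real n powr dl A S * mu n (vts A - S) (sec (vts A) (vts A) S (\<P> i) z))"
      unfolding sum_distrib_left[symmetric] by (rule mult_left_mono) simp
    also have "\<dots> \<le> (\<Sum>i<?m. 1)" using P(1) Atomic by (intro sum_mono ps) simp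
    finally show ?thesis using Atomic by simp
  next
    case (Join B C)
    have lB: "labels B \<subseteq> edges G" using lA Join by simp
    show ?thesis
    proof (rule chi_sib_ge[of _ B C])
      fix \<A>' \<B> \<C>
      assume p: "pathset G \<theta> n {} (graph_of A) \<A>'" and B: "pathset G \<theta> n {} (graph_of B) \<B>"
        and r: "\<And>y. y \<in> \<A>' \<Longrightarrow> restrict y (vts B) \<in> \<B>"
      have Bs: "\<B> \<subseteq> cube n (vts B)" using pathset_subset_cube[OF B] by simp
      show "real n powr dl A S * mu n (vts A - S) (sec (vts A) (vts A) S \<A>' z)
        \<le> max (real (chi G \<theta> n {} B \<B>)) (real (chi G \<theta> n {} C \<C>))"
      proof (cases "\<A>' = {}")
        case False
        hence "\<B> \<noteq> {}" using r by blast
        hence "1 \<le> real (chi G \<theta> n {} B \<B>)" using chi_ge_1[OF lB n Bs] by blast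
        thus ?thesis using ps[OF p] by linarith
      qed (simp add: sec_def mu_def)
    qed (use Join lA n sub in \<open>simp_all add: sib_def\<close>)
  qed
qed

text \<open>
  The relation \<open>\<A>'\<close> of a triple is revealed in two stages: first the coordinates in \<open>vts D - S\<close>, then,
  given these, those in \<open>vts E\<close>. Stage one is controlled by a section of \<open>\<B>\<close> and stage two by a section
  of \<open>\<C>\<close>.
\<close>

lemma mu_two_stage:
  assumes sib: "vts P = vts B \<union> vts C" and lP: "labels P \<subseteq> edges G" and n: "n > 0"
    and A': "\<A>' \<subseteq> cube n (vts P)" and Bc: "\<B> \<subseteq> cube n (vts B)" and Cc: "\<C> \<subseteq> cube n (vts C)"
    and rB: "\<And>y. y \<in> \<A>' \<Longrightarrow> restrict y (vts B) \<in> \<B>"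
    and rC: "\<And>y. y \<in> \<A>' \<Longrightarrow> restrict y (vts C) \<in> \<C>"
    and D: "vts D \<subseteq> vts B" and E: "vts E \<subseteq> vts C" and z: "z \<in> cube n S"
    and b: "b \<ge> 0" and bnd: "\<And>z'. z' \<in> cube n (S \<union> vts D) \<Longrightarrow>
        mu n (vts E - (S \<union> vts D)) (sec (vts C) (vts E) (S \<union> vts D) \<C> z') \<le> b"
  shows "mu n (vts P - S) (sec (vts P) (vts P) S \<A>' z) \<le> mu n (vts D - S) (sec (vts B) (vts D) S \<B> z) * b"
proof -
  let ?R = "sec (vts P) (vts P) S \<A>' z"
  let ?U1 = "vts D - S" and ?U2 = "vts E - (S \<union> vts D)"
  have R: "?R \<subseteq> cube n (vts P - S)" by (rule sec_subset_cube[OF A' subset_refl])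
  have fW: "finite (vts P - S)" using fin_vts[OF lP] by simp
  have fD: "finite (vts D)" using D sib fin_vts[OF lP] by (intro finite_subset[of "vts D" "vts P"]) auto
  have fE: "finite (vts E)" using E sib fin_vts[OF lP] by (intro finite_subset[of "vts E" "vts P"]) auto
  have U: "?U1 \<subseteq> vts P - S" "?U2 \<subseteq> vts P - S" "?U1 \<inter> ?U2 = {}"
    using D E unfolding sib by blast+
  have "mu n (vts P - S) ?R \<le> mu n ?U1 ((\<lambda>r. restrict r ?U1) ` ?R) * b"
  proof (rule mu_le_fibres[OF fW n R U])
    fix x assume "x \<in> (\<lambda>r. restrict r ?U1) ` ?R"
    then obtain r0 where r0: "r0 \<in> ?R" "x = restrict r0 ?U1" by (rule imageE)
    \<comment> \<open>\<open>z'\<close> glues the given condition on \<open>S\<close> to the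
      coordinates of \<open>D\<close> revealed in the first stage.\<close>
    define z' where "z' = (\<lambda>i\<in>S \<union> vts D. if i \<in> S then z i else x i)"
    have z': "z' \<in> cube n (S \<union> vts D)"
    proof (rule PiE_I)
      fix i assume i: "i \<in> S \<union> vts D"
      show "z' i \<in> {1..n}"
      proof (cases "i \<in> S")
        case True
        thus ?thesis using PiE_mem[OF z True] by (simp add: z'_def)
      next
        case False
        hence iU: "i \<in> ?U1" "i \<in> vts P - S" using i U by auto
        have "r0 i \<in> {1..n}" using PiE_mem[OF subsetD[OF R r0(1)] iU(2)] .
        thus ?thesis using False i iU(1) by (simp add: z'_def r0(2))
      qed
    qed (simp add: z'_def)
    have "(\<lambda>r. restrict r ?U2) ` {r \<in> ?R. restrict r ?U1 = x} \<subseteq> sec (vts C) (vts E) (S \<union> vts D) \<C> z'"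
    proof
      fix w assume "w \<in> (\<lambda>r. restrict r ?U2) ` {r \<in> ?R. restrict r ?U1 = x}"
      then obtain r where r: "r \<in> ?R" "restrict r ?U1 = x" "w = restrict r ?U2" by auto
      from r(1) obtain y where y: "y \<in> \<A>'" "\<forall>i\<in>vts P \<inter> S. y i = z i" "r = restrict y (vts P - S)"
        unfolding sec_def by auto
      let ?y = "restrict y (vts C)"
      have "w = restrict ?y ?U2"
        unfolding r(3) y(3) restrict_eq_iff using U(2) E by auto
      moreover have "?y i = z' i" if i: "i \<in> vts C \<inter> (S \<union> vts D)" for i
      proof (cases "i \<in> S")
        case True
        hence "i \<in> vts P \<inter> S" using i sib by simp
        hence "y i = z i" using y(2) by blast
        thus ?thesis using True i by (simp add: z'_def)
      next
        case False
        hence "i \<in> ?U1" "i \<in> vts P - S" using i sib by auto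
        hence "x i = y i" unfolding r(2)[symmetric] y(3) by simp
        thus ?thesis using False i by (simp add: z'_def)
      qed
      ultimately show "w \<in> sec (vts C) (vts E) (S \<union> vts D) \<C> z'"
        using rC[OF y(1)] unfolding sec_def by blast
    qed
    hence "mu n ?U2 ((\<lambda>r. restrict r ?U2) ` {r \<in> ?R. restrict r ?U1 = x})
        \<le> mu n ?U2 (sec (vts C) (vts E) (S \<union> vts D) \<C> z')"
      by (rule mu_mono[rotated]) (rule sec_subset_cube[OF Cc E], use fE in simp)
    also have "\<dots> \<le> b" by (rule bnd[OF z'])
    finally show "mu n ?U2 ((\<lambda>r. restrict r ?U2) ` {r \<in> ?R. restrict r ?U1 = x}) \<le> b" .
  qed
  also have "\<dots> \<le> mu n ?U1 (sec (vts B) (vts D) S \<B> z) * b"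
  proof (rule mult_right_mono[OF _ b])
    have "(\<lambda>r. restrict r ?U1) ` ?R \<subseteq> sec (vts B) (vts D) S \<B> z"
    proof
      fix w assume "w \<in> (\<lambda>r. restrict r ?U1) ` ?R"
      then obtain r where r: "r \<in> ?R" "w = restrict r ?U1" by auto
      from r(1) obtain y where y: "y \<in> \<A>'" "\<forall>i\<in>vts P \<inter> S. y i = z i" "r = restrict y (vts P - S)"
        unfolding sec_def by auto
      let ?y = "restrict y (vts B)"
      have "w = restrict ?y ?U1"
        unfolding r(2) y(3) restrict_eq_iff using U(1) D by auto
      moreover have "?y i = z i" if i: "i \<in> vts B \<inter> S" for i
      proof -
        have "i \<in> vts P \<inter> S" using i sib by simp
        hence "y i = z i" using y(2) by blast
        thus ?thesis using i by simp
      qed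
      ultimately show "w \<in> sec (vts B) (vts D) S \<B> z" using rB[OF y(1)] unfolding sec_def by blast
    qed
    thus "mu n ?U1 ((\<lambda>r. restrict r ?U1) ` ?R) \<le> mu n ?U1 (sec (vts B) (vts D) S \<B> z)"
      by (rule mu_mono[rotated]) (rule sec_subset_cube[OF Bc D], use fD in simp)
  qed
  finally show ?thesis .
qed

section \<open>Three rules for combining exponents at a join\<close>

lemma sib_commute: "sib P B C \<Longrightarrow> sib P C B"
  by (auto simp: sib_def)

text \<open>\<open>D\<close> is revealed first; the pathset condition on the relation at
  \<open>C\<close> with \<open>T = S \<union> vts D\<close> then bounds the second stage by
  \<open>n powr - dl C T\<close>.\<close>

lemma LB_after:
  assumes sib: "sib P B C" and lP: "labels P \<subseteq> edges G" and S: "S \<subseteq> verts G"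
    and D: "D \<in> subt B" and lb: "lb D S t"
  shows "lb P S (t + dl C (S \<union> vts D))"
  unfolding LB_def
proof (intro allI impI ballI)
  fix n \<A> z assume n: "(n::nat) > 0" and sub: "\<A> \<subseteq> cube n (vts P)" and z: "z \<in> cube n S"
  let ?d = "dl C (S \<union> vts D)"
  have lBC: "labels B \<subseteq> edges G" "labels C \<subseteq> edges G" using lP sib_labels[OF sib] by auto
  have DB: "vts D \<subseteq> vts B" using labels_subt[OF D] by auto
  have SD: "S \<union> vts D \<subseteq> verts G" using S DB vts_subset[OF lBC(1)] by blast
  show "real n powr (t + ?d) * mu n (vts P - S) (sec (vts P) (vts P) S \<A> z) \<le> real (chi G \<theta> n {} P \<A>)"
  proof (rule chi_sib_ge[OF sib lP n sub subset_refl])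
    fix \<A>' \<B> \<C>
    assume p: "pathset G \<theta> n {} (graph_of P) \<A>'" and B: "pathset G \<theta> n {} (graph_of B) \<B>"
      and C: "pathset G \<theta> n {} (graph_of C) \<C>"
      and r: "\<And>y. y \<in> \<A>' \<Longrightarrow> restrict y (vts B) \<in> \<B>" "\<And>y. y \<in> \<A>' \<Longrightarrow> restrict y (vts C) \<in> \<C>"
    have c: "\<A>' \<subseteq> cube n (vts P)" "\<B> \<subseteq> cube n (vts B)" "\<C> \<subseteq> cube n (vts C)"
      using pathset_subset_cube[OF p] pathset_subset_cube[OF B] pathset_subset_cube[OF C] by simp_all
    have "mu n (vts P - S) (sec (vts P) (vts P) S \<A>' z)
        \<le> mu n (vts D - S) (sec (vts B) (vts D) S \<B> z) * real n powr - ?d"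
      by (rule mu_two_stage[OF sib_vts[OF sib] lP n c r DB subset_refl z _ pathset_sec[OF C SD]]) simp_all
    hence "real n powr (t + ?d) * mu n (vts P - S) (sec (vts P) (vts P) S \<A>' z)
        \<le> real n powr (t + ?d) * (mu n (vts D - S) (sec (vts B) (vts D) S \<B> z) * real n powr - ?d)"
      by (rule mult_left_mono) simp
    also have "\<dots> = real n powr t * mu n (vts D - S) (sec (vts B) (vts D) S \<B> z) * (real n powr ?d * real n powr - ?d)"
      by (simp add: powr_add)
    also have "\<dots> = real n powr t * mu n (vts D - S) (sec (vts B) (vts D) S \<B> z)"
      unfolding powr_minus_cancel[OF n] by simp
    also have "\<dots> \<le> real (chi G \<theta> n {} B \<B>)" by (rule LB_sec[OF lb D lBC(1) n c(2) z])
    finally show "real n powr (t + ?d) * mu n (vts P - S) (sec (vts P) (vts P) S \<A>' z)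
        \<le> max (real (chi G \<theta> n {} B \<B>)) (real (chi G \<theta> n {} C \<C>))" by simp
  qed simp
qed

text \<open>The stages in the other order: all of \<open>C\<close> first, where the pathset
  condition yields the factor \<open>n powr - dl C S\<close>, then \<open>D\<close> conditioned on
  \<open>S \<union> vts C\<close>.\<close>

lemma LB_before:
  assumes sib: "sib P B C" and lP: "labels P \<subseteq> edges G" and S: "S \<subseteq> verts G"
    and D: "D \<in> subt B" and lb: "lb D (S \<union> vts C) t"
  shows "lb P S (t + dl C S)"
  unfolding LB_def
proof (intro allI impI ballI)
  fix n \<A> z assume n: "(n::nat) > 0" and sub: "\<A> \<subseteq> cube n (vts P)" and z: "z \<in> cube n S"
  have lBC: "labels B \<subseteq> edges G" "labels C \<subseteq> edges G" using lP sib_labels[OF sib] by auto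
  have DB: "vts D \<subseteq> vts B" using labels_subt[OF D] by auto
  note sib' = sib_commute[OF sib]
  show "real n powr (t + dl C S) * mu n (vts P - S) (sec (vts P) (vts P) S \<A> z) \<le> real (chi G \<theta> n {} P \<A>)"
  proof (rule chi_sib_ge[OF sib lP n sub subset_refl])
    fix \<A>' \<B> \<C>
    assume p: "pathset G \<theta> n {} (graph_of P) \<A>'" and B: "pathset G \<theta> n {} (graph_of B) \<B>"
      and C: "pathset G \<theta> n {} (graph_of C) \<C>"
      and r: "\<And>y. y \<in> \<A>' \<Longrightarrow> restrict y (vts B) \<in> \<B>" "\<And>y. y \<in> \<A>' \<Longrightarrow> restrict y (vts C) \<in> \<C>"
    have c: "\<A>' \<subseteq> cube n (vts P)" "\<B> \<subseteq> cube n (vts B)" "\<C> \<subseteq> cube n (vts C)"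
      using pathset_subset_cube[OF p] pathset_subset_cube[OF B] pathset_subset_cube[OF C] by simp_all
    let ?x = "real (chi G \<theta> n {} B \<B>)"
    have bnd: "mu n (vts D - (S \<union> vts C)) (sec (vts B) (vts D) (S \<union> vts C) \<B> z') \<le> real n powr - t * ?x"
      if "z' \<in> cube n (S \<union> vts C)" for z'
      using LB_sec[OF lb D lBC(1) n c(2) that] n by (simp add: powr_minus divide_simps mult.commute)
    have "mu n (vts P - S) (sec (vts P) (vts P) S \<A>' z)
        \<le> mu n (vts C - S) (sec (vts C) (vts C) S \<C> z) * (real n powr - t * ?x)"
      by (rule mu_two_stage[OF sib_vts[OF sib'] lP n c(1,3,2) r(2,1) subset_refl DB z _ bnd]) simp_all
    also have "\<dots> \<le> real n powr - dl C S * (real n powr - t * ?x)"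
      using pathset_sec[OF C S z] by (rule mult_right_mono) simp
    also have "\<dots> = real n powr - (t + dl C S) * ?x"
      by (simp add: add.commute[of t] flip: powr_add mult.assoc)
    finally have "mu n (vts P - S) (sec (vts P) (vts P) S \<A>' z) \<le> real n powr - (t + dl C S) * ?x" .
    from mult_powr_le[OF n this]
    show "real n powr (t + dl C S) * mu n (vts P - S) (sec (vts P) (vts P) S \<A>' z)
        \<le> max (real (chi G \<theta> n {} B \<B>)) (real (chi G \<theta> n {} C \<C>))" by simp
  qed simp
qed

text \<open>Let \<open>?M\<close> be the larger of the two complexities. Two stages bound the
  density by \<open>n powr - (t1 + t2)\<close> times the square of \<open>?M\<close>, and the
  pathset condition at \<open>P\<close> bounds it by \<open>n powr - dl P S\<close>. The geometric
  mean of the two bounds is linear in \<open>?M\<close>.\<close>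

lemma LB_average:
  assumes sib: "sib P B C" and lP: "labels P \<subseteq> edges G" and S: "S \<subseteq> verts G"
    and D: "D \<in> subt B" and E: "E \<in> subt C" and lb1: "lb D S t1" and lb2: "lb E (S \<union> vts D) t2"
  shows "lb P S ((t1 + t2 + dl P S) / 2)"
  unfolding LB_def
proof (intro allI impI ballI)
  fix n \<A> z assume n: "(n::nat) > 0" and sub: "\<A> \<subseteq> cube n (vts P)" and z: "z \<in> cube n S"
  have lBC: "labels B \<subseteq> edges G" "labels C \<subseteq> edges G" using lP sib_labels[OF sib] by auto
  have DB: "vts D \<subseteq> vts B" using labels_subt[OF D] by auto
  have EC: "vts E \<subseteq> vts C" using labels_subt[OF E] by auto
  show "real n powr ((t1 + t2 + dl P S) / 2) * mu n (vts P - S) (sec (vts P) (vts P) S \<A> z)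
      \<le> real (chi G \<theta> n {} P \<A>)"
  proof (rule chi_sib_ge[OF sib lP n sub subset_refl])
    fix \<A>' \<B> \<C>
    assume p: "pathset G \<theta> n {} (graph_of P) \<A>'" and B: "pathset G \<theta> n {} (graph_of B) \<B>"
      and C: "pathset G \<theta> n {} (graph_of C) \<C>"
      and r: "\<And>y. y \<in> \<A>' \<Longrightarrow> restrict y (vts B) \<in> \<B>" "\<And>y. y \<in> \<A>' \<Longrightarrow> restrict y (vts C) \<in> \<C>"
    have c: "\<A>' \<subseteq> cube n (vts P)" "\<B> \<subseteq> cube n (vts B)" "\<C> \<subseteq> cube n (vts C)"
      using pathset_subset_cube[OF p] pathset_subset_cube[OF B] pathset_subset_cube[OF C] by simp_all
    let ?x = "real (chi G \<theta> n {} B \<B>)" and ?y = "real (chi G \<theta> n {} C \<C>)"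
    let ?m = "mu n (vts P - S) (sec (vts P) (vts P) S \<A>' z)" and ?M = "max ?x ?y"
    have bnd: "mu n (vts E - (S \<union> vts D)) (sec (vts C) (vts E) (S \<union> vts D) \<C> z') \<le> real n powr - t2 * ?y"
      if "z' \<in> cube n (S \<union> vts D)" for z'
      using LB_sec[OF lb2 E lBC(2) n c(3) that] n by (simp add: powr_minus divide_simps mult.commute)
    have mD: "mu n (vts D - S) (sec (vts B) (vts D) S \<B> z) \<le> real n powr - t1 * ?x"
      using LB_sec[OF lb1 D lBC(1) n c(2) z] n by (simp add: powr_minus divide_simps mult.commute)
    have "?m \<le> mu n (vts D - S) (sec (vts B) (vts D) S \<B> z) * (real n powr - t2 * ?y)"
      by (rule mu_two_stage[OF sib_vts[OF sib] lP n c r DB EC z _ bnd]) simp_all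
    also have "\<dots> \<le> (real n powr - t1 * ?x) * (real n powr - t2 * ?y)"
      using mD by (rule mult_right_mono) simp
    also have "\<dots> \<le> (real n powr - t1 * ?M) * (real n powr - t2 * ?M)"
      by (intro mult_mono mult_left_mono) simp_all
    also have "\<dots> = (real n powr - t1 * real n powr - t2) * (?M * ?M)" by (simp only: mult_ac)
    also have "real n powr - t1 * real n powr - t2 = real n powr - (t1 + t2)"
      by (simp flip: powr_add)
    finally have m1: "?m \<le> real n powr - (t1 + t2) * (?M * ?M)" .
    have m2: "?m \<le> real n powr - dl P S" by (rule pathset_sec[OF p S z])
    have "?m\<^sup>2 \<le> (real n powr - (t1 + t2) * (?M * ?M)) * real n powr - dl P S"
      unfolding power2_eq_square by (intro mult_mono m1 m2 mu_nonneg) simp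
    also have "\<dots> = (real n powr - ((t1 + t2 + dl P S) / 2) * ?M)\<^sup>2"
    proof -
      have "(real n powr - ((t1 + t2 + dl P S) / 2))\<^sup>2 = real n powr - (t1 + t2) * real n powr - dl P S"
        unfolding power2_eq_square powr_add[symmetric] by (rule arg_cong[of _ _ "(powr) (real n)"]) argo
      thus ?thesis by (simp add: power_mult_distrib power2_eq_square mult_ac)
    qed
    finally have "?m \<le> real n powr - ((t1 + t2 + dl P S) / 2) * ?M"
      by (rule power2_le_imp_le) simp
    from mult_powr_le[OF n this]
    show "real n powr ((t1 + t2 + dl P S) / 2) * ?m \<le> ?M" .
  qed simp
qed

end

section \<open>Connectivity inside a join-tree\<close>

definition conn :: "'v set join_tree \<Rightarrow> ('v \<times> 'v) set" where
  "conn X = {(x, y). {x, y} \<in> labels X}\<^sup>*"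

text \<open>Membership of \<open>x\<close> in the vertex set of
  \<open>graph_of X \<ominus> S\<close>, phrased through \<open>conn\<close> to avoid forming
  components; \<open>safe_ominus\<close> and \<open>ominus_safe\<close> give the two
  directions.\<close>

definition safe :: "'v set join_tree \<Rightarrow> 'v set \<Rightarrow> 'v \<Rightarrow> bool" where
  "safe X S x \<longleftrightarrow> x \<in> vts X \<and> (\<forall>y. (x, y) \<in> conn X \<longrightarrow> y \<notin> S)"

lemma conn_refl [simp]: "(x, x) \<in> conn X"
  by (simp add: conn_def)

lemma conn_trans: "(x, y) \<in> conn X \<Longrightarrow> (y, z) \<in> conn X \<Longrightarrow> (x, z) \<in> conn X"
  by (simp add: conn_def)

lemma conn_sym: "(x, y) \<in> conn X \<Longrightarrow> (y, x) \<in> conn X"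
proof -
  have "sym {(x, y). {x, y} \<in> labels X}" by (auto simp: sym_def insert_commute)
  thus "(x, y) \<in> conn X \<Longrightarrow> (y, x) \<in> conn X"
    unfolding conn_def by (meson sym_rtrancl symD)
qed

lemma conn_edge: "{x, y} \<in> labels X \<Longrightarrow> (x, y) \<in> conn X"
  by (auto simp: conn_def)

lemma conn_mono: "labels X \<subseteq> labels Z \<Longrightarrow> (x, y) \<in> conn X \<Longrightarrow> (x, y) \<in> conn Z"
  unfolding conn_def by (rule rtrancl_mono[THEN subsetD, rotated]) auto

lemma conn_vts: "(x, y) \<in> conn X \<Longrightarrow> x \<in> vts X \<Longrightarrow> y \<in> vts X"
  unfolding conn_def by (induction rule: rtrancl_induct) auto

lemma safe_conn: "safe X S x \<Longrightarrow> (x, y) \<in> conn X \<Longrightarrow> safe X S y"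
  unfolding safe_def using conn_vts conn_trans by metis

lemma safe_subtree:
  assumes "safe Z S x" "labels X \<subseteq> labels Z" "x \<in> vts X"
  shows "safe X S x"
  using assms conn_mono[OF assms(2)] unfolding safe_def by blast

lemma safe_ominus: "safe X S x \<Longrightarrow> x \<in> verts (graph_of X \<ominus> S)"
  by (auto simp: ominus_def Let_def components_def component_of_def reachable_set_def safe_def
      conn_def disjoint_iff graph_of_def)

lemma ominus_safe: "x \<in> verts (graph_of X \<ominus> S) \<Longrightarrow> safe X S x"
proof -
  assume "x \<in> verts (graph_of X \<ominus> S)"
  then obtain v where v: "v \<in> vts X" "(v, x) \<in> conn X" "\<And>w. (v, w) \<in> conn X \<Longrightarrow> w \<notin> S"
    by (auto simp: ominus_def Let_def components_def component_of_def reachable_set_def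
        conn_def disjoint_iff graph_of_def)
  thus ?thesis using conn_vts[OF v(2,1)] conn_trans[OF v(2)] unfolding safe_def by blast
qed

lemma edges_ominus:
  assumes "e \<in> edges (graph_of X \<ominus> S)"
  shows "e \<in> labels X" "e \<subseteq> verts (graph_of X \<ominus> S)"
proof -
  obtain v where v: "v \<in> vts X" "reachable_set (graph_of X) v \<inter> S = {}" "e \<in> labels X"
      "e \<subseteq> reachable_set (graph_of X) v"
    using assms by (auto simp: ominus_def Let_def components_def component_of_def)
  show "e \<in> labels X" by (rule v(3))
  show "e \<subseteq> verts (graph_of X \<ominus> S)"
  proof (rule order_trans[OF v(4)])
    have "component_of (graph_of X) v \<in> {C \<in> components (graph_of X). verts C \<inter> S = {}}"
      using v(1,2) by (auto simp: components_def component_of_def)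
    hence "verts (component_of (graph_of X) v) \<subseteq> verts (graph_of X \<ominus> S)"
      unfolding ominus_def Let_def by (simp only: ugraph.select_convs) (rule UN_upper)
    thus "reachable_set (graph_of X) v \<subseteq> verts (graph_of X \<ominus> S)" by (simp add: component_of_def)
  qed
qed

section \<open>The random walk weighting of the complete binary tree\<close>

locale binary_tree =
  fixes k :: nat
  assumes k: "k \<ge> 1"
begin

abbreviation "G \<equiv> complete_binary_tree k"

definition deg :: "bool list \<Rightarrow> real" where
  "deg x = (if x = [] then 2 else if length x = k then 1 else 3)"

text \<open>Every vertex distributes a total weight of 1 evenly over its edges in \<open>G\<close>,
  like the transition probabilities of the random walk.\<close>

definition \<theta> :: "bool list set \<Rightarrow> real" where
  "\<theta> e = (\<Sum>x\<in>e. 1 / deg x)"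

abbreviation inc :: "bool list set set \<Rightarrow> bool list \<Rightarrow> bool list set set" where
  "inc E x \<equiv> {e \<in> E. x \<in> e}"

lemma verts_G: "x \<in> verts G \<longleftrightarrow> length x \<le> k"
  by (simp add: complete_binary_tree_def)

lemma edge_iff: "e \<in> edges G \<longleftrightarrow> (\<exists>x b. e = {x, b # x} \<and> length x < k)"
  by (auto simp: complete_binary_tree_def)

lemma finite_G: "finite (verts G)" and simple_G: "simple_graph G"
  using finite_graph_complete_binary_tree[of k] by (auto simp: finite_graph_def)

lemma finite_edges: "finite (edges G)"
proof (rule finite_subset)
  show "edges G \<subseteq> Pow (verts G)" using simple_G by (auto simp: simple_graph_def)
qed (simp add: finite_G)

lemma deg_pos: "deg x > 0" and deg_ge_1: "deg x \<ge> 1" and deg_le_3: "deg x \<le> 3"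
  by (auto simp: deg_def)

lemma inc_eq:
  assumes "length x \<le> k"
  shows "inc (edges G) x = (if length x < k then {{x, True # x}, {x, False # x}} else {}) \<union>
           (if x = [] then {} else {{tl x, x}})"
proof (rule set_eqI)
  fix e
  have "e \<in> inc (edges G) x \<longleftrightarrow>
      (\<exists>b. e = {x, b # x} \<and> length x < k) \<or> (\<exists>p b. e = {p, b # p} \<and> x = b # p)"
    using assms by (auto simp: edge_iff)
  also have "(\<exists>p b. e = {p, b # p} \<and> x = b # p) \<longleftrightarrow> x \<noteq> [] \<and> e = {tl x, x}"
    by (cases x) auto
  also have "(\<exists>b. e = {x, b # x} \<and> length x < k) \<longleftrightarrow> length x < k \<and> (e = {x, True # x} \<or> e = {x, False # x})"
    by (metis (full_types))
  finally show "e \<in> inc (edges G) x \<longleftrightarrow> e \<in> (if length x < k then {{x, True # x}, {x, False # x}} else {}) \<union>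
           (if x = [] then {} else {{tl x, x}})" by auto
qed

lemma card_inc:
  assumes "length x \<le> k"
  shows "real (card (inc (edges G) x)) = deg x"
proof -
  have ne: "{x, True # x} \<noteq> {x, False # x}" "{tl x, x} \<noteq> {x, b # x}" for b
  proof -
    show "{x, True # x} \<noteq> {x, False # x}" by (auto simp: doubleton_eq_iff)
    have "length (tl x) < length (b # x)" by simp
    thus "{tl x, x} \<noteq> {x, b # x}" by (metis doubleton_eq_iff less_irrefl not_Cons_self2)
  qed
  show ?thesis unfolding inc_eq[OF assms] deg_def using assms k ne by (auto simp: card_insert_if)
qed

text \<open>Double counting of incidences: a vertex contributes the fraction of its edges in
  \<open>G\<close> that is missing from \<open>F\<close>. For \<open>F = G\<close> all contributions
  vanish.\<close>

lemma Delta_eq: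
  assumes "finite (verts F)" "edges F \<subseteq> edges G" "\<And>e. e \<in> edges F \<Longrightarrow> e \<subseteq> verts F"
  shows "Delta \<theta> F = (\<Sum>x\<in>verts F. 1 - real (card (inc (edges F) x)) / deg x)"
proof -
  have fE: "finite (edges F)" using assms(2) finite_edges finite_subset by blast
  have "(\<Sum>e\<in>edges F. \<theta> e) = (\<Sum>e\<in>edges F. \<Sum>x | x \<in> verts F \<and> x \<in> e. 1 / deg x)"
    unfolding \<theta>_def by (intro sum.cong refl) (use assms(3) in blast)
  also have "\<dots> = (\<Sum>x\<in>verts F. \<Sum>e | e \<in> edges F \<and> x \<in> e. 1 / deg x)"
    by (rule sum.swap_restrict[OF fE assms(1)])
  also have "\<dots> = (\<Sum>x\<in>verts F. real (card (inc (edges F) x)) / deg x)" by simp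
  finally show ?thesis by (simp add: Delta_def sum_subtractf)
qed

lemma card_inc_le: 
  assumes "E \<subseteq> edges G" "length x \<le> k"
  shows "real (card (inc E x)) \<le> deg x"
proof -
  have "card (inc E x) \<le> card (inc (edges G) x)"
    using assms(1) finite_edges by (intro card_mono) auto
  thus ?thesis using card_inc[OF assms(2)] by linarith
qed

lemma threshold: "threshold_weighting G \<theta>"
  unfolding threshold_weighting_def
proof (intro conjI ballI allI impI)
  fix e assume e: "e \<in> edges G"
  show "0 \<le> \<theta> e" unfolding \<theta>_def using deg_pos by (intro sum_nonneg) (simp add: less_imp_le)
  have "card e = 2" using e simple_G by (simp add: simple_graph_def)
  have "\<theta> e \<le> (\<Sum>x\<in>e. 1)" unfolding \<theta>_def using deg_ge_1 by (intro sum_mono) (simp add: divide_le_eq deg_pos)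
  thus "\<theta> e \<le> 2" using \<open>card e = 2\<close> by simp
next
  fix F assume "subgraph F G"
  hence F: "edges F \<subseteq> edges G" "verts F = \<Union> (edges F)" by (auto simp: subgraph_def)
  have sub: "verts F \<subseteq> verts G" using F simple_G by (fastforce simp: simple_graph_def)
  have "Delta \<theta> F = (\<Sum>x\<in>verts F. 1 - real (card (inc (edges F) x)) / deg x)"
    using F by (intro Delta_eq finite_subset[OF sub finite_G]) auto
  also have "\<dots> \<ge> 0"
  proof (rule sum_nonneg)
    fix x assume "x \<in> verts F"
    hence "length x \<le> k" using sub verts_G by blast
    from card_inc_le[OF F(1) this] show "0 \<le> 1 - real (card (inc (edges F) x)) / deg x"
      using deg_pos[of x] by simp
  qed
  finally show "Delta \<theta> F \<ge> 0" .
next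
  have "Delta \<theta> G = (\<Sum>x\<in>verts G. 1 - real (card (inc (edges G) x)) / deg x)"
    using simple_G by (intro Delta_eq finite_G) (auto simp: simple_graph_def)
  also have "\<dots> = (\<Sum>x\<in>verts G. 0)"
    using deg_pos by (intro sum.cong refl) (simp add: card_inc verts_G less_imp_neq[symmetric])
  finally show "Delta \<theta> G = 0" by simp
qed

sublocale weighted_graph G \<theta>
  using threshold by unfold_locales (auto simp: finite_G simple_G threshold_weighting_def)

section \<open>Missing edges bound Delta from below\<close>

lemma length_vts: "labels X \<subseteq> edges G \<Longrightarrow> x \<in> vts X \<Longrightarrow> length x \<le> k"
  using vts_subset[of X] verts_G by blast

text \<open>A missing edge at a vertex contributes one over its degree, hence at least 1/3. Pairs of
  vertex and edge are counted, so an edge may count once at each end.\<close>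

lemma card_boundary_le:
  assumes lX: "labels X \<subseteq> edges G"
    and B: "\<And>x e. (x, e) \<in> B \<Longrightarrow> safe X S x \<and> e \<in> edges G \<and> e \<notin> labels X \<and> x \<in> e"
  shows "real (card B) \<le> 3 * dl X S"
proof -
  let ?F = "graph_of X \<ominus> S"
  have sub: "verts ?F \<subseteq> vts X"
    using ominus_safe[of _ X S] unfolding safe_def by (intro subsetI) (rule conjunct1)
  have fV: "finite (verts ?F)" by (rule finite_subset[OF sub fin_vts[OF lX]])
  have E: "edges ?F \<subseteq> edges G" using edges_ominus(1)[of _ X S] lX by (intro subsetI) (rule subsetD)
  let ?C = "\<lambda>x. {e. (x, e) \<in> B}"
  have BS: "B \<subseteq> Sigma (verts ?F) ?C" using B safe_ominus[of X S] by (intro subrelI) simp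
  have "?C x \<subseteq> edges G" for x using B by (intro subsetI) simp
  hence fC: "finite (?C x)" for x using finite_edges by (rule finite_subset)
  have "card B \<le> card (Sigma (verts ?F) ?C)" by (rule card_mono[OF finite_SigmaI[OF fV fC] BS])
  also have "\<dots> = (\<Sum>x\<in>verts ?F. card (?C x))" by (rule card_SigmaI[OF fV]) (simp add: fC)
  finally have "real (card B) \<le> (\<Sum>x\<in>verts ?F. real (card (?C x)))"
    by (simp flip: of_nat_sum)
  also have "\<dots> \<le> (\<Sum>x\<in>verts ?F. 3 * (1 - real (card (inc (edges ?F) x)) / deg x))"
  proof (rule sum_mono)
    fix x assume "x \<in> verts ?F"
    hence len: "length x \<le> k" by (intro length_vts[OF lX] subsetD[OF sub])
    have "card (?C x) + card (inc (edges ?F) x) = card (?C x \<union> inc (edges ?F) x)"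
    proof (rule card_Un_disjoint[symmetric])
      show "finite (inc (edges ?F) x)" using finite_subset[OF E finite_edges] by simp
      show "?C x \<inter> inc (edges ?F) x = {}"
        using B edges_ominus(1)[of _ X S] by (auto simp del: edges_graph_of)
    qed (rule fC)
    also have "\<dots> \<le> card (inc (edges G) x)"
    proof (rule card_mono)
      show "?C x \<union> inc (edges ?F) x \<subseteq> inc (edges G) x" using B subsetD[OF E] by auto
    qed (simp add: finite_edges)
    finally have "real (card (?C x)) \<le> deg x - real (card (inc (edges ?F) x))"
      using card_inc[OF len] by linarith
    also have "\<dots> \<le> 3 * ((deg x - real (card (inc (edges ?F) x))) / deg x)"
    proof -
      have "deg x * (deg x - real (card (inc (edges ?F) x))) \<le> 3 * (deg x - real (card (inc (edges ?F) x)))"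
        using deg_le_3 card_inc_le[OF E len] by (intro mult_right_mono) auto
      thus ?thesis using deg_pos[of x] by (simp add: field_simps)
    qed
    finally show "real (card (?C x)) \<le> 3 * (1 - real (card (inc (edges ?F) x)) / deg x)"
      using deg_pos[of x] by (simp add: diff_divide_distrib)
  qed
  also have "\<dots> = 3 * dl X S"
    using Delta_eq[OF fV E edges_ominus(2)[of _ X S]] by (simp only: sum_distrib_left)
  finally show ?thesis .
qed

text \<open>The form used for trees: pairwise disjoint regions \<open>R j\<close>, each containing a
  safe vertex with a missing edge, yield distinct pairs.\<close>

lemma card_disjoint_boundary_le:
  assumes lX: "labels X \<subseteq> edges G" and J: "finite J"
    and bd: "\<And>j. j \<in> J \<Longrightarrow> \<exists>x e. x \<in> R j \<and> safe X S x \<and> e \<in> edges G \<and> e \<notin> labels X \<and> x \<in> e"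
    and dis: "\<And>i j. i \<in> J \<Longrightarrow> j \<in> J \<Longrightarrow> i \<noteq> j \<Longrightarrow> R i \<inter> R j = {}"
  shows "real (card J) \<le> 3 * dl X S"
proof -
  define Q where "Q j x e \<longleftrightarrow> x \<in> R j \<and> safe X S x \<and> e \<in> edges G \<and> e \<notin> labels X \<and> x \<in> e" for j x e
  have "\<exists>x e. Q j x e" if "j \<in> J" for j using bd[OF that] unfolding Q_def .
  then obtain x e where Q: "\<And>j. j \<in> J \<Longrightarrow> Q j (x j) (e j)" by metis
  note xe = Q[unfolded Q_def]
  have "inj_on (\<lambda>j. (x j, e j)) J"
  proof (rule inj_onI)
    fix i j assume ij: "i \<in> J" "j \<in> J" "(x i, e i) = (x j, e j)"
    have "x i \<in> R i" "x i \<in> R j" using xe[OF ij(1)] xe[OF ij(2)] ij(3) by simp_all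
    thus "i = j" using dis[OF ij(1,2)] by blast
  qed
  hence "card J = card ((\<lambda>j. (x j, e j)) ` J)" by (rule card_image[symmetric])
  also have "real \<dots> \<le> 3 * dl X S"
  proof (rule card_boundary_le[OF lX])
    fix y d assume "(y, d) \<in> (\<lambda>j. (x j, e j)) ` J"
    then obtain j where "j \<in> J" "y = x j" "d = e j" by blast
    thus "safe X S y \<and> d \<in> edges G \<and> d \<notin> labels X \<and> y \<in> d" using xe by simp
  qed
  finally show ?thesis .
qed

section \<open>Full subtrees and paths\<close>

text \<open>The most recent choice comes first in a vertex, so \<open>suffix y p\<close> means that
  \<open>p\<close> is a descendant of \<open>y\<close> or \<open>y\<close> itself. The clause
  \<open>y \<in> vts X\<close> matters at the leaves of \<open>G\<close>, where the edge condition
  is vacuous.\<close>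

definition full :: "bool list set join_tree \<Rightarrow> bool list \<Rightarrow> bool" where
  "full X y \<longleftrightarrow> y \<in> vts X \<and> (\<forall>p b. suffix y p \<and> length p < k \<longrightarrow> {p, b # p} \<in> labels X)"

definition touch :: "bool list set join_tree \<Rightarrow> bool list \<Rightarrow> bool" where
  "touch X y \<longleftrightarrow> (\<exists>p\<in>vts X. suffix y p)"

text \<open>The path in \<open>X\<close> from \<open>p\<close> up to its ancestor \<open>m\<close>,
  given by the parent edge of each vertex strictly below \<open>m\<close>.\<close>

definition up :: "bool list set join_tree \<Rightarrow> bool list \<Rightarrow> bool list \<Rightarrow> bool" where
  "up X m p \<longleftrightarrow> suffix m p \<and> (\<forall>z. suffix z p \<and> length m < length z \<longrightarrow> {tl z, z} \<in> labels X)"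

lemma suffix_trans: "suffix x y \<Longrightarrow> suffix y z \<Longrightarrow> suffix (x :: 'a list) z"
  by (rule suffix_order.trans)

lemma full_mono: "labels X \<subseteq> labels Z \<Longrightarrow> full X y \<Longrightarrow> full Z y"
  unfolding full_def by blast

lemma full_touch: "full X y \<Longrightarrow> touch X y"
  unfolding full_def touch_def by blast

lemma full_suffix:
  assumes "full X y" "suffix y y'" "length y' \<le> k"
  shows "full X y'"
proof -
  have "y' \<in> vts X"
  proof (cases "y' = y")
    case False
    then obtain b p where "y' = b # p" "suffix y p" using assms(2) by (cases y') (auto simp: suffix_Cons)
    hence "{p, y'} \<in> labels X" using assms(1,3) unfolding full_def by auto
    thus ?thesis by blast
  qed (use assms(1) in \<open>simp add: full_def\<close>)
  thus ?thesis using assms(1) suffix_trans[OF assms(2)] unfolding full_def by blast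
qed

lemma full_conn:
  assumes "full X y" "suffix y p" "length p \<le> k"
  shows "(y, p) \<in> conn X"
  using assms(2,3)
proof (induction p)
  case (Cons b p)
  show ?case
  proof (cases "y = b # p")
    case False
    hence s: "suffix y p" using Cons.prems by (simp add: suffix_Cons)
    have "{p, b # p} \<in> labels X" using assms(1) s Cons.prems(2) unfolding full_def by auto
    from conn_trans[OF Cons.IH[OF s] conn_edge[OF this]] show ?thesis using Cons.prems(2) by simp
  qed simp
qed simp

lemma up_conn:
  assumes "up X m p" "suffix m z" "suffix z p"
  shows "(p, z) \<in> conn X"
proof -
  have "suffix z q \<Longrightarrow> suffix q p \<Longrightarrow> (q, z) \<in> conn X" for q
  proof (induction q)
    case (Cons b q)
    show ?case
    proof (cases "z = b # q")
      case False
      hence s: "suffix z q" using Cons.prems by (simp add: suffix_Cons)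
      have "length m < length (b # q)"
        using suffix_length_le[OF assms(2)] suffix_length_le[OF s] by simp
      hence "{q, b # q} \<in> labels X" using assms(1) Cons.prems(2) unfolding up_def by fastforce
      from conn_trans[OF conn_sym[OF conn_edge[OF this]] Cons.IH[OF s suffix_ConsD[OF Cons.prems(2)]]]
      show ?thesis .
    qed simp
  qed simp
  thus ?thesis using assms(3) by simp
qed

text \<open>If no vertex of the component of \<open>p\<close> below \<open>y\<close> had a missing
  edge, one could walk from \<open>p\<close> up to \<open>y\<close> and from there down to every
  descendant of \<open>y\<close>, so \<open>X\<close> would be full at \<open>y\<close>.\<close>

lemma boundary_in_subtree:
  assumes lX: "labels X \<subseteq> edges G" and p: "p \<in> vts X" "suffix y p" and nf: "\<not> full X y"
  shows "\<exists>x e. suffix y x \<and> (p, x) \<in> conn X \<and> e \<in> edges G \<and> e \<notin> labels X \<and> x \<in> e"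
proof (rule ccontr)
  assume no: "\<not> ?thesis"
  have len: "length p \<le> k" using length_vts[OF lX p(1)] .
  have up: "suffix y q \<Longrightarrow> suffix q p \<Longrightarrow> (p, q) \<in> conn X" if "length p = n + length q" for n q
    using that
  proof (induction n arbitrary: q)
    case 0
    hence "q = p" by (auto simp: suffix_def)
    thus ?case by simp
  next
    case (Suc n)
    then obtain zs where zs: "p = zs @ q" by (auto simp: suffix_def)
    moreover have "zs \<noteq> []" using Suc.prems(3) zs by auto
    ultimately obtain zs' b where p': "p = zs' @ b # q" by (metis append.assoc append_Cons append_Nil append_butlast_last_id)
    have "(p, b # q) \<in> conn X"
      by (rule Suc.IH) (use Suc.prems p' in \<open>auto simp: suffix_ConsI suffix_def\<close>)
    moreover have "{q, b # q} \<in> edges G" using p' len by (auto simp: edge_iff)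
    moreover have "suffix y (b # q)" using Suc.prems by (simp add: suffix_ConsI)
    ultimately have "{q, b # q} \<in> labels X" using no by blast
    from conn_trans[OF \<open>(p, b # q) \<in> conn X\<close> conn_sym[OF conn_edge[OF this]]] show ?case .
  qed
  have py: "(p, y) \<in> conn X"
    using up[of "length p - length y" y] p(2) suffix_length_le[OF p(2)] by simp
  have down: "suffix y q \<Longrightarrow> length q \<le> k \<Longrightarrow> (p, q) \<in> conn X" for q
  proof (induction q)
    case (Cons b q)
    show ?case
    proof (cases "y = b # q")
      case False
      hence s: "suffix y q" using Cons.prems by (simp add: suffix_Cons)
      hence c: "(p, q) \<in> conn X" using Cons by simp
      have "{q, b # q} \<in> edges G" using Cons.prems by (auto simp: edge_iff)
      hence "{q, b # q} \<in> labels X" using no s c by blast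
      from conn_trans[OF c conn_edge[OF this]] show ?thesis .
    qed (use py in simp)
  qed (use py in simp)
  have "full X y"
    unfolding full_def
  proof (intro conjI allI impI)
    show "y \<in> vts X" using conn_vts[OF py p(1)] .
    fix q b assume q: "suffix y q \<and> length q < k"
    hence "(p, q) \<in> conn X" using down by simp
    moreover have "{q, b # q} \<in> edges G" using q by (auto simp: edge_iff)
    ultimately show "{q, b # q} \<in> labels X" using no q by blast
  qed
  thus False using nf by blast
qed

lemma suffix_same_length: "suffix x z \<Longrightarrow> suffix y z \<Longrightarrow> length x = length y \<Longrightarrow> x = (y :: 'a list)"
  using suffix_length_suffix[of x z y] by (auto simp: suffix_def)

text \<open>Subtrees rooted at one level are disjoint, and each one touched but not filled has a
  missing edge. Hence small Delta forbids touching many subtrees without containing one of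
  them.\<close>

lemma card_touched_le:
  assumes lX: "labels X \<subseteq> edges G" and Y: "finite Y"
    and len: "\<And>y. y \<in> Y \<Longrightarrow> length y = l"
    and t: "\<And>y. y \<in> Y \<Longrightarrow> \<exists>p. suffix y p \<and> safe X S p"
    and nf: "\<And>y. y \<in> Y \<Longrightarrow> \<not> full X y"
  shows "real (card Y) \<le> 3 * dl X S"
proof (rule card_disjoint_boundary_le[OF lX Y, where R = "\<lambda>y. {x. suffix y x}"])
  fix y assume y: "y \<in> Y"
  then obtain p where p: "suffix y p" "safe X S p" using t by blast
  hence "p \<in> vts X" by (simp add: safe_def)
  from boundary_in_subtree[OF lX this p(1) nf[OF y]] safe_conn[OF p(2)]
  show "\<exists>x e. x \<in> {x. suffix y x} \<and> safe X S x \<and> e \<in> edges G \<and> e \<notin> labels X \<and> x \<in> e" by blast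
next
  fix y y' assume "y \<in> Y" "y' \<in> Y" "y \<noteq> y'"
  thus "{x. suffix y x} \<inter> {x. suffix y' x} = {}"
    using len suffix_same_length[of y _ y'] by auto
qed

text \<open>At each vertex of the path strictly above \<open>p\<close>, either the edge to the child
  off the path is missing, or the component enters that child's subtree, which is not full and so
  has a missing edge inside. These regions are disjoint for different vertices of the path.\<close>

lemma path_boundary:
  assumes lX: "labels X \<subseteq> edges G" and up: "up X m p" and safe: "safe X S p"
    and side: "\<And>z b. suffix m z \<Longrightarrow> suffix (b # z) p \<Longrightarrow> \<not> full X ((\<not> b) # z)"
  shows "real (length p - length m) \<le> 3 * dl X S"
proof -
  have mp: "suffix m p" using up by (simp add: up_def)
  have len: "length p \<le> k" using safe length_vts[OF lX] by (auto simp: safe_def)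
  \<comment> \<open>The vertices of the path from the parent of \<open>p\<close> up to
    \<open>m\<close> inclusive.\<close>
  let ?J = "(\<lambda>i. drop i p) ` {1..length p - length m}"
  have inj: "inj_on (\<lambda>i. drop i p) {1..length p - length m}"
  proof (rule inj_onI)
    fix i j assume ij: "i \<in> {1..length p - length m}" "j \<in> {1..length p - length m}" "drop i p = drop j p"
    have "length (drop i p) = length (drop j p)" using ij(3) by simp
    thus "i = j" using ij(1,2) by auto
  qed
  \<comment> \<open>The choice made at \<open>z\<close> on the way down to \<open>p\<close>;
    negating it gives the child off the path.\<close>
  define hdz where "hdz z = hd (drop (length p - length z - 1) p)" for z :: "bool list"
  have J: "suffix m z \<and> suffix (hdz z # z) p" if zJ: "z \<in> ?J" for z
  proof -
    obtain i where i: "z = drop i p" "1 \<le> i" "i \<le> length p - length m" using zJ by auto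
    have il: "i \<le> length p" using i by simp
    have "length p - length z - 1 = i - 1" using i il by simp
    moreover have "drop (i - 1) p = hd (drop (i - 1) p) # drop i p"
      using i il by (metis Suc_diff_1 Suc_le_eq Cons_nth_drop_Suc hd_drop_conv_nth less_le_trans
          diff_less zero_less_one One_nat_def)
    ultimately have "hdz z # z = drop (i - 1) p" unfolding hdz_def i(1) by simp
    hence "suffix (hdz z # z) p" by (simp add: suffix_drop)
    moreover have "suffix m z"
      using suffix_length_suffix[OF mp suffix_drop[of i p]] i il suffix_length_le[OF mp] by simp
    ultimately show ?thesis by blast
  qed
  have "real (card ?J) \<le> 3 * dl X S"
  proof (rule card_disjoint_boundary_le[OF lX, where R = "\<lambda>z. {z} \<union> {x. suffix ((\<not> hdz z) # z) x}"])
    fix z assume z: "z \<in> ?J"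
    let ?s = "(\<not> hdz z) # z"
    note Jz = J[OF z, THEN conjunct1] J[OF z, THEN conjunct2]
    have sp: "suffix z p" by (rule suffix_ConsD[OF Jz(2)])
    have sz: "safe X S z" by (rule safe_conn[OF safe up_conn[OF up Jz(1) sp]])
    have "length z < k" using suffix_length_le[OF Jz(2)] len by simp
    hence e: "{z, ?s} \<in> edges G" by (auto simp: edge_iff)
    show "\<exists>x e. x \<in> {z} \<union> {x. suffix ?s x} \<and> safe X S x \<and> e \<in> edges G \<and> e \<notin> labels X \<and> x \<in> e"
    proof (cases "{z, ?s} \<in> labels X")
      case False
      thus ?thesis using sz e by blast
    next
      case True
      have ss: "safe X S ?s" using safe_conn[OF sz conn_edge[OF True]] .
      hence "?s \<in> vts X" by (simp add: safe_def)
      moreover have "\<not> full X ?s" by (rule side[OF Jz])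
      ultimately obtain x e where "suffix ?s x" "(?s, x) \<in> conn X" "e \<in> edges G" "e \<notin> labels X" "x \<in> e"
        using boundary_in_subtree[OF lX, of ?s ?s] by blast
      thus ?thesis using safe_conn[OF ss] by blast
    qed
  next
    \<comment> \<open>The deeper vertex \<open>z'\<close> lies below the child of \<open>z\<close>
      on the path, so its region avoids both \<open>z\<close> and the subtree off the path at
      \<open>z\<close>.\<close>
    have dis: "({z} \<union> {x. suffix ((\<not> hdz z) # z) x}) \<inter> ({z'} \<union> {x. suffix ((\<not> hdz z') # z') x}) = {}"
      if "z \<in> ?J" "z' \<in> ?J" "length z < length z'" for z z'
    proof -
      have zp: "suffix z' p" by (rule suffix_ConsD[OF conjunct2[OF J[OF that(2)]]])
      have *: "suffix (hdz z # z) z'"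
        by (rule suffix_length_suffix[OF conjunct2[OF J[OF that(1)]] zp]) (use that(3) in simp)
      have n: "\<not> suffix ((\<not> hdz z) # z) x" if x: "suffix z' x" for x
      proof
        assume "suffix ((\<not> hdz z) # z) x"
        moreover have "suffix (hdz z # z) x" by (rule suffix_trans[OF * x])
        ultimately have "(\<not> hdz z) # z = hdz z # z" by (rule suffix_same_length) simp
        thus False by simp
      qed
      have zz: "z \<noteq> x" if x: "suffix z' x" for x
        using suffix_length_le[OF x] \<open>length z < length z'\<close> by auto
      have s: "suffix z' x" if "x = z' \<or> suffix ((\<not> hdz z') # z') x" for x
        using that by (elim disjE) (simp, erule suffix_ConsD)
      show ?thesis using n[OF s] zz[OF s] by auto
    qed
    fix z z' assume z: "z \<in> ?J" "z' \<in> ?J" "z \<noteq> z'"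
    have "suffix z p" "suffix z' p"
      by (rule suffix_ConsD[OF conjunct2[OF J[OF z(1)]]], rule suffix_ConsD[OF conjunct2[OF J[OF z(2)]]])
    hence "length z \<noteq> length z'" using suffix_same_length[of z p z'] z(3) by blast
    thus "({z} \<union> {x. suffix ((\<not> hdz z) # z) x}) \<inter> ({z'} \<union> {x. suffix ((\<not> hdz z') # z') x}) = {}"
      using dis[of z z'] dis[of z' z] z(1,2) by (metis Int_commute nat_neq_iff)
  qed simp
  thus ?thesis using card_image[OF inj] by simp
qed

text \<open>In a tree, connected vertices are joined by going up to a common ancestor and down
  again. Following the walk edge by edge, the ancestor changes only when an edge climbs above it; it
  then moves to its parent.\<close>

lemma conn_meet:
  assumes lX: "labels X \<subseteq> edges G" and "(p, x) \<in> conn X"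
  shows "\<exists>m. up X m p \<and> up X m x"
  using assms(2) unfolding conn_def
proof (induction rule: rtrancl_induct)
  case base
  show ?case by (rule exI[of _ p]) (auto simp: up_def dest: suffix_length_le)
next
  case (step x x')
  then obtain m where m: "up X m p" "up X m x" by blast
  have e: "{x, x'} \<in> labels X" using step by simp
  hence "{x, x'} \<in> edges G" using lX by blast
  then consider b where "x' = b # x" | b where "x = b # x'"
    by (auto simp: edge_iff doubleton_eq_iff)
  thus ?case
  proof cases
    case 1
    have "up X m x'" using m(2) e unfolding up_def 1 by (auto simp: suffix_Cons)
    thus ?thesis using m(1) by blast
  next
    case 2
    show ?thesis
    proof (cases "m = x")
      case False
      hence "suffix m x'" using m(2) unfolding up_def 2 by (auto simp: suffix_Cons)
      hence "up X m x'" using m(2) unfolding up_def 2 by (auto intro: suffix_ConsI)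
      thus ?thesis using m(1) by blast
    next
      case True
      have "suffix x p" using m(1) True unfolding up_def by simp
      hence "suffix x' p" unfolding 2 by (rule suffix_ConsD)
      moreover have "{tl z, z} \<in> labels X" if z: "suffix z p" "length x' < length z" for z
      proof (cases "length m < length z")
        case False
        hence "length z = length m" using z(2) True 2 by simp
        hence "z = m" using suffix_same_length[OF z(1), of m] m(1) unfolding up_def by simp
        thus ?thesis using e True 2 by (simp add: insert_commute)
      qed (use m(1) z(1) in \<open>simp add: up_def\<close>)
      ultimately have "up X x' p" unfolding up_def by blast
      moreover have "up X x' x'" by (auto simp: up_def dest: suffix_length_le)
      ultimately show ?thesis by blast
    qed
  qed
qed

text \<open>The meeting point of \<open>p\<close> and \<open>x\<close> must lie strictly above
  \<open>y\<close>, so the ascent from \<open>p\<close> passes through \<open>y\<close>.\<close>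

lemma conn_exit:
  assumes lX: "labels X \<subseteq> edges G" and c: "(p, x) \<in> conn X" and y: "suffix y p" "\<not> suffix y x"
  shows "up X y p \<and> (p, y) \<in> conn X"
proof -
  obtain m where m: "up X m p" "up X m x" using conn_meet[OF lX c] by blast
  have "length m < length y"
  proof (rule ccontr)
    assume "\<not> length m < length y"
    hence "suffix y m" using suffix_length_suffix[OF y(1)] m(1) by (simp add: up_def)
    hence "suffix y x" by (rule suffix_trans) (use m(2) in \<open>simp add: up_def\<close>)
    thus False using y(2) by blast
  qed
  hence "up X y p" using m(1) y(1) by (auto simp: up_def)
  moreover from this have "(p, y) \<in> conn X" by (rule up_conn) (use y(1) in auto)
  ultimately show ?thesis by blast
qed

section \<open>Levels, and how a join splits a full subtree\<close>

definition level :: "bool list \<Rightarrow> nat \<Rightarrow> bool list set" where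
  "level u n = {y. suffix u y \<and> length y = length u + n}"

lemma level_eq: "level u n = (\<lambda>zs. zs @ u) ` {zs. length zs = n}"
  by (auto simp: level_def suffix_def)

lemma card_level: "card (level u n) = 2 ^ n"
proof -
  have "card (level u n) = card {zs :: bool list. length zs = n}"
    unfolding level_eq by (rule card_image) (auto simp: inj_on_def)
  also have "\<dots> = 2 ^ n" using card_lists_length_eq[of "UNIV :: bool set" n] by simp
  finally show ?thesis .
qed

lemma finite_level: "finite (level u n)"
  by (rule card_ge_0_finite) (simp add: card_level)

text \<open>Whatever \<open>C\<close> misses of the subtree at \<open>y\<close>, be it
  \<open>y\<close> itself or an edge, must be supplied by \<open>B\<close>.\<close>

lemma full_children_touch:
  assumes sib: "sib P B C" and P: "full P y" and C: "\<not> full C y"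
  shows "touch B y"
proof (cases "y \<in> vts C")
  case False
  hence "y \<in> vts B" using P sib_vts[OF sib] by (auto simp: full_def)
  thus ?thesis by (auto simp: touch_def)
next
  case True
  then obtain p b where p: "suffix y p" "length p < k" "{p, b # p} \<notin> labels C"
    using C by (auto simp: full_def)
  hence "{p, b # p} \<in> labels B" using P sib_labels[OF sib] by (auto simp: full_def)
  thus ?thesis using p(1) unfolding touch_def by blast
qed

lemma leaf_full: "touch X y \<Longrightarrow> labels X \<subseteq> edges G \<Longrightarrow> length y = k \<Longrightarrow> full X y"
proof -
  assume t: "touch X y" and lX: "labels X \<subseteq> edges G" and y: "length y = k"
  then obtain p where p: "p \<in> vts X" "suffix y p" by (auto simp: touch_def)
  hence "p = y" using length_vts[OF lX p(1)] y suffix_length_le[OF p(2)] by (auto simp: suffix_def)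
  hence "y \<in> vts X" using p by simp
  moreover have "\<not> length q < k" if "suffix y q" for q using suffix_length_le[OF that] y by simp
  ultimately show "full X y" by (auto simp: full_def)
qed

text \<open>\<open>d\<close> is the least depth below \<open>u\<close> at which one of the children
  contains a full subtree. It exists because at the leaves of \<open>G\<close> touching and being
  full coincide; above depth \<open>d\<close> both children touch everything by
  \<open>full_children_touch\<close>.\<close>

lemma split_full:
  assumes sib: "sib P B C" and lP: "labels P \<subseteq> edges G" and P: "full P u"
    and B: "\<not> full B u" and C: "\<not> full C u"
  shows "\<exists>d y. d \<ge> 1 \<and> y \<in> level u d \<and> length u + d \<le> k \<and> (full B y \<or> full C y) \<and>
     (\<forall>d'<d. \<forall>y\<in>level u d'. \<not> full B y \<and> \<not> full C y \<and> touch B y \<and> touch C y)"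
proof -
  have lu: "length u \<le> k" using P length_vts[OF lP] by (auto simp: full_def)
  define D where "D d \<longleftrightarrow> (\<exists>y\<in>level u d. full B y \<or> full C y)" for d
  have ex: "D (k - length u)"
  proof -
    let ?y = "replicate (k - length u) True @ u"
    have y: "?y \<in> level u (k - length u)" "length ?y = k" "suffix u ?y"
      using lu by (auto simp: level_def suffix_def)
    hence "?y \<in> vts P" using full_suffix[OF P y(3)] by (auto simp: full_def)
    hence "touch B ?y \<or> touch C ?y" using sib_vts[OF sib] by (auto simp: touch_def)
    hence "full B ?y \<or> full C ?y"
      using leaf_full y(2) lP sib_labels[OF sib] by auto
    thus ?thesis using y(1) unfolding D_def by blast
  qed
  let ?d = "LEAST d. D d"
  have D: "D ?d" by (rule LeastI[of D, OF ex])
  have le: "?d \<le> k - length u" by (rule Least_le[of D, OF ex])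
  have less: "\<not> full B y \<and> \<not> full C y" if "d' < ?d" "y \<in> level u d'" for d' y
    using not_less_Least[OF that(1)] that(2) unfolding D_def by blast
  have t: "touch B y \<and> touch C y" if y: "d' < ?d" "y \<in> level u d'" for d' y
  proof -
    have "full P y" using full_suffix[OF P, of y] y le lu by (auto simp: level_def)
    thus ?thesis
      using full_children_touch[OF sib] full_children_touch[OF sib_commute[OF sib]] less[OF y] by blast
  qed
  obtain y where "y \<in> level u ?d" "full B y \<or> full C y" using D unfolding D_def by blast
  moreover have "?d \<ge> 1"
  proof (rule ccontr)
    assume "\<not> ?d \<ge> 1"
    hence "?d = 0" by simp
    hence "D 0" using D by simp
    thus False using B C by (auto simp: D_def level_def suffix_def)
  qed
  ultimately show ?thesis using less t le lu by (intro exI[of _ ?d] exI[of _ y]) auto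
qed

end

section \<open>Subtrees of a join-tree and routes through them\<close>

lemma subt_refl [simp]: "X \<in> subt X"
  by (cases X) auto

lemma subt_trans: "X \<in> subt Y \<Longrightarrow> Y \<in> subt Z \<Longrightarrow> X \<in> subt Z"
  by (induction Z) auto

lemma size_subt: "X \<in> subt Z \<Longrightarrow> X = Z \<or> size X < size Z"
  by (induction Z) auto

lemma sib_subt: "sib P B C \<Longrightarrow> B \<in> subt P" "sib P B C \<Longrightarrow> C \<in> subt P"
  by (auto simp: sib_def)

lemma sib_size: "sib P B C \<Longrightarrow> size B < size P" "sib P B C \<Longrightarrow> size C < size P"
  by (auto simp: sib_def)

text \<open>The route from \<open>X\<close> up to a join-tree above it. \<open>Q\<close> is imposed
  on the nodes above \<open>X\<close> but not on \<open>X\<close>, since later \<open>X\<close> is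
  the node where Delta is small.\<close>

inductive path :: "('e join_tree \<Rightarrow> bool) \<Rightarrow> 'e join_tree \<Rightarrow> 'e join_tree \<Rightarrow> bool" for Q X where
  refl: "path Q X X"
| step: "path Q X P \<Longrightarrow> sib P' P C \<Longrightarrow> Q P' \<Longrightarrow> path Q X P'"

lemma path_trans: "path Q Y Z \<Longrightarrow> path Q X Y \<Longrightarrow> path Q X Z"
  by (induction rule: path.induct) (auto intro: path.intros)

lemma subt_path:
  "X \<in> subt Z \<Longrightarrow> (\<And>P. P \<in> subt Z \<Longrightarrow> X \<in> subt P \<Longrightarrow> P \<noteq> X \<Longrightarrow> Q P) \<Longrightarrow> path Q X Z"
proof (induction Z)
  case (Atomic l)
  thus ?case by (simp add: path.refl)
next
  case (Join B C)
  show ?case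
  proof (cases "X = Join B C")
    case False
    hence "X \<in> subt B \<or> X \<in> subt C" using Join.prems(1) by simp
    hence "path Q X B \<or> path Q X C" using Join by auto
    moreover have "Q (Join B C)" using Join.prems False by simp
    moreover have "sib (Join B C) B C" "sib (Join B C) C B" by (auto simp: sib_def)
    ultimately show ?thesis using path.step by metis
  qed (simp add: path.refl)
qed

lemma path_chain:
  assumes "path Q X Z"
  shows "\<exists>(m::nat) P C. P 0 = X \<and> P m = Z \<and> (\<forall>i<m. sib (P (Suc i)) (P i) (C i) \<and> Q (P (Suc i)))"
  using assms
proof (induction rule: path.induct)
  case refl
  show ?case by (rule exI[of _ 0]) auto
next
  case (step Z Z' C')
  then obtain m P C where *: "P 0 = X" "P m = Z" "\<forall>i<m. sib (P (Suc i)) (P i) (C i) \<and> Q (P (Suc i))"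
    by blast
  let ?P = "P(Suc m := Z')" and ?C = "C(m := C')"
  have "?P 0 = X \<and> ?P (Suc m) = Z' \<and> (\<forall>i<Suc m. sib (?P (Suc i)) (?P i) (?C i) \<and> Q (?P (Suc i)))"
    using * step.hyps by (auto simp: less_Suc_eq)
  thus ?case by blast
qed

context binary_tree
begin

text \<open>The square of 1/1000: one level is worth 1/1000 of \<open>q\<close>, and
  \<open>q\<close> is worth 1/1000 of the exponent. This makes the two bounds compared in
  \<open>tight\<close> equal.\<close>

definition c0 :: real where "c0 = 1 / 10 ^ 6"

text \<open>
  \<open>\<Delta>\<close> may drop when passing to a subtree, so \<open>claim\<close> only credits an amount \<open>q\<close> that is present in all
  subtrees with a full subtree at relative depth less than \<open>1000 * q\<close>. Descending by \<open>e\<close> levels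
  costs \<open>e / 1000\<close> in \<open>q\<close>, that is \<open>c0 * e\<close> in the exponent.
\<close>

definition persistent :: "bool list set join_tree \<Rightarrow> bool list set \<Rightarrow> bool list \<Rightarrow> real \<Rightarrow> bool" where
  "persistent A S v q \<longleftrightarrow> labels A \<subseteq> edges G \<and> labels A \<noteq> edges G \<and> S \<subseteq> verts G \<and> full A v \<and> safe A S v \<and>
     q \<ge> 1 / 3 \<and>
     (\<forall>X\<in>subt A. \<forall>w. suffix v w \<longrightarrow> real (length w) < real (length v) + 1000 * q \<longrightarrow> full X w \<longrightarrow> q \<le> dl X S)"

definition claim :: "bool list set join_tree \<Rightarrow> bool list set \<Rightarrow> bool list \<Rightarrow> real \<Rightarrow> bool" where
  "claim A S v q \<longleftrightarrow> lb A S (c0 * (real k - real (length v)) + q / 1000)"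

lemma full_root: "full X [] \<Longrightarrow> labels X \<subseteq> edges G \<Longrightarrow> labels X = edges G"
  unfolding full_def by (auto simp: edge_iff)

text \<open>A component that survives the removal of \<open>S\<close> has some missing edge as long
  as \<open>X\<close> is not the whole tree, and one missing edge is worth 1/3.\<close>

lemma dl_ge_third:
  assumes lX: "labels X \<subseteq> edges G" "labels X \<noteq> edges G" and s: "safe X S x"
  shows "1 / 3 \<le> dl X S"
proof -
  have "x \<in> vts X" using s by (simp add: safe_def)
  moreover have "\<not> full X []" using full_root lX by blast
  ultimately obtain y e where y: "(x, y) \<in> conn X" "e \<in> edges G" "e \<notin> labels X" "y \<in> e"
    using boundary_in_subtree[OF lX(1), of x "[]"] by auto
  have "real (card {(y, e)}) \<le> 3 * dl X S"
    by (rule card_boundary_le[OF lX(1)]) (use y safe_conn[OF s y(1)] in auto)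
  thus ?thesis by simp
qed

lemma nonatomic:
  assumes "full X y" "length y < k"
  shows "\<exists>B C. sib X B C"
proof (cases X)
  case (Atomic l)
  have "{y, True # y} \<in> set_option l" "{y, False # y} \<in> set_option l"
    using assms Atomic by (auto simp: full_def)
  hence "{y, True # y} = {y, False # y}" by (cases l) auto
  thus ?thesis by (auto simp: doubleton_eq_iff)
next
  case (Join B C)
  thus ?thesis by (auto simp: sib_def)
qed

lemma level_suffix: "y \<in> level u d \<Longrightarrow> suffix u y" and level_length: "y \<in> level u d \<Longrightarrow> length y = length u + d"
  by (simp_all add: level_def)

end

section \<open>A minimal counterexample\<close>

locale counterexample = binary_tree +
  fixes A :: "bool list set join_tree" and S :: "bool list set" and v :: "bool list" and q :: real
  assumes persistentA: "persistent A S v q" and not_claim: "\<not> claim A S v q"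
    and IH: "\<And>D S' v' q'. size D < size A \<Longrightarrow> persistent D S' v' q' \<Longrightarrow> claim D S' v' q'"
begin

abbreviation dp :: "bool list \<Rightarrow> real" where
  "dp u \<equiv> real (length u) - real (length v)"

definition H :: real where "H = real k - real (length v)"

lemma lA: "labels A \<subseteq> edges G" "labels A \<noteq> edges G" and SG: "S \<subseteq> verts G" and fullA: "full A v"
  and safeA: "safe A S v" and q3: "q \<ge> 1 / 3"
  and dl_ge_q: "X \<in> subt A \<Longrightarrow> suffix v w \<Longrightarrow> dp w < 1000 * q \<Longrightarrow> full X w \<Longrightarrow> q \<le> dl X S"
  using persistentA unfolding persistent_def by (auto simp: algebra_simps)

lemma lsub: "X \<in> subt A \<Longrightarrow> labels X \<subseteq> edges G" "X \<in> subt A \<Longrightarrow> labels X \<noteq> edges G"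
  using labels_subt[of X A] lA by blast+

lemma dp_nonneg: "suffix v u \<Longrightarrow> 0 \<le> dp u"
  using suffix_length_le[of v u] by simp

text \<open>Any bound for a subtree lifts to \<open>A\<close> by \<open>LB_subt\<close>, so in a
  counterexample every bound obtained falls short of the target. All contradictions below arise in
  this way.\<close>

lemma lb_less:
  assumes "X \<in> subt A" "lb X S t"
  shows "t < c0 * H + q / 1000"
proof (rule ccontr)
  assume "\<not> t < c0 * H + q / 1000"
  hence "lb A S (c0 * H + q / 1000)"
    using LB_mono[OF LB_subt[OF assms(1) lA(1) assms(2)]] by simp
  thus False using not_claim unfolding claim_def H_def by simp
qed

lemma safe_in:
  assumes X: "X \<in> subt A" and x: "x \<in> vts X" "suffix v x"
  shows "safe X S x"
proof -
  have "(v, x) \<in> conn A" by (rule full_conn[OF fullA x(2) length_vts[OF lsub(1)[OF X] x(1)]])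
  from safe_subtree[OF safe_conn[OF safeA this] labels_subt[OF X] x(1)] show ?thesis .
qed

lemma touch_safe: "X \<in> subt A \<Longrightarrow> suffix v y \<Longrightarrow> touch X y \<Longrightarrow> \<exists>p. suffix y p \<and> safe X S p"
  unfolding touch_def using safe_in suffix_trans[of v y] by blast

lemma dl_less: "X \<in> subt A \<Longrightarrow> dl X S < c0 * H + q / 1000"
  by (rule lb_less[OF _ LB_Delta[OF lsub(1) SG]])

text \<open>Otherwise \<open>LB_Delta\<close> would already prove the claim, since persistence gives
  \<open>q \<le> dl A S\<close>.\<close>

lemma H_large: "H > 900000 * q"
proof -
  have "q \<le> dl A S" by (rule dl_ge_q[of A v]) (use fullA q3 in auto)
  also have "\<dots> < c0 * H + q / 1000" by (rule dl_less) simp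
  finally have "999 / 1000 * q < H / 1000000" by (simp add: c0_def)
  thus ?thesis using q3 by linarith
qed

lemma target_less: "c0 * H + q / 1000 < H / 900000"
  using H_large q3 by (simp add: c0_def)

text \<open>The induction hypothesis with the credit 1/3, which \<open>dl_ge_third\<close> provides
  for any conditioning set that leaves \<open>w\<close> safe.\<close>

lemma IH0:
  assumes D: "D \<in> subt A" "D \<noteq> A" and S': "S' \<subseteq> verts G" and w: "full D w" "safe D S' w"
  shows "lb D S' (c0 * (real k - real (length w)))"
proof -
  have "persistent D S' w (1 / 3)"
    unfolding persistent_def
  proof (intro conjI ballI allI impI)
    fix X w' assume X: "X \<in> subt D" and s: "suffix w w'" and f: "full X w'"
    have XA: "X \<in> subt A" using subt_trans[OF X D(1)] .
    have x: "w' \<in> vts X" using f by (simp add: full_def)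
    have "(w, w') \<in> conn D" by (rule full_conn[OF w(1) s length_vts[OF lsub(1)[OF XA] x]])
    from safe_subtree[OF safe_conn[OF w(2) this] labels_subt[OF X] x]
    show "1 / 3 \<le> dl X S'" by (rule dl_ge_third[OF lsub[OF XA]])
  qed (use lsub[OF D(1)] S' w in simp_all)
  moreover have "size D < size A" using size_subt[OF D(1)] D(2) by blast
  ultimately have "claim D S' w (1 / 3)" using IH by blast
  thus ?thesis unfolding claim_def by (rule LB_mono) simp
qed

text \<open>Otherwise \<open>D\<close> would be persistent at \<open>u\<close> with credit
  \<open>q + dp u / 1000\<close>, and the induction hypothesis for it gives exactly the target
  exponent. The bound on \<open>dp w\<close> is the depth range of that persistence.\<close>

lemma tight:
  assumes D: "D \<in> subt A" "D \<noteq> A" and u: "full D u" "suffix v u"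
  shows "\<exists>X\<in>subt D. \<exists>w. suffix u w \<and> full X w \<and> dl X S < q + dp u / 1000 \<and> dp w < 2 * dp u + 1000 * q"
proof (rule ccontr)
  assume no: "\<not> ?thesis"
  let ?q = "q + dp u / 1000"
  have uD: "u \<in> vts D" using u(1) by (simp add: full_def)
  have "persistent D S u ?q"
    unfolding persistent_def
  proof (intro conjI ballI allI impI)
    have "0 \<le> dp u / 1000" using dp_nonneg[OF u(2)] by simp
    thus "1 / 3 \<le> ?q" using q3 by linarith
    fix X w assume X: "X \<in> subt D" and s: "suffix u w" and f: "full X w"
      and l: "real (length w) < real (length u) + 1000 * ?q"
    have "dp w < 2 * dp u + 1000 * q" using l by argo
    thus "?q \<le> dl X S" using no X s f by (meson not_le)
  qed (use lsub[OF D(1)] SG u safe_in[OF D(1) uD u(2)] in simp_all)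
  moreover have "size D < size A" using size_subt[OF D(1)] D(2) by blast
  ultimately have "claim D S u ?q" using IH by blast
  moreover have "c0 * (real k - real (length u)) + ?q / 1000 = c0 * H + q / 1000"
    by (simp add: c0_def H_def field_simps)
  ultimately show False using lb_less[OF D(1)] unfolding claim_def by fastforce
qed

text \<open>
  A join that splits a full subtree has children whose largest full subtrees may be much smaller. If
  they are smaller by more than the allowance \<open>1000 * q + dp u\<close>, the child is \<open>scattered\<close>: it meets
  very many subtrees at moderate depth without containing any of them.
\<close>

definition scattered :: "bool list set join_tree \<Rightarrow> bool list \<Rightarrow> nat \<Rightarrow> bool" where
  "scattered Z u f \<longleftrightarrow> Z \<in> subt A \<and> Z \<noteq> A \<and> suffix v u \<and> real f \<ge> 1000 * q + dp u \<and>
     (\<exists>y\<in>level u f. full Z y) \<and> (\<forall>d<f. \<forall>y\<in>level u d. touch Z y \<and> \<not> full Z y)"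

text \<open>Scattered subtrees are finally excluded by considering a smallest one, which is tame.
  The arguments leading there may therefore assume only that no proper subtree is scattered.\<close>

definition tame :: "bool list set join_tree \<Rightarrow> bool" where
  "tame Z \<longleftrightarrow> (\<forall>Z'\<in>subt Z. Z' \<noteq> Z \<longrightarrow> (\<forall>u f. \<not> scattered Z' u f))"

section \<open>Finding full subtrees detached from the rest of the tree\<close>

lemma tame_subt:
  assumes "tame Z" "X \<in> subt Z" 
  shows "tame X"
  unfolding tame_def
proof (intro ballI impI)
  fix Z' assume Z': "Z' \<in> subt X" "Z' \<noteq> X"
  hence "size Z' < size X" using size_subt by blast
  hence "size Z' < size Z" using size_subt[OF assms(2)] by auto
  hence "Z' \<noteq> Z" by auto
  thus "\<forall>u f. \<not> scattered Z' u f" using assms(1) subt_trans[OF Z'(1) assms(2)] unfolding tame_def by blast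
qed

text \<open>\<open>P\<close> is a smallest subtree still full at some node less than
  \<open>r\<close> levels below \<open>u\<close>, so its children are full at none of these. By
  \<open>split_full\<close> one child \<open>D\<close> is full at some \<open>y\<close> further
  down, and as \<open>D\<close> is not scattered, \<open>y\<close> is not much deeper.\<close>

lemma descend:
  assumes Z: "Z \<in> subt A" "tame Z" and u: "full Z u" "suffix v u" and r: "r > 0" "length u + r \<le> k"
  shows "\<exists>P\<in>subt Z. \<exists>D C u' d y. sib P D C \<and> full P u' \<and> suffix u u' \<and> length u' < length u + r \<and>
     y \<in> level u' d \<and> full D y \<and> real d < 1000 * q + dp u' \<and>
     (\<forall>y. suffix u y \<longrightarrow> length y < length u + r \<longrightarrow> \<not> full D y)"
proof -
  let ?M = "\<lambda>P. P \<in> subt Z \<and> (\<exists>y. suffix u y \<and> length y < length u + r \<and> full P y)"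
  have "?M Z" using u r by (auto intro!: exI[of _ u])
  then obtain P where P: "?M P" and Pmin: "\<And>P'. ?M P' \<Longrightarrow> size P \<le> size P'"
    using ex_has_least_nat[of ?M Z size] by blast
  then obtain u' where u': "suffix u u'" "length u' < length u + r" "full P u'" by blast
  have PA: "P \<in> subt A" using subt_trans P Z(1) by blast
  obtain B C where sib: "sib P B C" using nonatomic[OF u'(3)] u'(2) r(2) by auto
  have nf: "\<not> full D y" if "sib P D D'" "suffix u y" "length y < length u + r" for D D' y
  proof
    assume "full D y"
    hence "?M D" using that subt_trans[OF sib_subt(1)[OF that(1)]] P by blast
    thus False using Pmin sib_size(1)[OF that(1)] by fastforce
  qed
  note sib' = sib_commute[OF sib]
  obtain d y where d: "d \<ge> 1" "y \<in> level u' d" "full B y \<or> full C y"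
    and less: "\<forall>d'<d. \<forall>y\<in>level u' d'. \<not> full B y \<and> \<not> full C y \<and> touch B y \<and> touch C y"
    using split_full[OF sib lsub(1)[OF PA] u'(3) nf[OF sib u'(1,2)] nf[OF sib' u'(1,2)]] by blast
  obtain D D' where D: "sib P D D'" "full D y"
     "\<forall>d'<d. \<forall>y\<in>level u' d'. touch D y \<and> \<not> full D y"
    using d(3) sib sib' less by blast
  have "\<not> scattered D u' d"
  proof -
    have "D \<in> subt Z" using subt_trans[OF sib_subt(1)[OF D(1)]] P by blast
    moreover have "D \<noteq> Z" using sib_size(1)[OF D(1)] size_subt[of P Z] P by auto
    ultimately show ?thesis using Z(2) unfolding tame_def by blast
  qed
  moreover have "D \<in> subt A" using subt_trans[OF sib_subt(1)[OF D(1)] PA] .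
  moreover have "D \<noteq> A" using sib_size(1)[OF D(1)] size_subt[OF PA] by auto
  ultimately have "real d < 1000 * q + dp u'"
    using d(2) D suffix_trans[OF u(2) u'(1)] unfolding scattered_def by (meson not_le)
  thus ?thesis using P D u' d(2) nf[OF D(1)] by blast
qed

text \<open>\<open>descend\<close> followed by \<open>tight\<close> gives \<open>X\<close> with
  small Delta that is full only at least \<open>W\<close> levels below \<open>u\<close>;
  \<open>w\<close> is a shallowest such node. If its component left the subtree at \<open>u\<close>,
  it would contain the long path from \<open>w\<close> up to \<open>u\<close>, whose side branches
  are not full, and \<open>path_boundary\<close> would make Delta large.\<close>

lemma detached:
  assumes Z: "Z \<in> subt A" "Z \<noteq> A" "tame Z" and u: "full Z u" "suffix v u"
    and W: "1000 * q \<le> W" "W \<ge> 333" "dp u \<le> c * W" "0 \<le> c" "c \<le> 100" and room: "dp u + W + 2 \<le> H"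
  shows "\<exists>X\<in>subt Z. \<exists>w. suffix u w \<and> full X w \<and> (\<forall>p. (w, p) \<in> conn X \<longrightarrow> suffix u p) \<and>
     dl X S < q + (2 * c + 4) * W / 1000 \<and> dp w \<le> (4 * c + 9) * W \<and>
     (\<forall>y. suffix u y \<longrightarrow> real (length y) < real (length u) + W \<longrightarrow> \<not> full X y)"
proof -
  define r where "r = nat \<lceil>W\<rceil>"
  have r: "W \<le> real r" "real r < W + 1" using W(2) unfolding r_def by linarith+
  have r0: "r > 0" using r(1) W(2) by linarith
  have rk: "length u + r \<le> k" using room r(2) unfolding H_def by linarith
  obtain P D C u' d y where P: "P \<in> subt Z" "sib P D C" "suffix u u'" "length u' < length u + r"
      "y \<in> level u' d" "full D y" "real d < 1000 * q + dp u'"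
    and nD: "\<And>y. suffix u y \<Longrightarrow> length y < length u + r \<Longrightarrow> \<not> full D y"
    using descend[OF Z(1,3) u r0 rk] by blast
  have DZ: "D \<in> subt Z" by (rule subt_trans[OF sib_subt(1)[OF P(2)] P(1)])
  have DA: "D \<in> subt A" by (rule subt_trans[OF DZ Z(1)])
  have DnA: "D \<noteq> A" using size_subt[OF Z(1)] size_subt[OF P(1)] sib_size(1)[OF P(2)] by auto
  have uy: "suffix u y" using suffix_trans[OF P(3) level_suffix[OF P(5)]] .
  have vy: "suffix v y" by (rule suffix_trans[OF u(2) uy])
  obtain X w0 where X: "X \<in> subt D" "suffix y w0" "full X w0" "dl X S < q + dp y / 1000"
      "dp w0 < 2 * dp y + 1000 * q"
    using tight[OF DA DnA P(6) vy] by blast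
  \<comment> \<open>The depth of \<open>u'\<close> is at most \<open>c * W + W + 1\<close>, and
    \<open>d\<close> adds at most this once more plus \<open>1000 * q \<le> W\<close>.\<close>
  have dy: "dp y \<le> (2 * c + 3) * W + 2"
  proof -
    have "dp y = dp u' + real d" using level_length[OF P(5)] by simp
    moreover have "dp u' \<le> dp u + real r" using P(4) by linarith
    ultimately have "dp y \<le> 2 * (x + (W + 1)) + W" if "x = c * W" for x
      using P(7) W(1,3) r(2) unfolding that[symmetric] by argo
    from this[OF HOL.refl] have "dp y \<le> 2 * (c * W + (W + 1)) + W" .
    thus ?thesis by (simp add: algebra_simps)
  qed
  have cW: "c * W \<ge> 0" "c * W \<le> 100 * W" using W(2,4,5) by (auto intro: mult_right_mono)
  have dX: "dl X S < q + (2 * c + 4) * W / 1000"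
  proof -
    have "dp y \<le> (2 * c + 4) * W" using dy W(2) by (simp add: algebra_simps)
    hence "dp y / 1000 \<le> (2 * c + 4) * W / 1000" by (rule divide_right_mono) simp
    thus ?thesis using X(4) by linarith
  qed
  have nX: "\<not> full X y'" if "suffix u y'" "length y' < length u + r" for y'
    using nD[OF that] full_mono[OF labels_subt[OF X(1)]] by blast
  have XA: "X \<in> subt A" by (rule subt_trans[OF X(1) DA])
  let ?M = "\<lambda>w. suffix u w \<and> full X w"
  have M0: "?M w0" using suffix_trans[OF uy X(2)] X(3) by simp
  obtain w where w: "?M w" "\<And>w'. ?M w' \<Longrightarrow> length w \<le> length w'"
    using ex_has_least_nat[of ?M w0 length] M0 by blast
  have uw: "suffix u w" and fw: "full X w" using w(1) by auto
  have lw: "length u + r \<le> length w" using nX[OF uw] fw by (meson not_le)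
  have "dp w \<le> dp w0" using w(2)[OF M0] by simp
  moreover have "2 * dp y + 1000 * q \<le> (4 * c + 9) * W" using dy W(1,2) by (simp add: algebra_simps)
  ultimately have dw: "dp w \<le> (4 * c + 9) * W" using X(5) by linarith
  have wX: "w \<in> vts X" using fw by (simp add: full_def)
  have sw: "safe X S w" by (rule safe_in[OF XA wX suffix_trans[OF u(2) uw]])
  have comp: "suffix u p" if p: "(w, p) \<in> conn X" for p
  proof (rule ccontr)
    assume np: "\<not> suffix u p"
    have up: "up X u w" using conn_exit[OF lsub(1)[OF XA] p uw np] by blast
    have wne: "w \<noteq> []" using lw r0 by auto
    \<comment> \<open>The path is started at the parent \<open>w'\<close> of \<open>w\<close>: its
      side branches are strictly shallower than \<open>w\<close> and thus not full, whereas the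
      sibling of \<open>w\<close> might be. This costs one unit of length.\<close>
    then obtain b w' where wb: "w = b # w'" by (cases w) auto
    have uw': "suffix u w'" using uw lw r0 unfolding wb by (auto simp: suffix_Cons)
    have up': "up X u w'" using up uw' unfolding up_def wb by (auto intro: suffix_ConsI)
    have sw': "safe X S w'"
      by (rule safe_conn[OF sw up_conn[OF up uw']]) (simp add: wb suffix_Cons)
    have side: "\<not> full X ((\<not> b') # z)" if z: "suffix u z" "suffix (b' # z) w'" for z b'
    proof
      assume f: "full X ((\<not> b') # z)"
      have "length w \<le> length ((\<not> b') # z)" by (rule w(2)) (use f z(1) in \<open>simp add: suffix_ConsI\<close>)
      thus False using suffix_length_le[OF z(2)] unfolding wb by simp
    qed
    have "real (length w' - length u) \<le> 3 * dl X S"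
      by (rule path_boundary[OF lsub(1)[OF XA] up' sw' side])
    moreover have "real r - 1 \<le> real (length w' - length u)" using lw r0 unfolding wb by simp
    ultimately have "W - 1 \<le> 3 * dl X S" using r(1) by linarith
    moreover have "dp y \<le> 203 * W + 2" using dy cW by (simp add: algebra_simps)
    ultimately show False using X(4) W(1,2) by argo
  qed
  have nX': "\<not> full X y'" if "suffix u y'" "real (length y') < real (length u) + W" for y'
    by (rule nX[OF that(1)]) (use that(2) r(1) in linarith)
  have "X \<in> subt Z" by (rule subt_trans[OF X(1) DZ])
  thus ?thesis using uw fw comp dX dw nX' by blast
qed

text \<open>The component of \<open>w\<close> stays below \<open>u\<close>, where \<open>C\<close>
  has no vertex, so conditioning on \<open>C\<close> leaves \<open>w\<close> safe and
  \<open>IH0\<close> applies.\<close>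

lemma lb_detached:
  assumes X: "X \<in> subt A" "X \<noteq> A" and w: "full X w" "suffix v w"
    and comp: "\<And>p. (w, p) \<in> conn X \<Longrightarrow> suffix u p" and vu: "suffix v u" and C: "C \<in> subt A" "\<not> touch C u"
  shows "lb X (S \<union> vts C) (c0 * (H - dp w))"
proof -
  have wX: "w \<in> vts X" using w(1) by (simp add: full_def)
  have sw: "safe X S w" by (rule safe_in[OF X(1) wX w(2)])
  have "safe X (S \<union> vts C) w"
    unfolding safe_def
  proof (intro conjI allI impI)
    fix p assume p: "(w, p) \<in> conn X"
    have "p \<notin> S" using sw p by (simp add: safe_def)
    moreover have "p \<notin> vts C" using comp[OF p] C(2) by (auto simp: touch_def)
    ultimately show "p \<notin> S \<union> vts C" by simp
  qed (rule wX)
  moreover have "S \<union> vts C \<subseteq> verts G" using SG vts_subset[OF lsub(1)[OF C(1)]] by simp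
  moreover have "H - dp w = real k - real (length w)" by (simp add: H_def)
  ultimately show ?thesis using IH0[OF X, of "S \<union> vts C" w] w(1) by (simp only:)
qed

end

section \<open>Siblings along a route down to a subtree of small Delta\<close>

locale chain = counterexample +
  fixes m :: nat and P C :: "nat \<Rightarrow> bool list set join_tree" and w1 :: "bool list" and W :: real
  assumes top: "P m \<in> subt A" and tame_top: "tame (P m)" and bottom: "P 0 \<noteq> A"
    and sibs: "i < m \<Longrightarrow> sib (P (Suc i)) (P i) (C i)"
    and high: "i < m \<Longrightarrow> W / 3000 \<le> dl (P (Suc i)) S"
    and w1: "full (P 0) w1" "suffix v w1" "dp w1 \<le> 3 * W"
    and low: "dl (P 0) S < W / 1000"
    and W: "333 \<le> W" "1000 * q \<le> W" "12 * W + 10 \<le> H"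
begin

lemma P_mono: "i \<le> j \<Longrightarrow> j \<le> m \<Longrightarrow> P i \<in> subt (P j)"
proof (induction j)
  case (Suc j)
  show ?case
  proof (cases "i = Suc j")
    case False
    hence "P i \<in> subt (P j)" using Suc by simp
    moreover have "P j \<in> subt (P (Suc j))" using sib_subt(1)[OF sibs] Suc.prems by simp
    ultimately show ?thesis by (rule subt_trans)
  qed simp
qed simp

lemma P_subt: "i \<le> m \<Longrightarrow> P i \<in> subt A"
  using P_mono[of i m] subt_trans top by blast

lemma C_top: "i < m \<Longrightarrow> C i \<in> subt (P m)"
  using sib_subt(2)[OF sibs] P_mono[of "Suc i" m] subt_trans by (metis Suc_leI order_refl)

lemma C_subt: "i < m \<Longrightarrow> C i \<in> subt A"
  using C_top subt_trans top by blast

lemma C_less_top: "i < m \<Longrightarrow> size (C i) < size (P m)"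
  using sib_size(2)[OF sibs] size_subt[OF P_mono[of "Suc i" m]] by fastforce

lemma C_neq: "i < m \<Longrightarrow> C i \<noteq> A" "i < m \<Longrightarrow> C i \<noteq> P m"
  using C_less_top size_subt[OF top] by fastforce+

lemma tame_C: "i < m \<Longrightarrow> tame (C i)"
  using tame_subt[OF tame_top C_top] .

lemma tame_P: "i \<le> m \<Longrightarrow> tame (P i)"
  using tame_subt[OF tame_top P_mono] by simp

lemma not_scattered: "i < m \<Longrightarrow> \<not> scattered (C i) u f"
  using tame_top C_top C_neq(2) unfolding tame_def by blast

lemma touched_level:
  assumes X: "X \<in> subt A" and u: "suffix v u" and d: "3 * dl X S < 2 ^ d"
  shows "\<exists>y\<in>level u d. \<not> touch X y \<or> full X y"
proof (rule ccontr)
  assume no: "\<not> ?thesis"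
  have "real (card (level u d)) \<le> 3 * dl X S"
  proof (rule card_touched_le[OF lsub(1)[OF X] finite_level level_length])
    fix y assume y: "y \<in> level u d"
    show "\<exists>p. suffix y p \<and> safe X S p"
      using touch_safe[OF X suffix_trans[OF u level_suffix[OF y]]] no y by blast
    show "\<not> full X y" using no y by blast
  qed
  thus False using d by (simp add: card_level)
qed

lemma less_power: "x \<le> real d \<Longrightarrow> x < 2 ^ d"
  using of_nat_less_two_power[of d, where 'a = real] by linarith

lemma lb_bottom: "lb (P 0) S (c0 * (H - dp w1))"
proof -
  have "w1 \<in> vts (P 0)" using w1(1) by (simp add: full_def)
  hence "safe (P 0) S w1" using safe_in[OF P_subt[of 0] _ w1(2)] by simp
  thus ?thesis using IH0[OF P_subt[of 0] bottom SG w1(1)] by (simp add: H_def)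
qed

text \<open>
  A sibling containing a large full subtree: below the two children there are nodes, both with a large
  full subtree, that do not touch each other, and averaging gains half of \<open>dl (P (Suc i)) S\<close>.
\<close>

lemma no_large_full:
  assumes i: "i < m" and u: "suffix v u" "dp u \<le> 7 * W"
  shows "\<not> full (C i) u"
proof
  assume fu: "full (C i) u"
  define r where "r = nat \<lceil>W\<rceil>"
  have r: "W \<le> real r" "real r < W + 1" using W(1) unfolding r_def by linarith+
  have P0: "P 0 \<in> subt A" using P_subt by simp
  obtain y where y: "y \<in> level u r" "\<not> touch (P 0) y \<or> full (P 0) y"
    using touched_level[OF P0 u(1), of r] less_power[OF r(1)] low W(1) by fastforce
  have vy: "suffix v y" by (rule suffix_trans[OF u(1) level_suffix[OF y(1)]])
  have dy: "dp y \<le> 9 * W" using level_length[OF y(1)] u(2) r(2) W(1) by simp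
  have "\<exists>D\<in>subt (P 0). \<exists>w y2. full D w \<and> suffix v w \<and> dp w \<le> 45 * W \<and> suffix u y2 \<and> dp y2 \<le> 10 * W \<and> \<not> touch D y2"
    using y(2)
  proof
    assume "\<not> touch (P 0) y"
    moreover have "dp w1 \<le> 45 * W" "dp y \<le> 10 * W" using w1(3) dy W(1) by linarith+
    ultimately show ?thesis
      using w1 level_suffix[OF y(1)] by (intro bexI[of _ "P 0"] exI[of _ w1] exI[of _ y]) auto
  next
    \<comment> \<open>Here \<open>P 0\<close> is replaced by a smaller \<open>X\<close> which is not
      full within \<open>W\<close> levels below \<open>y\<close>; being of small Delta, it leaves
      some \<open>y2\<close> there untouched.\<close>
    assume fy: "full (P 0) y"
    obtain X w where X: "X \<in> subt (P 0)" "suffix y w" "full X w" "dl X S < q + (2 * 9 + 4) * W / 1000"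
        "dp w \<le> (4 * 9 + 9) * W"
      and nX: "\<And>y'. suffix y y' \<Longrightarrow> real (length y') < real (length y) + W \<Longrightarrow> \<not> full X y'"
      using detached[OF P0 bottom tame_P[of 0] fy vy W(2,1), of 9] dy W by auto
    have XA: "X \<in> subt A" by (rule subt_trans[OF X(1) P0])
    have r1: "real (r - 1) = real r - 1" using r(1) W(1) by linarith
    have "3 * dl X S < real (r - 1)" using X(4) r(1) W(1,2) unfolding r1 by argo
    then obtain y2 where y2: "y2 \<in> level y (r - 1)" "\<not> touch X y2 \<or> full X y2"
      using touched_level[OF XA vy, of "r - 1"] less_power[of _ "r - 1"] by (meson less_imp_le)
    have "real (length y2) < real (length y) + W" using level_length[OF y2(1)] r1 r(2) by simp
    hence "\<not> touch X y2" using nX[OF level_suffix[OF y2(1)]] y2(2) by blast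
    moreover have "dp y2 \<le> 10 * W" using level_length[OF y2(1)] r1 r(2) dy by simp
    moreover have "suffix u y2" by (rule suffix_trans[OF level_suffix[OF y(1)] level_suffix[OF y2(1)]])
    moreover have "suffix v w" by (rule suffix_trans[OF vy X(2)])
    moreover have "dp w \<le> 45 * W" using X(5) by simp
    ultimately show ?thesis using X(1,3) by blast
  qed
  then obtain D w y2 where D: "D \<in> subt (P 0)" "full D w" "suffix v w" "dp w \<le> 45 * W"
      "suffix u y2" "dp y2 \<le> 10 * W" "\<not> touch D y2" by blast
  have DA: "D \<in> subt A" by (rule subt_trans[OF D(1) P0])
  have DnA: "D \<noteq> A" using size_subt[OF D(1)] size_subt[OF P0] bottom by auto
  have vy2: "suffix v y2" by (rule suffix_trans[OF u(1) D(5)])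
  have "length y2 \<le> k" using D(6) W(1,3) unfolding H_def by linarith
  hence fy2: "full (C i) y2" by (rule full_suffix[OF fu D(5)])
  obtain E wE where E: "E \<in> subt (C i)" "suffix y2 wE" "full E wE" "\<And>p. (wE, p) \<in> conn E \<Longrightarrow> suffix y2 p"
      "dp wE \<le> (4 * 10 + 9) * W"
    using detached[OF C_subt[OF i] C_neq(1)[OF i] tame_C[OF i] fy2 vy2 W(2,1), of 10] D(6) W by auto
  have EA: "E \<in> subt A" by (rule subt_trans[OF E(1) C_subt[OF i]])
  have EnA: "E \<noteq> A" using size_subt[OF E(1)] size_subt[OF C_subt[OF i]] C_neq(1)[OF i] by auto
  have wD: "w \<in> vts D" using D(2) by (simp add: full_def)
  have l1: "lb D S (c0 * (H - dp w))"
    using IH0[OF DA DnA SG D(2) safe_in[OF DA wD D(3)]] by (simp add: H_def)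
  have l2: "lb E (S \<union> vts D) (c0 * (H - dp wE))"
    by (rule lb_detached[OF EA EnA E(3) suffix_trans[OF vy2 E(2)] E(4) vy2 DA D(7)])
  have Pi: "P (Suc i) \<in> subt A" using P_subt i by simp
  have DPi: "D \<in> subt (P i)" using subt_trans[OF D(1) P_mono[of 0 i]] i by simp
  have "lb (P (Suc i)) S ((c0 * (H - dp w) + c0 * (H - dp wE) + dl (P (Suc i)) S) / 2)"
    by (rule LB_average[OF sibs[OF i] lsub(1)[OF Pi] SG DPi E(1) l1 l2])
  from lb_less[OF Pi this]
  have "c0 * (H - dp w) + c0 * (H - dp wE) + dl (P (Suc i)) S < 2 * (c0 * H + q / 1000)" by simp
  \<comment> \<open>The depths cost 45 and 49 times \<open>W\<close>. The total of 94 millionths of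
    \<open>W\<close> stays below the \<open>W / 3000\<close> granted by \<open>high\<close>.\<close>
  moreover have "c0 * (H - dp w) + c0 * (H - dp wE) \<ge> 2 * (c0 * H) - 94 * W / 1000000"
    using D(4) E(5) by (simp add: c0_def) argo
  ultimately have "dl (P (Suc i)) S < 94 * W / 1000000 + 2 * (q / 1000)"
    unfolding distrib_left by linarith
  thus False using W(1,2) high[OF i] by argo
qed

text \<open>The bottom bound misses the target only by the depth \<open>dp w1 \<le> 3 * W\<close>
  and by \<open>q\<close>, together at most 4 millionths of \<open>W\<close>; no gain on top of it
  can reach that.\<close>

lemma no_large_gain:
  assumes X: "X \<in> subt A" and lb: "lb X S (c0 * (H - dp w1) + g)"
  shows "g < 4 * W / 1000000"
proof -
  have "g < c0 * dp w1 + q / 1000" using lb_less[OF X lb] by (simp add: algebra_simps)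
  thus ?thesis using w1(3) W(2) by (simp add: c0_def) argo
qed

text \<open>Chosen above the 26 millionths of \<open>W\<close> that arise in
  \<open>sibling_small\<close> (depth \<open>25 * W\<close> plus the credit \<open>q\<close>), and
  small enough that \<open>9 * \<kappa> < W / 1000\<close>.\<close>

definition \<kappa> :: real where "\<kappa> = 30 * W / 1000000"

text \<open>
  A sibling of large exponent: revealing it first leaves a full subtree that it does not touch,
  unless it is scattered.
\<close>

lemma sibling_small:
  assumes i: "i < m"
  shows "dl (C i) S < \<kappa>"
proof (rule ccontr)
  assume "\<not> dl (C i) S < \<kappa>"
  hence \<Lambda>: "\<kappa> \<le> dl (C i) S" by simp
  have CA: "C i \<in> subt A" by (rule C_subt[OF i])
  have P0: "P 0 \<in> subt A" using P_subt by simp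
  have Pi: "P (Suc i) \<in> subt A" using P_subt i by simp
  let ?Q = "\<lambda>r. \<exists>y\<in>level w1 r. \<not> touch (C i) y \<or> full (C i) y"
  have lw1: "length w1 \<le> k" using w1(1) length_vts[OF lsub(1)[OF P0]] by (simp add: full_def)
  have exQ: "?Q (k - length w1)"
  proof -
    have "replicate (k - length w1) True @ w1 \<in> level w1 (k - length w1)" by (simp add: level_def suffix_def)
    thus ?thesis using leaf_full[OF _ lsub(1)[OF CA]] lw1 level_length by fastforce
  qed
  \<comment> \<open>At the first such level there is either an untouched node, leading to a large
    gain, or a full one, which makes \<open>C i\<close> scattered.\<close>
  define r where "r = (LEAST r. ?Q r)"
  have Qr: "?Q r" unfolding r_def by (rule LeastI[of ?Q, OF exQ])
  have rle: "r \<le> k - length w1" unfolding r_def by (rule Least_le[of ?Q, OF exQ])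
  have less: "touch (C i) y \<and> \<not> full (C i) y" if "d < r" "y \<in> level w1 d" for d y
    using not_less_Least[of d ?Q] that unfolding r_def by blast
  obtain y where y: "y \<in> level w1 r" "\<not> touch (C i) y \<or> full (C i) y" using Qr by blast
  have ly: "length y \<le> k" using level_length[OF y(1)] rle lw1 by simp
  have vy: "suffix v y" by (rule suffix_trans[OF w1(2) level_suffix[OF y(1)]])
  have dy: "dp y = dp w1 + real r" using level_length[OF y(1)] by simp
  show False
    using y(2)
  proof
    assume nt: "\<not> touch (C i) y"
    have fy: "full (P 0) y" by (rule full_suffix[OF w1(1) level_suffix[OF y(1)] ly])
    have gain: "dl (C i) S < c0 * dp w + q / 1000"
      if X: "X \<in> subt (P 0)" "suffix y w" "full X w" "\<And>p. (w, p) \<in> conn X \<Longrightarrow> suffix y p" for X w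
    proof -
      have XA: "X \<in> subt A" by (rule subt_trans[OF X(1) P0])
      have XnA: "X \<noteq> A" using size_subt[OF X(1)] size_subt[OF P0] bottom by auto
      have XPi: "X \<in> subt (P i)" using subt_trans[OF X(1) P_mono[of 0 i]] i by simp
      have "lb X (S \<union> vts (C i)) (c0 * (H - dp w))"
        by (rule lb_detached[OF XA XnA X(3) suffix_trans[OF vy X(2)] X(4) vy CA nt])
      from lb_less[OF Pi LB_before[OF sibs[OF i] lsub(1)[OF Pi] SG XPi this]]
      show ?thesis by (simp add: algebra_simps)
    qed
    show False
    proof (cases "dp y \<le> 4 * W")
      case True
      obtain X w where X: "X \<in> subt (P 0)" "suffix y w" "full X w" "\<And>p. (w, p) \<in> conn X \<Longrightarrow> suffix y p"
          "dp w \<le> (4 * 4 + 9) * W"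
        using detached[OF P0 bottom tame_P[of 0] fy vy W(2,1), of 4] True W by auto
      show False using gain[OF X(1-4)] X(5) \<Lambda> W(1,2) by (simp add: \<kappa>_def c0_def) argo
    next
      case False
      have rW: "W < real r" "dp y < 4 * real r" using False dy w1(3) by linarith+
      have r1: "r \<ge> 1" using rW W(1) by linarith
      have "2 ^ (r - 1) \<le> 3 * dl (C i) S"
        using touched_level[OF CA w1(2), of "r - 1"] less[of "r - 1"] r1 by (meson not_le diff_less zero_less_one less_le_trans)
      moreover have "real (r - 1) < 2 ^ (r - 1)" by (rule less_power) simp
      ultimately have rH: "real r - 1 < 3 * dl (C i) S" using r1 by linarith
      have dlt: "dl (C i) S < H / 900000" using dl_less[OF CA] target_less by linarith
      \<comment> \<open>For a deep \<open>y\<close>, \<open>detached\<close> is applied with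
        \<open>dp y\<close> in place of \<open>W\<close> and \<open>c = 1\<close>. All levels before
        \<open>r\<close> are touched without being filled, so \<open>dl (C i) S\<close> exceeds
        \<open>(r - 1) / 3\<close> and outweighs the cost of the depth.\<close>
      have W': "1000 * q \<le> dp y" "333 \<le> dp y" "dp y \<le> 1 * dp y" using False W by (linarith, linarith, simp)
      have "dp y + dp y + 2 \<le> H" using rW(2) rH dlt W(1,3) by argo
      then obtain X w where X: "X \<in> subt (P 0)" "suffix y w" "full X w" "\<And>p. (w, p) \<in> conn X \<Longrightarrow> suffix y p"
          "dp w \<le> (4 * 1 + 9) * dp y"
        using detached[OF P0 bottom tame_P[of 0] fy vy W'] by auto
      have "dl (C i) S < 13 * dp y / 1000000 + q / 1000"
        using gain[OF X(1-4)] X(5) by (simp add: c0_def) argo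
      thus False using rW rH W'(1) W(1) by argo
    qed
  next
    assume fy: "full (C i) y"
    \<comment> \<open>As \<open>w1\<close> has depth at most \<open>3 * W\<close>, \<open>r\<close>
      exceeds \<open>4 * W\<close> and hence the allowance in \<open>scattered\<close>.\<close>
    have "7 * W < dp y" using no_large_full[OF i vy] fy by fastforce
    hence "1000 * q + dp w1 \<le> real r" using dy w1(3) W(2) by linarith
    hence "scattered (C i) w1 r"
      unfolding scattered_def using CA C_neq(1)[OF i] w1(2) y(1) fy less by blast
    thus False using not_scattered[OF i] by blast
  qed
qed

lemma lb_P: "j \<le> i \<Longrightarrow> i \<le> m \<Longrightarrow> lb (P j) S t \<Longrightarrow> lb (P i) S t"
  by (rule LB_subt[OF P_mono lsub(1)[OF P_subt]])

text \<open>Only \<open>P j\<close>, possibly far below \<open>P i\<close>, has been revealed, so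
  the components of \<open>C i\<close> that meet merely the siblings in between are still
  gained.\<close>

lemma lb_gain:
  assumes "j \<le> i" "i < m" "lb (P j) S t"
  shows "lb (P (Suc i)) S (t + dl (C i) (S \<union> vts (P j)))"
  by (rule LB_after[OF sibs[OF assms(2)] lsub(1)[OF P_subt] SG P_mono assms(3)]) (use assms in simp_all)

lemma vts_P: "j \<le> m \<Longrightarrow> vts (P j) = vts (P 0) \<union> (\<Union>i<j. vts (C i))"
proof (induction j)
  case (Suc j)
  have "vts (P (Suc j)) = vts (P j) \<union> vts (C j)" using sib_vts[OF sibs[of j]] Suc.prems by simp
  thus ?case using Suc by (auto simp: lessThan_Suc)
qed simp

text \<open>This is \<open>path_boundary\<close>, with \<open>no_large_full\<close> excluding full
  side branches. The latter works only down to depth \<open>7 * W\<close>, so a path that is too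
  long is first cut.\<close>

lemma short_path:
  assumes i: "i < m" and up: "up (C i) n p" and n: "suffix v n" "dp n \<le> 6 * W"
    and safe: "safe (C i) S' p" and d: "dl (C i) S' < \<kappa>"
  shows "real (length p) - real (length n) \<le> 3 * dl (C i) S'"
proof (rule ccontr)
  assume no: "\<not> ?thesis"
  have np: "suffix n p" using up by (simp add: up_def)
  have len: "length n \<le> length p" by (rule suffix_length_le[OF np])
  have lC: "labels (C i) \<subseteq> edges G" "labels (C i) \<noteq> edges G" by (rule lsub[OF C_subt[OF i]])+
  have pos: "0 \<le> dl (C i) S'" using dl_ge_third[OF lC safe] by linarith
  \<comment> \<open>The least length exceeding the bound; since
    \<open>3 * \<kappa> + 1 \<le> W\<close>, the cut path stays within depth
    \<open>7 * W\<close>.\<close>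
  define n0 where "n0 = nat \<lfloor>3 * dl (C i) S'\<rfloor> + 1"
  have n0: "3 * dl (C i) S' < real n0" "real n0 \<le> 3 * dl (C i) S' + 1" using pos unfolding n0_def by linarith+
  have n0l: "length n + n0 \<le> length p" using no n0_def len pos by linarith
  let ?p = "drop (length p - length n - n0) p"
  have lp: "length ?p = length n + n0" using n0l by simp
  have sp: "suffix ?p p" by (rule suffix_drop)
  have np': "suffix n ?p" by (rule suffix_length_suffix[OF np sp]) (simp only: lp le_add1)
  have up': "up (C i) n ?p"
    using up np' suffix_trans[OF _ sp] unfolding up_def by blast
  have s': "safe (C i) S' ?p" by (rule safe_conn[OF safe up_conn[OF up np' sp]])
  have side: "\<not> full (C i) ((\<not> b) # z)" if z: "suffix n z" "suffix (b # z) ?p" for z b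
  proof (rule no_large_full[OF i])
    show "suffix v ((\<not> b) # z)" using suffix_trans[OF n(1) z(1)] by (rule suffix_ConsI)
    have "length (b # z) \<le> length n + n0" using suffix_length_le[OF z(2)] lp by simp
    hence "dp ((\<not> b) # z) \<le> dp n + real n0" by simp
    thus "dp ((\<not> b) # z) \<le> 7 * W" using n(2) n0(2) d W(1) unfolding \<kappa>_def by linarith
  qed
  have "real (length ?p - length n) \<le> 3 * dl (C i) S'"
    by (rule path_boundary[OF lC(1) up' s' side])
  thus False using n0(1) unfolding lp by simp
qed

text \<open>
  The two gains \<open>g1\<close> and \<open>g2\<close> come from alternate links of a sequence of components
  \<open>c\<close>, each touching its successor, that leads from \<open>p\<close> to the boundary of the subtree at \<open>y1\<close>; links
  that are not adjacent belong to disjoint parts of the chain, so that their gains add up.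
\<close>

lemma shallow:
  assumes y1: "suffix v y1" "dp y1 \<le> W" "\<not> touch (P 0) y1"
    and nofloat: "\<And>i p. i < m \<Longrightarrow> suffix y1 p \<Longrightarrow> \<not> safe (C i) (S \<union> vts (P i)) p"
  shows "i < m \<Longrightarrow> p \<in> vts (C i) \<Longrightarrow> suffix y1 p \<Longrightarrow> \<exists>g1 g2. 0 \<le> g1 \<and> 0 \<le> g2 \<and>
     lb (P (Suc i)) S (c0 * (H - dp w1) + g1) \<and> lb (P i) S (c0 * (H - dp w1) + g2) \<and>
     real (length p) - real (length y1) \<le> 3 * \<kappa> + 3 * (g1 + g2)"
proof (induction i arbitrary: p rule: less_induct)
  case (less i)
  note i = less.prems(1) and p = less.prems(2,3)
  have CA: "C i \<in> subt A" by (rule C_subt[OF i])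
  note lC = lsub[OF CA]
  have vp: "suffix v p" by (rule suffix_trans[OF y1(1) p(2)])
  have sp: "safe (C i) S p" by (rule safe_in[OF CA p(1) vp])
  show ?case
  proof (cases "\<exists>x. (p, x) \<in> conn (C i) \<and> \<not> suffix y1 x")
    case True
    then obtain x where "(p, x) \<in> conn (C i)" "\<not> suffix y1 x" by blast
    hence up: "up (C i) y1 p" using conn_exit[OF lC(1) _ p(2)] by blast
    have small: "dl (C i) S < \<kappa>" by (rule sibling_small[OF i])
    have "dp y1 \<le> 6 * W" using y1(2) W(1) by linarith
    from short_path[OF i up y1(1) this sp small] small
    have "real (length p) - real (length y1) \<le> 3 * \<kappa> + 3 * (0 + 0)" by argo
    moreover have "lb (P (Suc i)) S (c0 * (H - dp w1) + 0)" "lb (P i) S (c0 * (H - dp w1) + 0)"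
      using lb_P[of 0, OF _ _ lb_bottom] i by simp_all
    ultimately show ?thesis by blast
  next
    case False
    hence inside: "\<And>x. (p, x) \<in> conn (C i) \<Longrightarrow> suffix y1 x" by blast
    let ?Q = "\<lambda>j. \<exists>x. (p, x) \<in> conn (C i) \<and> x \<in> vts (P j)"
    have Qi: "?Q i"
      using nofloat[OF i p(2)] sp p(1) unfolding safe_def by blast
    \<comment> \<open>The first stage that the component of \<open>p\<close> meets. With
      \<open>j = Suc l\<close> it meets the sibling \<open>C l\<close> but avoids
      \<open>P l\<close>.\<close>
    define j where "j = (LEAST j. ?Q j)"
    have Qj: "?Q j" unfolding j_def by (rule LeastI[of ?Q, OF Qi])
    have ji: "j \<le> i" unfolding j_def by (rule Least_le[of ?Q, OF Qi])
    have less_j: "\<not> ?Q l" if "l < j" for l using not_less_Least[of l ?Q] that unfolding j_def by blast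
    have "j \<noteq> 0"
    proof
      assume "j = 0"
      thus False using Qj inside y1(3) unfolding touch_def by blast
    qed
    then obtain l where l: "j = Suc l" by (cases j) auto
    obtain x where x: "(p, x) \<in> conn (C i)" "x \<in> vts (P j)" using Qj by blast
    have lm: "l < m" and li: "l < i" using ji i l by simp_all
    have "x \<notin> vts (P l)" using less_j[of l] l x(1) by blast
    hence xC: "x \<in> vts (C l)" using x(2) sib_vts[OF sibs[OF lm]] l by blast
    obtain g1 g2 where g: "0 \<le> g1" "0 \<le> g2" "lb (P (Suc l)) S (c0 * (H - dp w1) + g1)"
        "lb (P l) S (c0 * (H - dp w1) + g2)" "real (length x) - real (length y1) \<le> 3 * \<kappa> + 3 * (g1 + g2)"
      using less.IH[OF li lm xC inside[OF x(1)]] by blast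
    let ?S = "S \<union> vts (P l)"
    have s: "safe (C i) ?S p"
      using sp less_j[of l] l unfolding safe_def by blast
    have dpos: "0 \<le> dl (C i) ?S" using dl_ge_third[OF lC s] by linarith
    \<comment> \<open>The two gains swap roles: the new link avoids \<open>P l\<close> and adds to
      \<open>g2\<close>, which was obtained there, while \<open>g1\<close> is carried from
      \<open>P (Suc l)\<close> up to \<open>P i\<close>.\<close>
    have "lb (P (Suc i)) S (c0 * (H - dp w1) + g2 + dl (C i) ?S)"
      by (rule lb_gain[OF less_imp_le[OF li] i g(4)])
    hence lb1: "lb (P (Suc i)) S (c0 * (H - dp w1) + (g2 + dl (C i) ?S))" by (simp add: add.assoc)
    have lb2: "lb (P i) S (c0 * (H - dp w1) + g1)"
      by (rule lb_P[OF _ _ g(3)]) (use li i in simp_all)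
    have gs: "g1 < 4 * W / 1000000" "g2 + dl (C i) ?S < 4 * W / 1000000"
      using no_large_gain[OF P_subt lb2] no_large_gain[OF P_subt lb1] i by simp_all
    \<comment> \<open>From \<open>p\<close> up to the meeting point \<open>n\<close> the path is
      short, and \<open>n\<close> is no deeper than \<open>x\<close>, whose depth the induction
      hypothesis controls.\<close>
    obtain n where n: "up (C i) n p" "up (C i) n x" using conn_meet[OF lC(1) x(1)] by blast
    have "(p, n) \<in> conn (C i)" by (rule up_conn[OF n(1)]) (use n(1) in \<open>simp_all add: up_def\<close>)
    hence yn: "suffix y1 n" by (rule inside)
    have vn: "suffix v n" by (rule suffix_trans[OF y1(1) yn])
    have nx: "length n \<le> length x" using n(2) suffix_length_le[of n x] by (simp add: up_def)
    hence nx': "real (length n) \<le> real (length x)" by simp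
    hence dn: "dp n \<le> 6 * W" using g(2,5) gs y1(2) dpos W(1) unfolding \<kappa>_def by argo
    have dk: "dl (C i) ?S < \<kappa>" using gs(2) g(2) W(1) unfolding \<kappa>_def by linarith
    have "real (length p) - real (length n) \<le> 3 * dl (C i) ?S"
      by (rule short_path[OF i n(1) vn dn s dk])
    hence "real (length p) - real (length y1) \<le> 3 * \<kappa> + 3 * ((g2 + dl (C i) ?S) + g1)"
      using g(5) nx' by argo
    moreover have "0 \<le> g2 + dl (C i) ?S" using g(2) dpos by simp
    ultimately show ?thesis using lb1 lb2 g(1) by blast
  qed
qed

text \<open>Components of a sibling not touching the part of the chain below it are gained all at once.\<close>

lemma floating_small: "(\<Sum>i<m. dl (C i) (S \<union> vts (P i))) < \<kappa>"
proof -
  have "j \<le> m \<Longrightarrow> lb (P j) S (c0 * (H - dp w1) + (\<Sum>i<j. dl (C i) (S \<union> vts (P i))))" for j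
  proof (induction j)
    case (Suc j)
    have "lb (P j) S (c0 * (H - dp w1) + (\<Sum>i<j. dl (C i) (S \<union> vts (P i))))"
      using Suc by simp
    from lb_gain[OF order_refl _ this] Suc.prems show ?case by (simp add: add.assoc)
  qed (use lb_bottom in simp)
  from no_large_gain[OF top this[OF order_refl]] show ?thesis using W(1) unfolding \<kappa>_def by linarith
qed

text \<open>Among the nodes \<open>r0\<close> levels below \<open>u1\<close>, fewer than all are
  touched by \<open>P 0\<close> or by components of siblings that float free of the chain below
  them. Below a remaining node \<open>y1\<close>, \<open>shallow\<close> limits the depth of every
  sibling, yet \<open>P m\<close> touches a node \<open>N\<close> levels deeper.\<close>

lemma contradiction:
  assumes u1: "suffix v u1" "dp u1 + real r0 \<le> W"
    and nf: "\<And>y. y \<in> level u1 r0 \<Longrightarrow> \<not> full (P 0) y"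
    and r0: "3 * W / 1000 + 3 * \<kappa> < 2 ^ r0" and N: "9 * \<kappa> < real N"
    and t: "\<And>y. y \<in> level u1 (r0 + N) \<Longrightarrow> touch (P m) y"
  shows False
proof -
  let ?L = "level u1 r0"
  have vL: "suffix v y" if "y \<in> ?L" for y by (rule suffix_trans[OF u1(1) level_suffix[OF that]])
  have dL: "dp y \<le> W" if "y \<in> ?L" for y using level_length[OF that] u1(2) by simp
  define B0 where "B0 = {y \<in> ?L. touch (P 0) y}"
  define B where "B i = {y \<in> ?L. \<exists>p. suffix y p \<and> safe (C i) (S \<union> vts (P i)) p}" for i
  have fin: "finite B0" "finite (B i)" for i
    unfolding B0_def B_def by (rule finite_subset[OF _ finite_level], blast)+
  have P0: "P 0 \<in> subt A" using P_subt by simp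
  have B0: "real (card B0) \<le> 3 * dl (P 0) S"
  proof (rule card_touched_le[OF lsub(1)[OF P0] fin(1)])
    fix y assume y: "y \<in> B0"
    hence yL: "y \<in> ?L" "touch (P 0) y" unfolding B0_def by auto
    show "length y = length u1 + r0" by (rule level_length[OF yL(1)])
    show "\<exists>p. suffix y p \<and> safe (P 0) S p" by (rule touch_safe[OF P0 vL[OF yL(1)] yL(2)])
    show "\<not> full (P 0) y" by (rule nf[OF yL(1)])
  qed
  have Bi: "real (card (B i)) \<le> 3 * dl (C i) (S \<union> vts (P i))" if i: "i < m" for i
  proof (rule card_touched_le[OF lsub(1)[OF C_subt[OF i]] fin(2)])
    fix y assume y: "y \<in> B i"
    hence yL: "y \<in> ?L" unfolding B_def by simp
    show "length y = length u1 + r0" by (rule level_length[OF yL])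
    show "\<exists>p. suffix y p \<and> safe (C i) (S \<union> vts (P i)) p" using y unfolding B_def by simp
    show "\<not> full (C i) y" by (rule no_large_full[OF i vL[OF yL]]) (use dL[OF yL] W(1) in linarith)
  qed
  have "real (card (B0 \<union> (\<Union>i<m. B i))) \<le> real (card B0) + (\<Sum>i<m. real (card (B i)))"
    using card_Un_le[of B0 "\<Union>i<m. B i"] card_UN_le[of "{..<m}" B] by (simp flip: of_nat_sum)
  also have "(\<Sum>i<m. real (card (B i))) \<le> (\<Sum>i<m. 3 * dl (C i) (S \<union> vts (P i)))"
    by (rule sum_mono) (use Bi in simp)
  also have "\<dots> = 3 * (\<Sum>i<m. dl (C i) (S \<union> vts (P i)))" by (simp only: sum_distrib_left)
  finally have "real (card (B0 \<union> (\<Union>i<m. B i))) < 2 ^ r0"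
    using B0 floating_small low r0 by linarith
  hence "B0 \<union> (\<Union>i<m. B i) \<noteq> ?L" using card_level[of u1 r0] by auto
  moreover have "B0 \<union> (\<Union>i<m. B i) \<subseteq> ?L" unfolding B0_def B_def by blast
  ultimately obtain y1 where y1: "y1 \<in> ?L" "y1 \<notin> B0" "\<And>i. i < m \<Longrightarrow> y1 \<notin> B i" by blast
  have nt: "\<not> touch (P 0) y1" using y1(1,2) unfolding B0_def by blast
  have nofloat: "\<not> safe (C i) (S \<union> vts (P i)) p" if "i < m" "suffix y1 p" for i p
    using y1(1) y1(3)[OF that(1)] that(2) unfolding B_def by blast
  let ?y = "replicate N True @ y1"
  have yy: "suffix y1 ?y" by (simp add: suffix_def)
  have "?y \<in> level u1 (r0 + N)"
    using suffix_trans[OF level_suffix[OF y1(1)] yy] level_length[OF y1(1)] by (simp add: level_def)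
  then obtain p where p: "p \<in> vts (P m)" "suffix ?y p" using t unfolding touch_def by blast
  have yp: "suffix y1 p" by (rule suffix_trans[OF yy p(2)])
  have "p \<notin> vts (P 0)" using nt yp unfolding touch_def by blast
  then obtain i where i: "i < m" "p \<in> vts (C i)" using p(1) vts_P[of m] by auto
  obtain g1 g2 where g: "lb (P (Suc i)) S (c0 * (H - dp w1) + g1)" "lb (P i) S (c0 * (H - dp w1) + g2)"
      "real (length p) - real (length y1) \<le> 3 * \<kappa> + 3 * (g1 + g2)"
    using shallow[OF vL[OF y1(1)] dL[OF y1(1)] nt nofloat i yp] by blast
  have "g1 < 4 * W / 1000000" "g2 < 4 * W / 1000000"
    using no_large_gain[OF P_subt g(1)] no_large_gain[OF P_subt g(2)] i(1) by simp_all
  moreover have "real N \<le> real (length p) - real (length y1)" using suffix_length_le[OF p(2)] by simp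
  ultimately show False using g(3) N W(1) unfolding \<kappa>_def by argo
qed

end

section \<open>No subtree is scattered, and no counterexample exists\<close>

context counterexample
begin

lemma engine:
  assumes Z: "Z \<in> subt A" "tame Z" and path: "path (\<lambda>P. W / 3000 \<le> dl P S) X Z" and X: "X \<noteq> A"
    and w1: "full X w1" "suffix v w1" "dp w1 \<le> 3 * W" and low: "dl X S < W / 1000"
    and W: "333 \<le> W" "1000 * q \<le> W" "12 * W + 10 \<le> H"
    and u1: "suffix v u1" "dp u1 + real r0 \<le> W"
    and nf: "\<And>y. y \<in> level u1 r0 \<Longrightarrow> \<not> full X y"
    and r0: "4 * W / 1000 \<le> real r0"
    and t: "\<And>y d. y \<in> level u1 d \<Longrightarrow> real d \<le> real r0 + W / 1000 + 2 \<Longrightarrow> touch Z y"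
  shows False
proof -
  obtain m :: nat and P C where ch: "P 0 = X" "P m = Z"
      "\<forall>i<m. sib (P (Suc i)) (P i) (C i) \<and> W / 3000 \<le> dl (P (Suc i)) S"
    using path_chain[OF path] by blast
  interpret chain k A S v q m P C w1 W
    by unfold_locales (use ch Z X w1 low W in simp_all)
  define N where "N = nat \<lceil>W / 1000\<rceil> + 1"
  have N: "W / 1000 < real N" "real N < W / 1000 + 2" using W(1) unfolding N_def by linarith+
  show False
  proof (rule contradiction[OF u1])
    show "\<not> full (P 0) y" if "y \<in> level u1 r0" for y using nf[OF that] ch(1) by simp
    have "3 * W / 1000 + 3 * \<kappa> \<le> real r0" using r0 W(1) unfolding \<kappa>_def by argo
    thus "3 * W / 1000 + 3 * \<kappa> < 2 ^ r0" by (rule less_power)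
    show "9 * \<kappa> < real N" using N(1) W(1) unfolding \<kappa>_def by argo
    show "touch (P m) y" if "y \<in> level u1 (r0 + N)" for y
      using t[OF that] N(2) ch(2) by simp
  qed
qed

text \<open>A smallest scattered \<open>Z\<close> is tame. Inside it, \<open>tight\<close> gives a
  subtree of small Delta, while \<open>Z\<close> touches all nodes less than \<open>f\<close> levels
  below \<open>u\<close> and is full at none; \<open>engine\<close> refutes this halfway
  down.\<close>

lemma not_scattered: "\<not> scattered Z u f"
proof
  assume "scattered Z u f"
  hence "\<exists>u f. scattered Z u f" by blast
  then obtain Z where ex: "\<exists>u f. scattered Z u f"
    and min: "\<And>Z'. \<exists>u f. scattered Z' u f \<Longrightarrow> size Z \<le> size Z'"
    using ex_has_least_nat[of "\<lambda>Z. \<exists>u f. scattered Z u f" Z size] by blast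
  have tZ: "tame Z"
    unfolding tame_def using min size_subt by fastforce
  obtain u f where "scattered Z u f" using ex by blast
  then obtain y where Z: "Z \<in> subt A" "Z \<noteq> A" and u: "suffix v u" "real f \<ge> 1000 * q + dp u"
    and y: "y \<in> level u f" "full Z y"
    and sc: "\<And>d y. d < f \<Longrightarrow> y \<in> level u d \<Longrightarrow> touch Z y \<and> \<not> full Z y"
    unfolding scattered_def by blast
  have vy: "suffix v y" by (rule suffix_trans[OF u(1) level_suffix[OF y(1)]])
  have dy: "dp y = dp u + real f" using level_length[OF y(1)] by simp
  have du: "0 \<le> dp u" by (rule dp_nonneg[OF u(1)])
  \<comment> \<open>Then \<open>W / 1000\<close> is precisely the bound on Delta that
    \<open>tight\<close> gives at \<open>y\<close>.\<close>
  define W where "W = 1000 * q + dp y"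
  have f333: "333 \<le> real f" using u(2) du q3 by linarith
  have Wf: "real f \<le> W" "W \<le> 3 * real f" "333 \<le> W" "1000 * q \<le> W"
    using u(2) du q3 f333 unfolding W_def dy by linarith+
  let ?M = "\<lambda>X. X \<in> subt Z \<and> (\<exists>w. suffix y w \<and> full X w \<and> dp w < 2 * dp y + 1000 * q) \<and> dl X S < W / 1000"
  obtain X0 where "?M X0" using tight[OF Z y(2) vy] unfolding W_def add_divide_distrib by auto
  moreover have "\<forall>X. ?M X \<longrightarrow> size X < Suc (size Z)"
  proof (intro allI impI)
    fix X assume "?M X"
    hence "X \<in> subt Z" by (rule conjunct1)
    thus "size X < Suc (size Z)" using size_subt[of X Z] by auto
  qed
  \<comment> \<open>A largest \<open>X\<close> of small Delta: every node above it in
    \<open>Z\<close> is still full at \<open>w\<close>, so it must have large Delta, as a chain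
    requires.\<close>
  ultimately have "\<exists>X. ?M X \<and> (\<forall>X'. ?M X' \<longrightarrow> size X' \<le> size X)"
    by (rule ex_has_greatest_nat[where P = ?M and f = size])
  then obtain X where X: "?M X" and max: "\<And>X'. ?M X' \<Longrightarrow> size X' \<le> size X" by blast
  from X obtain w where w: "suffix y w" "full X w" "dp w < 2 * dp y + 1000 * q" by blast
  have lZ: "labels Z \<subseteq> edges G" by (rule lsub[OF Z(1)])
  have fd: "real f \<le> 3 * dl Z S"
  proof -
    have f1: "f \<ge> 1" using f333 by linarith
    have "real (card (level u (f - 1))) \<le> 3 * dl Z S"
    proof (rule card_touched_le[OF lZ finite_level level_length])
      fix y' assume y': "y' \<in> level u (f - 1)"
      have sc': "touch Z y' \<and> \<not> full Z y'" by (rule sc[OF _ y']) (use f1 in simp)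
      show "\<exists>p. suffix y' p \<and> safe Z S p"
        using touch_safe[OF Z(1) suffix_trans[OF u(1) level_suffix[OF y']]] sc' by blast
      show "\<not> full Z y'" using sc' by blast
    qed
    moreover have "f - 1 < 2 ^ (f - 1)" by (rule less_exp)
    hence "f \<le> 2 ^ (f - 1)" using f1 by linarith
    hence "real f \<le> 2 ^ (f - 1)" by (simp flip: of_nat_power of_nat_le_iff)
    ultimately show ?thesis unfolding card_level of_nat_power of_nat_numeral by linarith
  qed
  have "dl Z S < H / 900000" using dl_less[OF Z(1)] target_less by linarith
  hence room: "12 * W + 10 \<le> H" using fd Wf f333 by argo
  have "path (\<lambda>P. W / 3000 \<le> dl P S) X Z"
  proof (rule subt_path)
    show "X \<in> subt Z" using X by blast
    fix P assume P: "P \<in> subt Z" "X \<in> subt P" "P \<noteq> X"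
    hence "size X < size P" using size_subt by blast
    hence "\<not> ?M P" using max by fastforce
    moreover have "full P w" by (rule full_mono[OF labels_subt[OF P(2)] w(2)])
    ultimately have "W / 1000 \<le> dl P S" using P(1) w by fastforce
    thus "W / 3000 \<le> dl P S" using Wf(3) by argo
  qed
  moreover have XA: "X \<noteq> A" using X size_subt[of X Z] size_subt[OF Z(1)] Z(2) by fastforce
  moreover have "suffix v w" by (rule suffix_trans[OF vy w(1)])
  moreover have "dp w \<le> 3 * W" using w(3) dp_nonneg[OF vy] q3 unfolding W_def by argo
  moreover have "dl X S < W / 1000" using X by blast
  moreover have "dp u + real (f div 2) \<le> W"
  proof -
    have "real (f div 2) \<le> real f" by simp
    thus ?thesis using q3 unfolding W_def dy by linarith
  qed
  moreover have "\<not> full X y'" if y': "y' \<in> level u (f div 2)" for y'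
  proof -
    have "f div 2 < f" using f333 by (intro div_less_dividend) auto
    hence "\<not> full Z y'" using sc[OF _ y'] by blast
    thus ?thesis using full_mono[OF labels_subt] X by blast
  qed
  moreover have h: "2 * real (f div 2) \<le> real f" "real f \<le> 2 * real (f div 2) + 1" by linarith+
  hence "4 * W / 1000 \<le> real (f div 2)" using Wf(2) f333 by argo
  moreover have "touch Z y'" if y': "y' \<in> level u d" "real d \<le> real (f div 2) + W / 1000 + 2" for y' d
  proof -
    have "real d < real f" using y'(2) h Wf(2) f333 by argo
    hence "d < f" by simp
    thus ?thesis using sc[OF _ y'(1)] by blast
  qed
  ultimately show False
    using engine[OF Z(1) tZ, of W X w u "f div 2"] w(2) Wf(3,4) room u(1) by blast
qed

lemma impossible: False
proof -
  have tA: "tame A" using not_scattered unfolding tame_def by blast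
  \<comment> \<open>About \<open>100 * q\<close> levels are enough room for
    \<open>r0 = e0 - 1\<close> in \<open>engine\<close>, yet few enough to keep
    \<open>W \<le> 2300 * q\<close>.\<close>
  define e0 where "e0 = nat \<lceil>100 * q\<rceil>"
  have e0: "100 * q \<le> real e0" "real e0 < 100 * q + 1" "e0 \<ge> 1" using q3 unfolding e0_def by linarith+
  have rk: "length v + e0 \<le> k" using e0(2) H_large q3 unfolding H_def by linarith
  have AA: "A \<in> subt A" by simp
  obtain P D C u' d y where P: "P \<in> subt A" "sib P D C" "full P u'" "suffix v u'" "length u' < length v + e0"
      "y \<in> level u' d" "full D y" "real d < 1000 * q + dp u'"
    and nD: "\<And>y. suffix v y \<Longrightarrow> length y < length v + e0 \<Longrightarrow> \<not> full D y"
    using descend[OF AA tA fullA _ _ rk] e0(3) by auto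
  have DA: "D \<in> subt A" by (rule subt_trans[OF sib_subt(1)[OF P(2)] P(1)])
  have DnA: "D \<noteq> A" using sib_size(1)[OF P(2)] size_subt[OF P(1)] by auto
  have vy: "suffix v y" by (rule suffix_trans[OF P(4) level_suffix[OF P(6)]])
  have du': "dp u' < real e0" using P(5) by linarith
  have dy: "dp y = dp u' + real d" using level_length[OF P(6)] by simp
  define W where "W = 1000 * q + dp y"
  have W: "W \<le> 2300 * q" "333 \<le> W" "1000 * q \<le> W"
    using dp_nonneg[OF vy] dy du' P(8) e0(2) q3 unfolding W_def by linarith+
  let ?M = "\<lambda>X. X \<in> subt D \<and> (\<exists>w. suffix y w \<and> full X w \<and> dp w < 2 * dp y + 1000 * q) \<and> dl X S < W / 1000"
  obtain X0 where "?M X0" using tight[OF DA DnA P(7) vy] unfolding W_def add_divide_distrib by auto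
  moreover have "\<forall>X. ?M X \<longrightarrow> size X < Suc (size D)"
  proof (intro allI impI)
    fix X assume "?M X"
    hence "X \<in> subt D" by (rule conjunct1)
    thus "size X < Suc (size D)" using size_subt[of X D] by auto
  qed
  ultimately have "\<exists>X. ?M X \<and> (\<forall>X'. ?M X' \<longrightarrow> size X' \<le> size X)"
    by (rule ex_has_greatest_nat[where P = ?M and f = size])
  then obtain X where X: "?M X" and max: "\<And>X'. ?M X' \<Longrightarrow> size X' \<le> size X" by blast
  from X obtain w where w: "suffix y w" "full X w" "dp w < 2 * dp y + 1000 * q" by blast
  let ?Q = "\<lambda>P. W / 3000 \<le> dl P S"
  have p1: "path ?Q X D"
  proof (rule subt_path)
    show "X \<in> subt D" using X by blast
    fix P assume P: "P \<in> subt D" "X \<in> subt P" "P \<noteq> X"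
    hence "size X < size P" using size_subt by blast
    hence "\<not> ?M P" using max by fastforce
    moreover have "full P w" by (rule full_mono[OF labels_subt[OF P(2)] w(2)])
    ultimately have "W / 1000 \<le> dl P S" using P(1) w by fastforce
    thus "W / 3000 \<le> dl P S" using W(2) by argo
  qed
  \<comment> \<open>From \<open>P\<close> upwards Delta is large by persistence of \<open>A\<close>,
    not by maximality of \<open>X\<close>: it is at least \<open>q\<close>, which exceeds
    \<open>W / 3000\<close> because \<open>W \<le> 2300 * q\<close>.\<close>
  have up: "?Q P'" if P': "P' \<in> subt A" "P \<in> subt P'" for P'
  proof -
    have "full P' u'" by (rule full_mono[OF labels_subt[OF P'(2)] P(3)])
    moreover have "dp u' < 1000 * q" using du' e0(2) q3 by linarith
    ultimately have "q \<le> dl P' S" using dl_ge_q[OF P'(1) P(4)] by blast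
    thus ?thesis using W(1) q3 by argo
  qed
  have "path ?Q X P" by (rule path.step[OF p1 P(2) up[OF P(1)]]) simp
  moreover have "path ?Q P A" by (rule subt_path[OF P(1) up])
  ultimately have "path ?Q X A" by (rule path_trans[rotated])
  moreover have "X \<noteq> A" using X size_subt[of X D] size_subt[OF DA] DnA by fastforce
  moreover have "suffix v w" by (rule suffix_trans[OF vy w(1)])
  moreover have "dp w \<le> 3 * W" using w(3) dp_nonneg[OF vy] q3 unfolding W_def by argo
  moreover have "dl X S < W / 1000" using X by blast
  moreover have room: "12 * W + 10 \<le> H" using W(1) H_large q3 by argo
  moreover have r1: "real (e0 - 1) = real e0 - 1" using e0(3) by simp
  have "dp v + real (e0 - 1) \<le> W" unfolding r1 using e0(2) W(3) q3 by argo
  moreover have "\<not> full X y'" if y': "y' \<in> level v (e0 - 1)" for y'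
  proof -
    have "length y' < length v + e0" using level_length[OF y'] e0(3) by simp
    hence "\<not> full D y'" using nD level_suffix[OF y'] by blast
    thus ?thesis using full_mono[OF labels_subt] X by blast
  qed
  moreover have "4 * W / 1000 \<le> real (e0 - 1)" unfolding r1 using e0(1) W(1) q3 by argo
  moreover have "touch A y'" if y': "y' \<in> level v d" "real d \<le> real (e0 - 1) + W / 1000 + 2" for y' d
  proof -
    have "real d \<le> H" using y'(2) e0(2) W(2,3) room unfolding r1 by argo
    hence "length y' \<le> k" using level_length[OF y'(1)] unfolding H_def by linarith
    thus ?thesis using full_touch full_suffix[OF fullA level_suffix[OF y'(1)]] by blast
  qed
  moreover have "suffix v v" by simp
  ultimately show False
    using engine[OF AA tA, of W X w v "e0 - 1"] w(2) W(2,3) by blast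
qed

end

section \<open>The lower bound\<close>

context binary_tree
begin

lemma lower_bound: "persistent A S v q \<Longrightarrow> claim A S v q"
proof (induction "size A" arbitrary: A S v q rule: less_induct)
  case less
  show ?case
  proof (rule ccontr)
    assume "\<not> claim A S v q"
    then interpret counterexample k A S v q
      by unfold_locales (use less in auto)
    show False by (rule impossible)
  qed
qed

lemma vertex_in_edge: "length x \<le> k \<Longrightarrow> x \<in> \<Union> (edges G)"
proof (cases x)
  case Nil
  have "{[], True # []} \<in> edges G" using k edge_iff by fastforce
  thus ?thesis using Nil by blast
next
  case (Cons b p)
  assume "length x \<le> k"
  hence "{p, b # p} \<in> edges G" using Cons edge_iff by auto
  thus ?thesis using Cons by blast
qed

text \<open>\<open>lower_bound\<close> concerns proper subgraphs only, so a smallest subtree with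
  all edges is split into its children. Either a child is full at a node in the upper half, and
  \<open>lower_bound\<close> applies there, or it touches exponentially many subtrees without
  containing one, and \<open>LB_Delta\<close> suffices.\<close>

lemma tau_bound: "tau_bound G (real k / 10 ^ 7)"
  unfolding tau_bound_def
proof (intro conjI exI[of _ \<theta>] allI impI threshold)
  fix A n \<A>
  assume A: "join_tree_over G A" "graph_of A = G" and n: "n > 0" and sub: "\<A> \<subseteq> cube n (verts G)"
  have lA: "labels A = edges G" using A(2) by (metis edges_graph_of)
  have vA: "vts A = verts G" using A(2) by (metis verts_graph_of)
  have "lb A {} (real k / 10 ^ 7)"
  proof -
    let ?M = "\<lambda>P. P \<in> subt A \<and> labels P = edges G"
    obtain P where P: "?M P" and Pmin: "\<And>P'. ?M P' \<Longrightarrow> size P \<le> size P'"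
      using ex_has_least_nat[of ?M A size] lA by auto
    have "[] \<in> vts P" using P vertex_in_edge[of "[]"] by simp
    hence fP: "full P []" using P unfolding full_def by (auto simp: edge_iff)
    then obtain B C where sib: "sib P B C" using nonatomic[of P "[]"] k by auto
    have sub_P: "D \<in> subt A" if "sib P D D'" for D D'
      using subt_trans[OF sib_subt(1)[OF that]] P by blast
    have lD: "labels D \<subseteq> edges G" if "sib P D D'" for D D'
      using labels_subt[OF sub_P[OF that]] lA by simp
    have nD: "labels D \<noteq> edges G" if "sib P D D'" for D D'
      using Pmin[of D] sub_P[OF that] sib_size(1)[OF that] by fastforce
    have nf: "\<not> full D []" if "sib P D D'" for D D'
      using full_root[OF _ lD[OF that]] nD[OF that] by blast
    note sib' = sib_commute[OF sib]
    have lP: "labels P \<subseteq> edges G" using P by simp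
    obtain d y where d: "d \<ge> 1" "y \<in> level [] d" "full B y \<or> full C y"
      and less: "\<forall>d'<d. \<forall>y\<in>level [] d'. \<not> full B y \<and> \<not> full C y \<and> touch B y \<and> touch C y"
      using split_full[OF sib lP fP nf[OF sib] nf[OF sib']] by (elim exE conjE) (rule that)
    obtain D D' where D: "sib P D D'" "full D y" "\<forall>d'<d. \<forall>y\<in>level [] d'. touch D y \<and> \<not> full D y"
    proof -
      from d(3) show ?thesis
      proof
        assume "full B y"
        from that[OF sib this] less show ?thesis by simp
      next
        assume "full C y"
        from that[OF sib' this] less show ?thesis by simp
      qed
    qed
    note DA = sub_P[OF D(1)] and ld = lD[OF D(1)] and nd = nD[OF D(1)]
    have safe: "safe D {} x" if "x \<in> vts D" for x using that by (simp add: safe_def)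
    show ?thesis
    proof (cases "2 * d \<le> k")
      case True
      have yD: "y \<in> vts D" using D(2) by (simp add: full_def)
      have "persistent D {} y (1 / 3)"
        unfolding persistent_def
      proof (intro conjI ballI allI impI)
        fix X w assume X: "X \<in> subt D" and f: "full X w"
        have "safe X {} w" using f by (simp add: full_def safe_def)
        moreover have "labels X \<subseteq> edges G" "labels X \<noteq> edges G"
          using labels_subt[OF X] ld nd by blast+
        ultimately show "1 / 3 \<le> dl X {}" by (intro dl_ge_third)
      qed (use ld nd D(2) safe[OF yD] in simp_all)
      hence "claim D {} y (1 / 3)" by (rule lower_bound)
      hence "lb D {} (real k / 10 ^ 7)"
        unfolding claim_def
      proof (rule LB_mono)
        have c0: "c0 * (real k - real (length y)) = (real k - real (length y)) / 1000000"
          "real k / 10 ^ 7 = real k / 10000000" by (simp_all add: c0_def)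
        have "real (length y) \<le> real k / 2" "0 \<le> real k" using level_length[OF d(2)] True by simp_all
        thus "real k / 10 ^ 7 \<le> c0 * (real k - real (length y)) + 1 / 3 / 1000"
          using c0 by argo
      qed
      from LB_subt[OF DA _ this] show ?thesis using lA by simp
    next
      case False
      \<comment> \<open>Level \<open>d - 1\<close> is the last one that \<open>D\<close> touches
        everywhere without being full; its \<open>2 ^ (d - 1) \<ge> d\<close> nodes give a Delta
        linear in \<open>k\<close>.\<close>
      have "real (card (level [] (d - 1))) \<le> 3 * dl D {}"
      proof (rule card_touched_le[OF ld finite_level level_length])
        fix y' assume y': "y' \<in> level [] (d - 1)"
        have "d - 1 < d" using d(1) by simp
        hence *: "touch D y' \<and> \<not> full D y'" using D(3) y' by blast
        show "\<exists>p. suffix y' p \<and> safe D {} p" using * safe unfolding touch_def by blast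
        show "\<not> full D y'" using * by blast
      qed
      moreover have "d - 1 < 2 ^ (d - 1)" by (rule less_exp)
      hence "d \<le> 2 ^ (d - 1)" using d(1) by linarith
      hence "real d \<le> 2 ^ (d - 1)" by (simp flip: of_nat_power of_nat_le_iff)
      ultimately have "real d \<le> 3 * dl D {}"
        unfolding card_level of_nat_power of_nat_numeral by linarith
      moreover have "real k \<le> 2 * real d" using False by linarith
      ultimately have "real k / 10 ^ 7 \<le> dl D {}" by simp
      from LB_mono[OF LB_Delta[OF ld] this] have "lb D {} (real k / 10 ^ 7)" by simp
      from LB_subt[OF DA _ this] show ?thesis using lA by simp
    qed
  qed
  hence "real n powr (real k / 10 ^ 7) * mu n (vts A - {}) (sec (vts A) (vts A) {} \<A> (\<lambda>_. undefined))
      \<le> real (chi G \<theta> n {} A \<A>)"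
    unfolding LB_def by (rule allE[where x = n]) (use n sub vA in simp)
  moreover have "sec (vts A) (vts A) {} \<A> (\<lambda>_. undefined) = \<A>"
  proof -
    have "restrict y (vts A) = y" if "y \<in> \<A>" for y
      using subsetD[OF sub that] unfolding vA by (intro extensional_restrict) (simp add: PiE_def)
    thus ?thesis unfolding sec_def by (simp cong: image_cong)
  qed
  ultimately show "real n powr (real k / 10 ^ 7) * mu n (verts G) \<A> \<le> real (chi G \<theta> n {} A \<A>)"
    using vA by simp
qed simp

lemma le_tau: "real k / 10 ^ 7 \<le> tau G"
  unfolding tau_def
proof (rule cSup_upper)
  have "verts G = \<Union> (edges G)"
  proof (rule subset_antisym)
    show "verts G \<subseteq> \<Union> (edges G)"
      using vertex_in_edge by (intro subsetI) (simp only: verts_G)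
    show "\<Union> (edges G) \<subseteq> verts G" using simple_G by (auto simp: simple_graph_def)
  qed
  thus "bdd_above {t. tau_bound G t}"
    by (rule bdd_above_tau_bound[OF finite_graph_complete_binary_tree])
qed (use tau_bound in blast)

end

theorem theorem1p7:
  shows "\<exists>(c::real) (k\<^sub>0::nat). c > 0 \<and> (\<forall>k\<ge>k\<^sub>0. tau (complete_binary_tree k) \<ge> c * real k)"
proof (intro exI conjI allI impI)
  show "(0 :: real) < 1 / 10 ^ 7" by simp
  fix k :: nat assume "k \<ge> 1"
  then interpret binary_tree k by unfold_locales
  show "1 / 10 ^ 7 * real k \<le> tau (complete_binary_tree k)" using le_tau by simp
qed

end
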